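(* Let $d\ge 1$ and let $1\le q\le p\le\infty$. Then there exist two open and smooth subsets $\Omega^m_{p,q}$ and $\Omega^M_{p,q}$ of $\mathbb{R}^d$ such that $$\mathcal{F}_{p,q}(\Omega^m_{p,q})=m(p,q)\qquad\text{and}\qquad \mathcal{F}_{p,q}(\Omega^M_{p,q})=M(p,q).$$ Moreover, if $q<p$, the quantity $M(p,q)$ is finite if and only if $q>d$.
   Context: For $1\le p<\infty$ and a nonempty bounded open set $\Omega\subset\mathbb{R}^d$, $$\lambda_p(\Omega)=\inf\Big\{\frac{\int|\nabla u|^p\,dx}{\int|u|^p\,dx}\ :\ u\in W^{1,p}_0(\Omega)\setminus\{0\}\Big\},$$ where $W_0^{1,p}(\Omega)$ is the closure of $C^1_c(\Omega)$ in $W^{1,p}$ (equivalently the infimum may be taken over $u\in C^1_c(\Omega)\setminus\{0\}$). For a nonempty, possibly unbounded open set, $\lambda_p(\Omega)=\inf\{\lambda_p(A): A\subset\Omega,\ A \text{ bounded, open, nonempty}\}$. For $p=\infty$, the symbol $\lambda_\infty^{1/\infty}(\Omega)$ means $1/\rho(\Omega)$, where $\rho(\Omega)\in(0,+\infty]$ is the inradius of $\Omega$ (the supremum of the radii of balls contained in $\Omega$), with $1/\infty=0$. For $1\le q\le p\le\infty$ set $$\mathcal{F}_{p,q}(\Omega)=\frac{\lambda_p^{1/p}(\Omega)}{\lambda_q^{1/q}(\Omega)},$$ with the convention $\mathcal{F}_{p,q}(\Omega)=+\infty$ if $\lambda_q^{1/q}(\Omega)=0$ and $\lambda_p^{1/p}(\Omega)>0$.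 Define $$m(p,q)=\inf\{\mathcal{F}_{p,q}(\Omega):\Omega\subset\mathbb{R}^d \text{ open},\ \lambda_q(\Omega)>0\},\qquad M(p,q)=\sup\{\mathcal{F}_{p,q}(\Omega):\Omega\subset\mathbb{R}^d \text{ open},\ \lambda_q(\Omega)>0\}\in(0,+\infty],$$ where for $q=\infty$ the condition $\lambda_q(\Omega)>0$ means $\rho(\Omega)<\infty$. The sets $\Omega^m_{p,q},\Omega^M_{p,q}$ may be unbounded and disconnected; "smooth" means having smooth boundary.
   Formalization: The final equivalence "M(p,q) is finite if and only if q>d" is proved except when d=q=1, where it is false: there F_{p,1}(Ω) is the same finite constant for every admissible Ω, so M(p,1) is finite although q>d fails. *)

theory Defs
  imports "HOL-Analysis.Analysis"
begin

section \<open>Functions of class C^k and C^1_c\<close>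

definition partial_deriv :: "'n::finite \<Rightarrow> (real ^ 'n \<Rightarrow> real) \<Rightarrow> real ^ 'n \<Rightarrow> real" where
  "partial_deriv i f x = frechet_derivative f (at x) (axis i 1)"

definition grad :: "(real ^ 'n::finite \<Rightarrow> real) \<Rightarrow> real ^ 'n \<Rightarrow> real ^ 'n" where
  "grad f x = (\<chi> i. partial_deriv i f x)"

text \<open>Meant for open U, and so stated with full (not one-sided) derivatives.\<close>

primrec Ck_on :: "nat \<Rightarrow> (real ^ 'n::finite) set \<Rightarrow> (real ^ 'n \<Rightarrow> real) \<Rightarrow> bool" where
  "Ck_on 0 U f \<longleftrightarrow> continuous_on U f"
| "Ck_on (Suc k) U f \<longleftrightarrow>
     (\<forall>x\<in>U. f differentiable (at x)) \<and> (\<forall>i. Ck_on k U (partial_deriv i f))"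

definition smooth_on :: "(real ^ 'n::finite) set \<Rightarrow> (real ^ 'n \<Rightarrow> real) \<Rightarrow> bool" where
  "smooth_on U f \<longleftrightarrow> (\<forall>k. Ck_on k U f)"

text \<open>Elements of C^1_c(\<Omega>) are extended by zero to the whole space.\<close>

definition C1c :: "(real ^ 'n::finite) set \<Rightarrow> (real ^ 'n \<Rightarrow> real) set" where
  "C1c \<Omega> = {f. Ck_on 1 UNIV f \<and> (\<exists>K. compact K \<and> K \<subseteq> \<Omega> \<and> (\<forall>x. x \<notin> K \<longrightarrow> f x = 0))}"

text \<open>Smooth boundary, by local defining functions. Since the gradient does not vanish,
  the boundary of \<Omega> inside U is exactly the zero set of \<Phi>, and \<Omega> lies locally on one
  side of it.\<close>

definition smooth_boundary :: "(real ^ 'n::finite) set \<Rightarrow> bool" where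
  "smooth_boundary \<Omega> \<longleftrightarrow>
     (\<forall>x\<in>frontier \<Omega>. \<exists>U \<Phi>. open U \<and> x \<in> U \<and> smooth_on U \<Phi> \<and>
        (\<forall>y\<in>U. grad \<Phi> y \<noteq> 0) \<and> \<Omega> \<inter> U = {y \<in> U. \<Phi> y < 0})"

section \<open>Sobolev spaces\<close>

definition Lp_on :: "real \<Rightarrow> (real ^ 'n::finite) set \<Rightarrow> (real ^ 'n \<Rightarrow> 'b::euclidean_space) \<Rightarrow> bool" where
  "Lp_on p \<Omega> f \<longleftrightarrow> f \<in> borel_measurable (lebesgue_on \<Omega>) \<and>
     integrable (lebesgue_on \<Omega>) (\<lambda>x. norm (f x) powr p)"

definition weak_grad ::
    "(real ^ 'n::finite) set \<Rightarrow> (real ^ 'n \<Rightarrow> real) \<Rightarrow> (real ^ 'n \<Rightarrow> real ^ 'n) \<Rightarrow> bool" where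
  "weak_grad \<Omega> u g \<longleftrightarrow>
     (\<forall>f\<in>C1c \<Omega>. \<forall>i. (\<integral>x. u x * partial_deriv i f x \<partial>lebesgue_on \<Omega>)
                     = - (\<integral>x. g x $ i * f x \<partial>lebesgue_on \<Omega>))"

text \<open>A Sobolev function is carried together with (a representative of) its weak gradient g,
  which is unique up to null sets.\<close>

definition W1p ::
    "real \<Rightarrow> (real ^ 'n::finite) set \<Rightarrow> (real ^ 'n \<Rightarrow> real) \<Rightarrow> (real ^ 'n \<Rightarrow> real ^ 'n) \<Rightarrow> bool" where
  "W1p p \<Omega> u g \<longleftrightarrow> Lp_on p \<Omega> u \<and> Lp_on p \<Omega> g \<and> weak_grad \<Omega> u g"

definition W1p0 ::
    "real \<Rightarrow> (real ^ 'n::finite) set \<Rightarrow> (real ^ 'n \<Rightarrow> real) \<Rightarrow> (real ^ 'n \<Rightarrow> real ^ 'n) \<Rightarrow> bool" where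
  "W1p0 p \<Omega> u g \<longleftrightarrow> W1p p \<Omega> u g \<and>
     (\<exists>f. (\<forall>n. f n \<in> C1c \<Omega>) \<and>
        (\<lambda>n. (\<integral>x. \<bar>f n x - u x\<bar> powr p \<partial>lebesgue_on \<Omega>)
            + (\<integral>x. norm (grad (f n) x - g x) powr p \<partial>lebesgue_on \<Omega>)) \<longlonglongrightarrow> 0)"

section \<open>Principal frequencies\<close>

text \<open>Infima are taken in the reals: for the nonempty open sets considered, the sets below
  are nonempty and bounded below by 0.\<close>

definition lambda_bdd :: "real \<Rightarrow> (real ^ 'n::finite) set \<Rightarrow> real" where
  "lambda_bdd p \<Omega> =
     Inf {(\<integral>x. norm (g x) powr p \<partial>lebesgue_on \<Omega>) / (\<integral>x. \<bar>u x\<bar> powr p \<partial>lebesgue_on \<Omega>) | u g.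
            W1p0 p \<Omega> u g \<and> \<not> (AE x in lebesgue_on \<Omega>. u x = 0)}"

definition lambda :: "real \<Rightarrow> (real ^ 'n::finite) set \<Rightarrow> real" where
  "lambda p \<Omega> = Inf {lambda_bdd p A | A. A \<subseteq> \<Omega> \<and> open A \<and> bounded A \<and> A \<noteq> {}}"

definition inradius :: "(real ^ 'n::finite) set \<Rightarrow> ennreal" where
  "inradius \<Omega> = Sup {ennreal r | r. 0 < r \<and> (\<exists>x. ball x r \<subseteq> \<Omega>)}"

text \<open>The quantity \<lambda>_p^{1/p}(\<Omega>) for p in [1,\<infinity>]; note that inverse top = 0 in ennreal.\<close>

definition lambda_root :: "ennreal \<Rightarrow> (real ^ 'n::finite) set \<Rightarrow> ennreal" where
  "lambda_root p \<Omega> =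
     (if p = top then inverse (inradius \<Omega>)
      else ennreal (lambda (enn2real p) \<Omega> powr (1 / enn2real p)))"

definition lambda_pos :: "ennreal \<Rightarrow> (real ^ 'n::finite) set \<Rightarrow> bool" where
  "lambda_pos q \<Omega> \<longleftrightarrow> (if q = top then inradius \<Omega> < top else 0 < lambda (enn2real q) \<Omega>)"

text \<open>In ennreal, a / 0 = top for a > 0, which is the convention wanted here. The quotient has
  no meaning when both terms vanish (ennreal then returns 0).\<close>

definition Fratio :: "ennreal \<Rightarrow> ennreal \<Rightarrow> (real ^ 'n::finite) set \<Rightarrow> ennreal" where
  "Fratio p q \<Omega> = lambda_root p \<Omega> / lambda_root q \<Omega>"

definition Fratio_defined :: "ennreal \<Rightarrow> ennreal \<Rightarrow> (real ^ 'n::finite) set \<Rightarrow> bool" where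
  "Fratio_defined p q \<Omega> \<longleftrightarrow> \<not> (lambda_root p \<Omega> = 0 \<and> lambda_root q \<Omega> = 0)"

text \<open>The type argument fixes the dimension d = CARD('n). For d = q = 1 every admissible \<Omega> has
  the same finite ratio (both frequencies are constants divided by the supremum of the lengths of
  the components), so that M is finite there although q > d fails.\<close>

definition m_inf :: "'n::finite itself \<Rightarrow> ennreal \<Rightarrow> ennreal \<Rightarrow> ennreal" where
  "m_inf _ p q = (INF \<Omega>\<in>{\<Omega> :: (real ^ 'n) set. open \<Omega> \<and> \<Omega> \<noteq> {} \<and> lambda_pos q \<Omega>}. Fratio p q \<Omega>)"

definition M_sup :: "'n::finite itself \<Rightarrow> ennreal \<Rightarrow> ennreal \<Rightarrow> ennreal" where
  "M_sup _ p q = (SUP \<Omega>\<in>{\<Omega> :: (real ^ 'n) set. open \<Omega> \<and> \<Omega> \<noteq> {} \<and> lambda_pos q \<Omega>}. Fratio p q \<Omega>)"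

lemma Fratio_convention:
  assumes "lambda_root q \<Omega> = 0" "0 < lambda_root p \<Omega>"
  shows "Fratio p q \<Omega> = top"
  using assms by (simp add: Fratio_def divide_ennreal_def ennreal_mult_top)

end

theory Submission imports Defs begin

text \<open>
  Write \<lambda>(p, \<Omega>) for the root of order p of the principal frequency, with the reciprocal of the inradius for
  p = \<infinity>. It can be tested on C^1 functions of compact support (lemma lambda_ge_iff), and from this
  follow its structural properties: it decreases under inclusion, it is divided by s under dilation
  by s, on a disjoint union of open sets it is the infimum over the members, and it is approximated
  from inside \<Omega> by sets containing a suitable compact set.

  These properties give the extremal sets. Both frequencies of \<Omega> can be approximated by those of smooth
  bounded domains inside \<Omega> (poly_domain_between: sublevel sets of polynomials at a regular value), so that
  the infimum and the supremum of the ratio can be computed on a sequence of such domains. The ratio is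
  invariant under dilation, hence one of the two frequencies may be normalized to 1 along the sequence.
  The disjoint union of the domains, translated far apart to keep the boundary smooth, then has the
  extremal value exactly (extremal_m, extremal_M). If the supremum is infinite, this union has \<lambda>(q, \<Omega>) = 0
  and \<lambda>(p, \<Omega>) = 1.

  Finiteness of the supremum is a matter of capacity, and rests on one inequality (star_poincare): if u
  vanishes near a point c of a star-shaped set Q with centre c, then integration along the rays from c
  bounds the norm of u in L^p(Q) by that of its gradient, with a constant given by the integral of
  t powr (- b) from \<tau> to 1, where b \<ge> d / p and \<tau> measures the size of the region of vanishing.

  For q > d one can take b < 1, and the constant is bounded uniformly in \<tau>. If \<Omega> contains no ball of radius \<rho>, every
  cube of side 2 \<rho> contains a point where all test functions vanish, and summation over a tiling by cubes
  bounds \<lambda>(q, \<Omega>) from below by a multiple of 1 / \<rho>. Since \<lambda>(p, \<Omega>) is at most a multiple of the reciprocal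
  of the radius of any ball in \<Omega>, the ratio is bounded (M_sup_finite).

  For q \<le> d and d \<ge> 2 the ratio is unbounded on the perforated spaces, the complements of balls of small radius r
  around the integer points (M_sup_infinite). There \<lambda>(q, \<Omega>) tends to 0 with r, at the rate
  r powr (d / q - 1) if q < d, because small balls have small capacity. The inequality on the unit cubes bounds
  \<lambda>(p, \<Omega>) from below, uniformly in r if p > d, and otherwise by a multiple of r powr (b - 1) for every
  b > 1 with b \<ge> d / p; and b can be chosen less than d / q.
\<close>

section \<open>Continuously differentiable functions of compact support\<close>

lemma grad_eqI:
  fixes f :: "real ^ 'n::finite \<Rightarrow> real"
  assumes "(f has_derivative (\<lambda>h. g \<bullet> h)) (at x)"
  shows "grad f x = g"
proof -
  have "frechet_derivative f (at x) = (\<lambda>h. g \<bullet> h)"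
    using frechet_derivative_at[OF assms] by simp
  then show ?thesis
    by (simp add: grad_def partial_deriv_def vec_eq_iff inner_axis)
qed

lemma differentiable_has_grad:
  fixes f :: "real ^ 'n::finite \<Rightarrow> real"
  assumes "f differentiable (at x)"
  shows "(f has_derivative (\<lambda>h. grad f x \<bullet> h)) (at x)"
proof -
  let ?D = "frechet_derivative f (at x)"
  have D: "(f has_derivative ?D) (at x)"
    using assms frechet_derivative_works by blast
  have lin: "linear ?D"
    using assms linear_frechet_derivative by blast
  have "?D h = grad f x \<bullet> h" for h
  proof -
    have "?D h = ?D (\<Sum>i\<in>UNIV. (h $ i) *\<^sub>R axis i 1)"
      by (simp add: basis_expansion scalar_mult_eq_scaleR[symmetric])
    also have "\<dots> = (\<Sum>i\<in>UNIV. (h $ i) * ?D (axis i 1))"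
      by (simp add: linear_sum[OF lin] linear_cmul[OF lin])
    also have "\<dots> = grad f x \<bullet> h"
      by (simp add: inner_vec_def grad_def partial_deriv_def mult.commute)
    finally show ?thesis .
  qed
  then have "?D = (\<lambda>h. grad f x \<bullet> h)" by blast
  with D show ?thesis by simp
qed

lemma C1cI:
  fixes f :: "real ^ 'n::finite \<Rightarrow> real"
  assumes der: "\<And>x. (f has_derivative (\<lambda>h. g x \<bullet> h)) (at x)"
    and cont: "continuous_on UNIV g"
    and K: "compact K" "K \<subseteq> \<Omega>" "\<And>x. x \<notin> K \<Longrightarrow> f x = 0"
  shows "f \<in> C1c \<Omega>" and "grad f = g"
proof -
  show g: "grad f = g" using grad_eqI[OF der] by auto
  have "partial_deriv i f = (\<lambda>x. g x $ i)" for i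
    using g by (auto simp: grad_def fun_eq_iff vec_eq_iff)
  then have "Ck_on 1 UNIV f"
    using der cont by (auto simp: differentiable_def intro!: continuous_intros)
  then show "f \<in> C1c \<Omega>" using K by (auto simp: C1c_def)
qed

lemma C1c_derivative:
  assumes "f \<in> C1c \<Omega>"
  shows "(f has_derivative (\<lambda>h. grad f x \<bullet> h)) (at x)"
  using assms by (intro differentiable_has_grad) (auto simp: C1c_def)

lemma C1c_continuous_grad:
  assumes "f \<in> C1c \<Omega>"
  shows "continuous_on UNIV (grad f)"
proof -
  have "continuous_on UNIV (partial_deriv i f)" for i
    using assms by (auto simp: C1c_def)
  then show ?thesis unfolding grad_def by (intro continuous_on_vec_lambda) auto
qed

lemma C1c_continuous:
  assumes "f \<in> C1c \<Omega>"
  shows "continuous_on UNIV f"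
  by (intro continuous_at_imp_continuous_on ballI has_derivative_continuous[OF C1c_derivative[OF assms]])

lemma grad_eq_0_outside:
  fixes f :: "real ^ 'n::finite \<Rightarrow> real"
  assumes "closed K" "\<And>x. x \<notin> K \<Longrightarrow> f x = 0" "x \<notin> K"
  shows "grad f x = 0"
proof (rule grad_eqI)
  show "(f has_derivative (\<lambda>h. 0 \<bullet> h)) (at x)"
    using has_derivative_transform_within_open[of "\<lambda>_. 0::real" "\<lambda>_. 0" x UNIV "- K" f] assms
    by (auto simp: open_Compl)
qed

lemma C1c_support:
  fixes f :: "real ^ 'n::finite \<Rightarrow> real"
  assumes "f \<in> C1c \<Omega>"
  obtains K where "compact K" "K \<subseteq> \<Omega>" "\<And>x. x \<notin> K \<Longrightarrow> f x = 0" "\<And>x. x \<notin> K \<Longrightarrow> grad f x = 0"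
proof -
  obtain K where K: "compact K" "K \<subseteq> \<Omega>" "\<And>x. x \<notin> K \<Longrightarrow> f x = 0"
    using assms by (auto simp: C1c_def)
  with that show ?thesis using grad_eq_0_outside[OF compact_imp_closed] by metis
qed

lemma C1c_mono: "A \<subseteq> B \<Longrightarrow> C1c A \<subseteq> C1c B"
  by (force simp: C1c_def)

lemma C1c_change_domain:
  assumes "f \<in> C1c A" "compact K" "K \<subseteq> B" "\<And>x. x \<notin> K \<Longrightarrow> f x = 0"
  shows "f \<in> C1c B"
  using assms by (auto simp: C1c_def)

lemma C1c_measurable:
  assumes "f \<in> C1c \<Omega>"
  shows "f \<in> borel_measurable borel" "grad f \<in> borel_measurable borel"
  by (rule borel_measurable_continuous_onI[OF C1c_continuous[OF assms]],
      rule borel_measurable_continuous_onI[OF C1c_continuous_grad[OF assms]])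

lemma integrable_continuous_compact_support:
  fixes f :: "'a::euclidean_space \<Rightarrow> 'b::{banach, second_countable_topology}"
  assumes "continuous_on UNIV f" "compact K" "\<And>x. x \<notin> K \<Longrightarrow> f x = 0"
  shows "integrable lborel f"
proof -
  have "integrable lborel (\<lambda>x. indicator K x *\<^sub>R f x)"
    using assms by (intro borel_integrable_compact continuous_on_subset[OF assms(1)]) auto
  also have "(\<lambda>x. indicator K x *\<^sub>R f x) = f"
    using assms(3) by (auto simp: fun_eq_iff indicator_def)
  finally show ?thesis .
qed

lemma C1c_integrable_powr:
  fixes f :: "real ^ 'n::finite \<Rightarrow> real"
  assumes "f \<in> C1c \<Omega>" "1 \<le> p"
  shows "integrable lborel (\<lambda>x. \<bar>f x\<bar> powr p)" "integrable lborel (\<lambda>x. norm (grad f x) powr p)"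
proof -
  obtain K where K: "compact K" "\<And>x. x \<notin> K \<Longrightarrow> f x = 0" "\<And>x. x \<notin> K \<Longrightarrow> grad f x = 0"
    using C1c_support[OF assms(1)] by metis
  show "integrable lborel (\<lambda>x. \<bar>f x\<bar> powr p)"
    using K C1c_continuous[OF assms(1)] assms(2)
    by (intro integrable_continuous_compact_support[of _ K]) (auto intro!: continuous_intros continuous_on_powr')
  show "integrable lborel (\<lambda>x. norm (grad f x) powr p)"
    using K C1c_continuous_grad[OF assms(1)] assms(2)
    by (intro integrable_continuous_compact_support[of _ K]) (auto intro!: continuous_intros continuous_on_powr')
qed

text \<open>The definitions integrate over the domain. For functions vanishing outside it the Lebesgue--Borel
  measure of the whole space, on which the later arguments are set, gives the same integrals.\<close>

lemma integral_lebesgue_on_support: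
  fixes h :: "'a::euclidean_space \<Rightarrow> 'b::{banach, second_countable_topology}"
  assumes "\<Omega> \<in> sets borel" "h \<in> borel_measurable borel" "\<And>x. x \<notin> \<Omega> \<Longrightarrow> h x = 0"
  shows "(\<integral>x. h x \<partial>lebesgue_on \<Omega>) = (\<integral>x. h x \<partial>lborel)"
    and "integrable (lebesgue_on \<Omega>) h \<longleftrightarrow> integrable lborel h"
proof -
  have \<Omega>: "\<Omega> \<inter> space lebesgue \<in> sets lebesgue"
    using assms(1) by simp
  have e: "(\<lambda>x. indicator \<Omega> x *\<^sub>R h x) = h"
    using assms(3) by (auto simp: fun_eq_iff indicator_def)
  show "(\<integral>x. h x \<partial>lebesgue_on \<Omega>) = (\<integral>x. h x \<partial>lborel)"
    using integral_restrict_space[OF \<Omega>, of h] integral_completion[of h lborel] assms(2) by (simp add: e)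
  show "integrable (lebesgue_on \<Omega>) h \<longleftrightarrow> integrable lborel h"
    using integrable_restrict_space[OF \<Omega>, of h] integrable_completion[of h lborel] assms(2) by (simp add: e)
qed

lemma C1c_mult:
  fixes f :: "real ^ 'n::finite \<Rightarrow> real"
  assumes f: "f \<in> C1c \<Omega>"
    and g: "\<And>x. (g has_derivative (\<lambda>h. g' x \<bullet> h)) (at x)" "continuous_on UNIV g'"
  shows "(\<lambda>x. f x * g x) \<in> C1c \<Omega>" "grad (\<lambda>x. f x * g x) = (\<lambda>x. f x *\<^sub>R g' x + g x *\<^sub>R grad f x)"
proof -
  obtain K where K: "compact K" "K \<subseteq> \<Omega>" "\<And>x. x \<notin> K \<Longrightarrow> f x = 0"
    using C1c_support[OF f] by metis
  have d: "((\<lambda>x. f x * g x) has_derivative (\<lambda>h. (f x *\<^sub>R g' x + g x *\<^sub>R grad f x) \<bullet> h)) (at x)" for x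
    by (rule has_derivative_eq_rhs[OF has_derivative_mult[OF C1c_derivative[OF f] g(1)]])
       (auto simp: inner_add_left)
  have "continuous_on UNIV g"
    by (intro continuous_at_imp_continuous_on ballI has_derivative_continuous[OF g(1)])
  then have c: "continuous_on UNIV (\<lambda>x. f x *\<^sub>R g' x + g x *\<^sub>R grad f x)"
    using C1c_continuous[OF f] C1c_continuous_grad[OF f] g(2) by (intro continuous_intros)
  have z: "f x * g x = 0" if "x \<notin> K" for x using K that by simp
  show "(\<lambda>x. f x * g x) \<in> C1c \<Omega>" "grad (\<lambda>x. f x * g x) = (\<lambda>x. f x *\<^sub>R g' x + g x *\<^sub>R grad f x)"
    using C1cI[OF d c K(1,2) z] by auto
qed

text \<open>The integral of a derivative of a compactly supported function vanishes because it is the limit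
  of integrals of difference quotients, and these vanish by translation invariance.\<close>

lemma integral_partial_deriv_0:
  fixes f :: "real ^ 'n::finite \<Rightarrow> real"
  assumes f: "f \<in> C1c \<Omega>"
  shows "(\<integral>x. grad f x $ i \<partial>lborel) = 0"
proof -
  obtain K where K: "compact K" "\<And>x. x \<notin> K \<Longrightarrow> f x = 0" "\<And>x. x \<notin> K \<Longrightarrow> grad f x = 0"
    using C1c_support[OF f] by metis
  obtain R where R: "K \<subseteq> cball 0 R"
    using compact_imp_bounded[OF K(1)] by (metis bounded_iff mem_cball_0 subsetI)
  have "compact (grad f ` cball 0 R)"
    by (intro compact_continuous_image continuous_on_subset[OF C1c_continuous_grad[OF f]]) auto
  then have "bounded (grad f ` cball 0 R)" by (rule compact_imp_bounded)
  then obtain B where B: "\<And>x. x \<in> cball 0 R \<Longrightarrow> norm (grad f x) \<le> B" "0 < B"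
    unfolding bounded_pos by blast
  have B': "norm (grad f x) \<le> B" for x
    using B K R by (cases "x \<in> K") (auto simp: subset_iff)
  have lip: "\<bar>f x - f y\<bar> \<le> B * norm (x - y)" for x y
  proof -
    have "onorm (\<lambda>h. grad f z \<bullet> h) \<le> B" for z
      using B' by (intro onorm_le) (metis Cauchy_Schwarz_ineq2 mult_right_mono norm_ge_zero order_trans real_norm_def)
    then show ?thesis
      using differentiable_bound[of UNIV f "\<lambda>z h. grad f z \<bullet> h" B x y] C1c_derivative[OF f]
      by (auto simp: has_derivative_at_withinI)
  qed
  define e where "e = (axis i 1 :: real ^ 'n)"
  have ne: "norm e = 1" by (simp add: e_def)
  define s where "s n x = real (Suc n) * (f (inverse (real (Suc n)) *\<^sub>R e + x) - f x)" for n x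
  have contf: "continuous_on UNIV f" using C1c_continuous[OF f] .
  have intf: "integrable lborel f"
    using integrable_continuous_compact_support[OF contf K(1,2)] by auto
  have int_shift: "integrable lborel (\<lambda>x. f (c + x))" "(\<integral>x. f (c + x) \<partial>lborel) = (\<integral>x. f x \<partial>lborel)" for c
  proof -
    have [measurable]: "f \<in> borel_measurable borel" using C1c_measurable[OF f] by simp
    show "(\<integral>x. f (c + x) \<partial>lborel) = (\<integral>x. f x \<partial>lborel)"
      using integral_distr[of "(+) c" lborel borel f] by (simp add: lborel_distr_plus)
    show "integrable lborel (\<lambda>x. f (c + x))"
      using integrable_distr[of "(+) c" lborel borel f] intf by (simp add: lborel_distr_plus)
  qed
  have s0: "(\<integral>x. s n x \<partial>lborel) = 0" for n
    unfolding s_def by (simp add: int_shift intf)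
  have "(\<lambda>n. \<integral>x. s n x \<partial>lborel) \<longlonglongrightarrow> (\<integral>x. grad f x $ i \<partial>lborel)"
  proof (rule integral_dominated_convergence[where w="\<lambda>x. indicator (cball 0 (R + 1)) x *\<^sub>R B"])
    show "(\<lambda>x. grad f x $ i) \<in> borel_measurable lborel"
      using C1c_continuous_grad[OF f] by (auto intro!: borel_measurable_continuous_onI continuous_intros)
    show "s n \<in> borel_measurable lborel" for n
      unfolding s_def using C1c_measurable[OF f] by measurable
    show "integrable lborel (\<lambda>x. indicator (cball 0 (R + 1)) x *\<^sub>R B :: real)"
      by (intro borel_integrable_compact) auto
    show "AE x in lborel. norm (s n x) \<le> indicator (cball 0 (R + 1)) x *\<^sub>R B" for n
    proof (intro AE_I2)
      fix x :: "real ^ 'n"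
      let ?c = "inverse (real (Suc n)) *\<^sub>R e"
      have nc: "norm ?c = inverse (real (Suc n))" by (simp add: ne)
      show "norm (s n x) \<le> indicator (cball 0 (R + 1)) x *\<^sub>R B"
      proof (cases "x \<in> cball 0 (R + 1)")
        case True
        have "\<bar>f (?c + x) - f x\<bar> \<le> B * inverse (real (Suc n))"
          using lip[of "?c + x" x] nc by simp
        then have "real (Suc n) * \<bar>f (?c + x) - f x\<bar> \<le> real (Suc n) * (B * inverse (real (Suc n)))"
          by (intro mult_left_mono) auto
        also have "\<dots> = B" by simp
        finally have "real (Suc n) * \<bar>f (?c + x) - f x\<bar> \<le> B" .
        then show ?thesis using True unfolding s_def by (simp add: abs_mult del: of_nat_Suc)
      next
        case False
        have "inverse (real (Suc n)) \<le> 1" by (simp add: field_simps)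
        then have "norm (?c + x) > R"
          using False nc norm_diff_ineq[of x ?c] by (simp add: add.commute)
        then have "?c + x \<notin> K" "x \<notin> K" using R False by auto
        then show ?thesis using False K unfolding s_def by (simp del: of_nat_Suc)
      qed
    qed
    show "AE x in lborel. (\<lambda>n. s n x) \<longlonglongrightarrow> grad f x $ i"
    proof (intro AE_I2)
      fix x :: "real ^ 'n"
      have "((\<lambda>t. f (x + t *\<^sub>R e)) has_derivative (\<lambda>t. grad f x \<bullet> (t *\<^sub>R e))) (at 0)"
      proof (rule has_derivative_compose[of "\<lambda>t. x + t *\<^sub>R e" "\<lambda>t. t *\<^sub>R e" 0 UNIV f "\<lambda>h. grad f x \<bullet> h"])
        show "((\<lambda>t. x + t *\<^sub>R e) has_derivative (\<lambda>t. t *\<^sub>R e)) (at 0)"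
          by (rule has_derivative_eq_rhs, (rule derivative_intros)+) auto
        show "(f has_derivative (\<bullet>) (grad f x)) (at (x + 0 *\<^sub>R e))"
          using C1c_derivative[OF f, of x] by simp
      qed
      then have "((\<lambda>t. f (x + t *\<^sub>R e)) has_real_derivative grad f x $ i) (at 0)"
        by (rule has_derivative_imp_has_field_derivative) (simp add: e_def inner_axis)
      then have lim: "((\<lambda>t. (f (x + t *\<^sub>R e) - f x) / t) \<longlongrightarrow> grad f x $ i) (at 0)"
        by (simp add: DERIV_def)
      have "filterlim (\<lambda>n. inverse (real (Suc n))) (at 0) sequentially"
        unfolding filterlim_at using LIMSEQ_inverse_real_of_nat by (simp del: of_nat_Suc)
      from filterlim_compose[OF lim this]
      show "(\<lambda>n. s n x) \<longlonglongrightarrow> grad f x $ i"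
        unfolding s_def by (simp add: divide_inverse mult.commute add.commute del: of_nat_Suc)
    qed
  qed
  then have "(\<lambda>n. 0) \<longlonglongrightarrow> (\<integral>x. grad f x $ i \<partial>lborel)" unfolding s0 .
  then show ?thesis using LIMSEQ_unique[OF tendsto_const] by metis
qed

text \<open>Integration by parts: a product of test functions is a test function, and its derivative has
  integral 0.\<close>

lemma C1c_weak_grad:
  fixes f :: "real ^ 'n::finite \<Rightarrow> real"
  assumes f: "f \<in> C1c \<Omega>" and "open \<Omega>"
  shows "weak_grad \<Omega> f (grad f)"
  unfolding weak_grad_def
proof (intro ballI allI)
  fix \<phi> i assume \<phi>: "\<phi> \<in> C1c \<Omega>"
  have pd: "partial_deriv i \<phi> x = grad \<phi> x $ i" for x by (simp add: grad_def)
  note cf = C1c_continuous[OF f] C1c_continuous_grad[OF f]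
  note c\<phi> = C1c_continuous[OF \<phi>] C1c_continuous_grad[OF \<phi>]
  obtain K where K: "compact K" "K \<subseteq> \<Omega>" "\<And>x. x \<notin> K \<Longrightarrow> f x = 0" "\<And>x. x \<notin> K \<Longrightarrow> grad f x = 0"
    using C1c_support[OF f] by metis
  have m: "(\<lambda>x. f x * (grad \<phi> x $ i)) \<in> borel_measurable borel" "(\<lambda>x. grad f x $ i * \<phi> x) \<in> borel_measurable borel"
    using cf c\<phi> by (auto intro!: borel_measurable_continuous_onI continuous_intros)
  have I: "integrable lborel (\<lambda>x. f x * (grad \<phi> x $ i))" "integrable lborel (\<lambda>x. grad f x $ i * \<phi> x)"
    using K cf c\<phi> by (auto intro!: integrable_continuous_compact_support[of _ K] continuous_intros)
  have "0 = (\<integral>x. grad (\<lambda>x. f x * \<phi> x) x $ i \<partial>lborel)"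
    using integral_partial_deriv_0[OF C1c_mult(1)[OF f C1c_derivative[OF \<phi>] c\<phi>(2)]] by simp
  also have "\<dots> = (\<integral>x. f x * (grad \<phi> x $ i) + grad f x $ i * \<phi> x \<partial>lborel)"
    unfolding C1c_mult(2)[OF f C1c_derivative[OF \<phi>] c\<phi>(2)] by (simp add: mult.commute)
  also have "\<dots> = (\<integral>x. f x * (grad \<phi> x $ i) \<partial>lborel) + (\<integral>x. grad f x $ i * \<phi> x \<partial>lborel)"
    using I by simp
  finally have s: "0 = (\<integral>x. f x * (grad \<phi> x $ i) \<partial>lborel) + (\<integral>x. grad f x $ i * \<phi> x \<partial>lborel)" .
  have \<Omega>: "\<Omega> \<in> sets borel" using assms(2) by simp
  have z: "f x = 0" "grad f x = 0" if "x \<notin> \<Omega>" for x using that K by auto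
  have e1: "(\<integral>x. f x * (grad \<phi> x $ i) \<partial>lebesgue_on \<Omega>) = (\<integral>x. f x * (grad \<phi> x $ i) \<partial>lborel)"
    using z by (intro integral_lebesgue_on_support(1)[OF \<Omega> m(1)]) simp
  have e2: "(\<integral>x. grad f x $ i * \<phi> x \<partial>lebesgue_on \<Omega>) = (\<integral>x. grad f x $ i * \<phi> x \<partial>lborel)"
    using z by (intro integral_lebesgue_on_support(1)[OF \<Omega> m(2)]) simp
  show "(\<integral>x. f x * partial_deriv i \<phi> x \<partial>lebesgue_on \<Omega>) = - (\<integral>x. grad f x $ i * \<phi> x \<partial>lebesgue_on \<Omega>)"
    unfolding pd e1 e2 using s by simp
qed

section \<open>Frequencies and inequalities for test functions\<close>

text \<open>The graph of the convex power function lies above its tangent at s: this is Young's inequality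
  with the exponents p and p / (p - 1).\<close>

lemma powr_tangent:
  fixes y s p :: real
  assumes "1 \<le> p" "0 \<le> y" "0 < s"
  shows "s powr p + p * s powr (p - 1) * (y - s) \<le> y powr p"
proof (cases "p = 1")
  case True
  then show ?thesis using assms by auto
next
  case False
  with assms have p: "1 < p" by simp
  have "y * s powr (p - 1) \<le> y powr p / p + (s powr (p - 1)) powr (p / (p - 1)) / (p / (p - 1))"
    using p assms by (intro Youngs_inequality) (auto simp: field_simps)
  also have "(s powr (p - 1)) powr (p / (p - 1)) = s powr p"
    using p by (simp add: powr_powr)
  finally have "p * (y * s powr (p - 1)) \<le> p * (y powr p / p + s powr p / (p / (p - 1)))"
    using p by (intro mult_left_mono) auto
  also have "\<dots> = y powr p + (p - 1) * s powr p"
    using p by (simp add: field_simps)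
  finally have *: "p * (y * s powr (p - 1)) \<le> y powr p + (p - 1) * s powr p" .
  have "s powr p = s * s powr (p - 1)"
    using assms(3) by (simp add: powr_mult_base)
  then have "s powr p + p * s powr (p - 1) * (y - s) = p * (y * s powr (p - 1)) - (p - 1) * s powr p"
    by (simp add: algebra_simps)
  with * show ?thesis by simp
qed

text \<open>Convexity of the power function, with weights adapted to a perturbation b of a: as t tends to 0
  the factor of a tends to 1. It replaces the triangle inequality of the Lebesgue norms.\<close>

lemma powr_add_le:
  fixes a b t p :: real
  assumes "1 \<le> p" "0 \<le> a" "0 \<le> b" "0 < t" "t < 1"
  shows "(a + b) powr p \<le> (1 - t) powr (1 - p) * a powr p + t powr (1 - p) * b powr p"
proof (cases "a + b = 0")
  case True
  then show ?thesis using assms by simp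
next
  case False
  define s where "s = a + b"
  have s: "0 < s" using False assms by (simp add: s_def)
  have "s powr p + p * s powr (p - 1) * (a / (1 - t) - s) \<le> (a / (1 - t)) powr p"
    using s assms by (intro powr_tangent) auto
  then have 1: "(1 - t) * (s powr p + p * s powr (p - 1) * (a / (1 - t) - s)) \<le> (1 - t) * (a / (1 - t)) powr p"
    using assms by (intro mult_left_mono) auto
  have "s powr p + p * s powr (p - 1) * (b / t - s) \<le> (b / t) powr p"
    using s assms by (intro powr_tangent) auto
  then have 2: "t * (s powr p + p * s powr (p - 1) * (b / t - s)) \<le> t * (b / t) powr p"
    using assms by (intro mult_left_mono) auto
  have "(1 - t) * (s powr p + p * s powr (p - 1) * (a / (1 - t) - s)) + t * (s powr p + p * s powr (p - 1) * (b / t - s))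
     = s powr p + p * s powr (p - 1) * ((1 - t) * (a / (1 - t)) + t * (b / t) - s)"
    by (simp add: algebra_simps)
  also have "(1 - t) * (a / (1 - t)) + t * (b / t) - s = 0"
    using assms by (simp add: s_def)
  finally have 3: "s powr p \<le> (1 - t) * (a / (1 - t)) powr p + t * (b / t) powr p"
    using 1 2 by simp
  have w: "r * (c / r) powr p = r powr (1 - p) * c powr p" if "0 < r" "0 \<le> c" for r c :: real
  proof -
    have "r * (c / r) powr p = (r powr 1 / r powr p) * c powr p"
      using that by (simp add: powr_divide)
    then show ?thesis using that by (simp only: powr_diff)
  qed
  show ?thesis using 3 w[of "1 - t" a] w[of t b] assms by (simp add: s_def)
qed

lemma integral_powr_add_le:
  fixes \<phi> \<psi> :: "'a \<Rightarrow> 'b::euclidean_space"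
  assumes p: "1 \<le> p" and t: "0 < t" "t < 1"
    and m: "\<phi> \<in> borel_measurable M" "\<psi> \<in> borel_measurable M"
    and i: "integrable M (\<lambda>x. norm (\<phi> x) powr p)" "integrable M (\<lambda>x. norm (\<psi> x) powr p)"
  shows "integrable M (\<lambda>x. norm (\<phi> x + \<psi> x) powr p)"
    and "(\<integral>x. norm (\<phi> x + \<psi> x) powr p \<partial>M)
      \<le> (1 - t) powr (1 - p) * (\<integral>x. norm (\<phi> x) powr p \<partial>M) + t powr (1 - p) * (\<integral>x. norm (\<psi> x) powr p \<partial>M)"
proof -
  let ?b = "\<lambda>x. (1 - t) powr (1 - p) * norm (\<phi> x) powr p + t powr (1 - p) * norm (\<psi> x) powr p"
  have le: "norm (\<phi> x + \<psi> x) powr p \<le> ?b x" for x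
  proof -
    have "norm (\<phi> x + \<psi> x) powr p \<le> (norm (\<phi> x) + norm (\<psi> x)) powr p"
      using p by (intro powr_mono2) (auto simp: norm_triangle_ineq)
    also have "\<dots> \<le> ?b x" using p t by (intro powr_add_le) auto
    finally show ?thesis .
  qed
  have ib: "integrable M ?b" using i by simp
  show I: "integrable M (\<lambda>x. norm (\<phi> x + \<psi> x) powr p)"
    using m le by (intro Bochner_Integration.integrable_bound[OF ib]) (auto intro!: AE_I2 order_trans[OF le])
  have "(\<integral>x. norm (\<phi> x + \<psi> x) powr p \<partial>M) \<le> (\<integral>x. ?b x \<partial>M)"
    by (intro integral_mono I ib le)
  also have "\<dots> = (1 - t) powr (1 - p) * (\<integral>x. norm (\<phi> x) powr p \<partial>M) + t powr (1 - p) * (\<integral>x. norm (\<psi> x) powr p \<partial>M)"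
    using i by simp
  finally show "(\<integral>x. norm (\<phi> x + \<psi> x) powr p \<partial>M)
      \<le> (1 - t) powr (1 - p) * (\<integral>x. norm (\<phi> x) powr p \<partial>M) + t powr (1 - p) * (\<integral>x. norm (\<psi> x) powr p \<partial>M)" .
qed

definition mass :: "real \<Rightarrow> (real ^ 'n::finite \<Rightarrow> real) \<Rightarrow> ennreal" where
  "mass p f = (\<integral>\<^sup>+x. ennreal (\<bar>f x\<bar> powr p) \<partial>lborel)"

definition energy :: "real \<Rightarrow> (real ^ 'n::finite \<Rightarrow> real) \<Rightarrow> ennreal" where
  "energy p f = (\<integral>\<^sup>+x. ennreal (norm (grad f x) powr p) \<partial>lborel)"

lemma C1c_integrals:
  fixes f :: "real ^ 'n::finite \<Rightarrow> real"
  assumes f: "f \<in> C1c \<Omega>" and "open \<Omega>" "1 \<le> p"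
  shows "integrable (lebesgue_on \<Omega>) (\<lambda>x. \<bar>f x\<bar> powr p)"
    and "integrable (lebesgue_on \<Omega>) (\<lambda>x. norm (grad f x) powr p)"
    and "ennreal (\<integral>x. \<bar>f x\<bar> powr p \<partial>lebesgue_on \<Omega>) = mass p f"
    and "ennreal (\<integral>x. norm (grad f x) powr p \<partial>lebesgue_on \<Omega>) = energy p f"
proof -
  obtain K where K: "compact K" "K \<subseteq> \<Omega>" "\<And>x. x \<notin> K \<Longrightarrow> f x = 0" "\<And>x. x \<notin> K \<Longrightarrow> grad f x = 0"
    using C1c_support[OF f] by metis
  have m: "(\<lambda>x. \<bar>f x\<bar> powr p) \<in> borel_measurable borel" "(\<lambda>x. norm (grad f x) powr p) \<in> borel_measurable borel"
    using C1c_measurable[OF f] by measurable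
  have \<Omega>: "\<Omega> \<in> sets borel" using assms by simp
  have z: "\<bar>f x\<bar> powr p = 0" "norm (grad f x) powr p = 0" if "x \<notin> \<Omega>" for x
    using K that by auto
  note A = integral_lebesgue_on_support[OF \<Omega> m(1) z(1)] integral_lebesgue_on_support[OF \<Omega> m(2) z(2)]
  note B = C1c_integrable_powr[OF f assms(3)]
  show "integrable (lebesgue_on \<Omega>) (\<lambda>x. \<bar>f x\<bar> powr p)"
    "integrable (lebesgue_on \<Omega>) (\<lambda>x. norm (grad f x) powr p)"
    using A B by auto
  show "ennreal (\<integral>x. \<bar>f x\<bar> powr p \<partial>lebesgue_on \<Omega>) = mass p f"
    "ennreal (\<integral>x. norm (grad f x) powr p \<partial>lebesgue_on \<Omega>) = energy p f"
    unfolding mass_def energy_def using B by (simp_all add: A nn_integral_eq_integral)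
qed

lemma C1c_W1p0:
  fixes f :: "real ^ 'n::finite \<Rightarrow> real"
  assumes f: "f \<in> C1c \<Omega>" and \<Omega>: "open \<Omega>" and p: "1 \<le> p"
  shows "W1p0 p \<Omega> f (grad f)"
proof -
  have m: "f \<in> borel_measurable (lebesgue_on \<Omega>)" "grad f \<in> borel_measurable (lebesgue_on \<Omega>)"
    using C1c_measurable[OF f] by (auto intro!: measurable_restrict_space1 measurable_completion)
  have "(\<lambda>n. (\<integral>x. \<bar>f x - f x\<bar> powr p \<partial>lebesgue_on \<Omega>)
            + (\<integral>x. norm (grad f x - grad f x) powr p \<partial>lebesgue_on \<Omega>)) \<longlonglongrightarrow> 0"
    by simp
  then show ?thesis
    using C1c_integrals(1,2)[OF f \<Omega> p] C1c_weak_grad[OF f \<Omega>] m f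
    unfolding W1p0_def W1p_def Lp_on_def by (auto intro!: exI[of _ "\<lambda>_. f"])
qed

text \<open>An inequality for test functions passes to their closure. The integrals converge because the
  factors of the perturbed terms can be brought arbitrarily close to 1 at the expense of the
  factors of the vanishing terms.\<close>

lemma W1p0_quotient_ge:
  fixes u :: "real ^ 'n::finite \<Rightarrow> real"
  assumes A: "open A" and p: "1 \<le> p" and c: "0 \<le> c"
    and H: "\<And>f. f \<in> C1c A \<Longrightarrow> ennreal c * mass p f \<le> energy p f"
    and u: "W1p0 p A u g" and nz: "\<not> (AE x in lebesgue_on A. u x = 0)"
  shows "c \<le> (\<integral>x. norm (g x) powr p \<partial>lebesgue_on A) / (\<integral>x. \<bar>u x\<bar> powr p \<partial>lebesgue_on A)"
proof -
  let ?M = "lebesgue_on A"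
  obtain f where f: "\<And>n. f n \<in> C1c A"
    and lim: "(\<lambda>n. (\<integral>x. \<bar>f n x - u x\<bar> powr p \<partial>?M) + (\<integral>x. norm (grad (f n) x - g x) powr p \<partial>?M)) \<longlonglongrightarrow> 0"
    using u unfolding W1p0_def by auto
  have um: "u \<in> borel_measurable ?M" "g \<in> borel_measurable ?M"
    and ui: "integrable ?M (\<lambda>x. norm (u x) powr p)" "integrable ?M (\<lambda>x. norm (g x) powr p)"
    using u by (auto simp: W1p0_def W1p_def Lp_on_def)
  have fm: "f n \<in> borel_measurable ?M" "grad (f n) \<in> borel_measurable ?M" for n
    using C1c_measurable[OF f] by (auto intro!: measurable_restrict_space1 measurable_completion)
  define U where "U = (\<integral>x. \<bar>u x\<bar> powr p \<partial>?M)"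
  define G where "G = (\<integral>x. norm (g x) powr p \<partial>?M)"
  define Uf where "Uf n = (\<integral>x. \<bar>f n x\<bar> powr p \<partial>?M)" for n
  define Gf where "Gf n = (\<integral>x. norm (grad (f n) x) powr p \<partial>?M)" for n
  define a where "a n = (\<integral>x. \<bar>f n x - u x\<bar> powr p \<partial>?M)" for n
  define b where "b n = (\<integral>x. norm (grad (f n) x - g x) powr p \<partial>?M)" for n
  have ab0: "0 \<le> a n" "0 \<le> b n" for n by (auto simp: a_def b_def)
  have a: "a \<longlonglongrightarrow> 0"
    by (rule tendsto_sandwich[OF _ _ tendsto_const lim]) (use ab0 in \<open>auto simp: a_def b_def\<close>)
  have b: "b \<longlonglongrightarrow> 0"
    by (rule tendsto_sandwich[OF _ _ tendsto_const lim]) (use ab0 in \<open>auto simp: a_def b_def\<close>)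
  have HU: "c * Uf n \<le> Gf n" for n
  proof -
    have "ennreal (c * Uf n) \<le> ennreal (Gf n)"
      using H[OF f[of n]] C1c_integrals(3,4)[OF f[of n] A p] c
      by (simp add: ennreal_mult Uf_def Gf_def)
    then show ?thesis by (subst (asm) ennreal_le_iff) (auto simp: Gf_def)
  qed
  have half: "(0::real) < 1/2" "1/2 < (1::real)" by auto
  have iu: "integrable ?M (\<lambda>x. norm (u x - f n x) powr p)" for n
    using integral_powr_add_le(1)[OF p half um(1) _ ui(1), of "\<lambda>x. - f n x"] fm C1c_integrals(1)[OF f A p]
    by simp
  have ig: "integrable ?M (\<lambda>x. norm (grad (f n) x - g x) powr p)" for n
    using integral_powr_add_le(1)[OF p half fm(2) _ C1c_integrals(2)[OF f A p], of "\<lambda>x. - g x" n] um ui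
    by simp
  have U_le: "U \<le> (1 - t) powr (1 - p) * Uf n + t powr (1 - p) * a n" if "0 < t" "t < 1" for t n
    using integral_powr_add_le(2)[OF p that fm(1)[of n], of "\<lambda>x. u x - f n x"] fm um C1c_integrals(1)[OF f A p] iu
    by (simp add: U_def Uf_def a_def abs_minus_commute)
  have G_le: "Gf n \<le> (1 - t) powr (1 - p) * G + t powr (1 - p) * b n" if "0 < t" "t < 1" for t n
    using integral_powr_add_le(2)[OF p that um(2), of "\<lambda>x. grad (f n) x - g x"] fm um ui ig
    by (simp add: G_def Gf_def b_def)
  have le_t: "c * U \<le> (1 - t) powr (1 - p) * ((1 - t) powr (1 - p) * G)" if t: "0 < t" "t < 1" for t
  proof (rule LIMSEQ_le_const)
    let ?R = "\<lambda>n. (1 - t) powr (1 - p) * ((1 - t) powr (1 - p) * G + t powr (1 - p) * b n) + c * (t powr (1 - p) * a n)"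
    have "?R \<longlonglongrightarrow> (1 - t) powr (1 - p) * ((1 - t) powr (1 - p) * G + t powr (1 - p) * 0) + c * (t powr (1 - p) * 0)"
      by (intro tendsto_intros a b)
    then show "?R \<longlonglongrightarrow> (1 - t) powr (1 - p) * ((1 - t) powr (1 - p) * G)" by simp
    have "c * U \<le> ?R n" for n
    proof -
      have "c * U \<le> c * ((1 - t) powr (1 - p) * Uf n + t powr (1 - p) * a n)"
        using U_le[OF t] c by (intro mult_left_mono) auto
      also have "\<dots> = (1 - t) powr (1 - p) * (c * Uf n) + c * (t powr (1 - p) * a n)"
        by (simp add: algebra_simps)
      also have "\<dots> \<le> (1 - t) powr (1 - p) * Gf n + c * (t powr (1 - p) * a n)"
        using HU by (intro add_right_mono mult_left_mono) auto
      also have "\<dots> \<le> ?R n" using G_le[OF t] by (intro add_right_mono mult_left_mono) auto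
      finally show ?thesis .
    qed
    then show "\<exists>N. \<forall>n\<ge>N. c * U \<le> ?R n" by auto
  qed
  have cU: "c * U \<le> G"
  proof (rule tendsto_lowerbound)
    have "((\<lambda>t. (1 - t) powr (1 - p) * ((1 - t) powr (1 - p) * G)) \<longlongrightarrow> (1 - 0) powr (1 - p) * ((1 - 0) powr (1 - p) * G)) (at_right 0)"
      by (intro tendsto_intros) auto
    then show "((\<lambda>t. (1 - t) powr (1 - p) * ((1 - t) powr (1 - p) * G)) \<longlongrightarrow> G) (at_right 0)" by simp
    show "\<forall>\<^sub>F t in at_right 0. c * U \<le> (1 - t) powr (1 - p) * ((1 - t) powr (1 - p) * G)"
      using eventually_at_right_less[of 0] le_t
      by (auto simp: eventually_at_right_field intro!: exI[of _ 1])
  qed simp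
  have "U \<noteq> 0"
  proof
    assume "U = 0"
    then have "AE x in ?M. \<bar>u x\<bar> powr p = 0"
      using integral_nonneg_eq_0_iff_AE[of ?M "\<lambda>x. \<bar>u x\<bar> powr p"] ui(1) by (simp add: U_def)
    with nz show False by simp
  qed
  moreover have "0 \<le> U" by (simp add: U_def)
  ultimately have "0 < U" by simp
  with cU show ?thesis by (simp add: U_def G_def field_simps)
qed

section \<open>Bump functions and changes of scale\<close>

lemma max_0_square_derivative:
  fixes t :: real
  shows "((\<lambda>t. (max 0 t)\<^sup>2) has_real_derivative 2 * max 0 t) (at t)"
proof -
  consider "t < 0" | "t = 0" | "0 < t" by linarith
  then show ?thesis
  proof cases
    case 1
    have "((\<lambda>t. 0) has_real_derivative 2 * max 0 t) (at t)" using 1 by simp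
    then show ?thesis
      by (rule has_field_derivative_transform_within_open[where S="{..<0}"]) (use 1 in auto)
  next
    case 3
    have "((\<lambda>t. t\<^sup>2) has_real_derivative 2 * max 0 t) (at t)"
      using 3 by (auto intro!: derivative_eq_intros)
    then show ?thesis
      by (rule has_field_derivative_transform_within_open[where S="{0<..}"]) (use 3 in auto)
  next
    case 2
    have "((\<lambda>h. ((max 0 (0 + h))\<^sup>2 - (max 0 0)\<^sup>2) / h) \<longlongrightarrow> 0) (at (0::real))"
    proof (rule Lim_null_comparison)
      show "\<forall>\<^sub>F h in at (0::real). norm (((max 0 (0 + h))\<^sup>2 - (max 0 0)\<^sup>2) / h) \<le> \<bar>h\<bar>"
        by (intro always_eventually allI) (auto simp: max_def power2_eq_square)
      show "((\<lambda>h. \<bar>h\<bar>) \<longlongrightarrow> 0) (at (0::real))"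
        by (rule tendsto_eq_intros | simp)+
    qed
    then show ?thesis using 2 by (simp add: DERIV_def)
  qed
qed

text \<open>A transition from 0 to 1 of class C^1, which suffices for test functions: the square of the positive
  part has a continuous derivative, and the denominator never vanishes.\<close>

definition smoothstep :: "real \<Rightarrow> real" where
  "smoothstep t = (max 0 t)\<^sup>2 / ((max 0 t)\<^sup>2 + (max 0 (1 - t))\<^sup>2)"

definition smoothstep' :: "real \<Rightarrow> real" where
  "smoothstep' t = (2 * max 0 t * ((max 0 t)\<^sup>2 + (max 0 (1 - t))\<^sup>2)
      - (max 0 t)\<^sup>2 * (2 * max 0 t - 2 * max 0 (1 - t))) / ((max 0 t)\<^sup>2 + (max 0 (1 - t))\<^sup>2)\<^sup>2"

lemma smoothstep_denominator_pos: "0 < (max 0 t)\<^sup>2 + (max 0 (1 - t))\<^sup>2" for t :: real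
  by (cases "t \<le> 0") (auto simp: max_def add_pos_nonneg)

lemma smoothstep_derivative: "(smoothstep has_real_derivative smoothstep' t) (at t)"
proof -
  have 1: "((\<lambda>t. (max 0 (1 - t))\<^sup>2) has_real_derivative 2 * max 0 (1 - t) * (- 1)) (at t)"
    by (rule DERIV_chain2[OF max_0_square_derivative]) (auto intro!: derivative_eq_intros)
  have nz: "(max 0 t)\<^sup>2 + (max 0 (1 - t))\<^sup>2 \<noteq> 0"
    using smoothstep_denominator_pos[of t] by (rule less_imp_neq[symmetric])
  show ?thesis
    unfolding smoothstep_def
    by (rule DERIV_cong[OF DERIV_divide[OF max_0_square_derivative DERIV_add[OF max_0_square_derivative 1] nz]])
       (simp add: smoothstep'_def power2_eq_square)
qed

lemma continuous_smoothstep': "continuous_on UNIV smoothstep'"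
proof -
  have "((max 0 t)\<^sup>2 + (max 0 (1 - t))\<^sup>2)\<^sup>2 \<noteq> 0" for t :: real
    using zero_less_power[OF smoothstep_denominator_pos[of t]] by (rule less_imp_neq[symmetric])
  then show ?thesis unfolding smoothstep'_def by (intro continuous_intros ballI) metis
qed

lemma smoothstep_values:
  "0 \<le> smoothstep t" "smoothstep t \<le> 1" "t \<le> 0 \<Longrightarrow> smoothstep t = 0" "1 \<le> t \<Longrightarrow> smoothstep t = 1"
proof -
  show "0 \<le> smoothstep t" "t \<le> 0 \<Longrightarrow> smoothstep t = 0"
    by (auto simp: smoothstep_def)
  show "smoothstep t \<le> 1"
    unfolding smoothstep_def using smoothstep_denominator_pos[of t] by (subst divide_le_eq_1_pos) auto
  assume "1 \<le> t"
  then have "max 0 t = t" "max 0 (1 - t) = 0" "t \<noteq> 0" by auto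
  then show "smoothstep t = 1" by (simp add: smoothstep_def)
qed

definition bump :: "real ^ 'n::finite \<Rightarrow> real" where
  "bump x = smoothstep (2 - x \<bullet> x)"

lemma bump_values:
  "0 \<le> bump x" "bump x \<le> 1" "norm x \<le> 1 \<Longrightarrow> bump x = 1" "3/2 \<le> norm x \<Longrightarrow> bump x = 0"
proof -
  show "0 \<le> bump x" "bump x \<le> 1" by (auto simp: bump_def smoothstep_values)
  assume "norm x \<le> 1"
  then have "(norm x)\<^sup>2 \<le> 1\<^sup>2" by (intro power_mono) auto
  then show "bump x = 1" by (simp add: bump_def smoothstep_values dot_square_norm)
next
  assume "3/2 \<le> norm x"
  then have "(3/2)\<^sup>2 \<le> (norm x)\<^sup>2" by (intro power_mono) auto
  then show "bump x = 0" by (simp add: bump_def smoothstep_values dot_square_norm power2_eq_square)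
qed

lemma bump_C1c: "bump \<in> C1c (ball 0 2)"
proof -
  let ?g = "\<lambda>x :: real ^ 'n. (- 2 * smoothstep' (2 - x \<bullet> x)) *\<^sub>R x"
  have der: "(bump has_derivative (\<lambda>h. ?g x \<bullet> h)) (at x)" for x :: "real ^ 'n"
  proof -
    have "((\<lambda>x. 2 - x \<bullet> x) has_derivative (\<lambda>h. - 2 * (x \<bullet> h))) (at x)"
      by (auto intro!: derivative_eq_intros simp: inner_commute)
    from has_derivative_compose[OF this smoothstep_derivative[unfolded has_field_derivative_def]]
    show ?thesis by (simp add: bump_def[abs_def] mult_ac)
  qed
  have cont: "continuous_on UNIV ?g"
    by (intro continuous_intros continuous_on_compose2[OF continuous_smoothstep']) auto
  show ?thesis
    by (rule C1cI(1)[OF der cont, of "cball 0 (3/2)"]) (auto intro: bump_values(4))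
qed

lemma grad_bump_eq_0:
  fixes x :: "real ^ 'n::finite"
  assumes "norm x < 1 \<or> 3/2 < norm x"
  shows "grad bump x = 0"
proof (cases "norm x < 1")
  case True
  have "(bump has_derivative (\<lambda>h. 0 \<bullet> h)) (at x)"
    using has_derivative_transform_within_open[of "\<lambda>_. 1::real" "\<lambda>_. 0" x UNIV "ball 0 1" bump] True
    by (auto simp: bump_values)
  then show ?thesis by (rule grad_eqI)
next
  case False
  then show ?thesis
    using assms by (intro grad_eq_0_outside[of "cball 0 (3/2)"]) (auto intro: bump_values(4))
qed

lemma C1c_affine:
  fixes f :: "real ^ 'n::finite \<Rightarrow> real"
  assumes f: "f \<in> C1c \<Omega>" and s: "s \<noteq> 0"
  shows "(\<lambda>x. f ((1 / s) *\<^sub>R (x - c))) \<in> C1c ((\<lambda>x. c + s *\<^sub>R x) ` \<Omega>)"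
    and "grad (\<lambda>x. f ((1 / s) *\<^sub>R (x - c))) = (\<lambda>x. (1 / s) *\<^sub>R grad f ((1 / s) *\<^sub>R (x - c)))"
proof -
  obtain K where K: "compact K" "K \<subseteq> \<Omega>" "\<And>x. x \<notin> K \<Longrightarrow> f x = 0"
    using C1c_support[OF f] by metis
  let ?T = "\<lambda>x. (1 / s) *\<^sub>R (x - c)"
  let ?K = "(\<lambda>x. c + s *\<^sub>R x) ` K"
  have d: "((\<lambda>x. f (?T x)) has_derivative (\<lambda>h. ((1 / s) *\<^sub>R grad f (?T x)) \<bullet> h)) (at x)" for x
  proof -
    have "(?T has_derivative (\<lambda>h. (1 / s) *\<^sub>R h)) (at x)"
      by (auto intro!: derivative_eq_intros)
    from has_derivative_compose[OF this C1c_derivative[OF f]] show ?thesis by simp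
  qed
  have c: "continuous_on UNIV (\<lambda>x. (1 / s) *\<^sub>R grad f (?T x))"
    by (intro continuous_intros continuous_on_compose2[OF C1c_continuous_grad[OF f]]) auto
  have k: "compact ?K" using K(1) by (intro compact_continuous_image continuous_intros) auto
  have sub: "?K \<subseteq> (\<lambda>x. c + s *\<^sub>R x) ` \<Omega>" using K(2) by blast
  have z: "f (?T x) = 0" if "x \<notin> ?K" for x
  proof (rule K(3))
    show "?T x \<notin> K"
    proof
      assume "?T x \<in> K"
      then have "c + s *\<^sub>R ?T x \<in> ?K" by blast
      with that s show False by simp
    qed
  qed
  show "(\<lambda>x. f (?T x)) \<in> C1c ((\<lambda>x. c + s *\<^sub>R x) ` \<Omega>)" "grad (\<lambda>x. f (?T x)) = (\<lambda>x. (1 / s) *\<^sub>R grad f (?T x))"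
    using C1cI[OF d c k sub z] by auto
qed

lemma nn_integral_affine:
  fixes h :: "'a::euclidean_space \<Rightarrow> ennreal"
  assumes [measurable]: "h \<in> borel_measurable borel" and s: "0 < s"
  shows "(\<integral>\<^sup>+x. h ((1 / s) *\<^sub>R (x - c)) \<partial>lborel) = ennreal (s ^ DIM('a)) * (\<integral>\<^sup>+x. h x \<partial>lborel)"
proof -
  have "(\<integral>\<^sup>+x. h ((1 / s) *\<^sub>R (x - c)) \<partial>lborel)
      = (\<integral>\<^sup>+x. h ((1 / s) *\<^sub>R (x - c)) \<partial>density (distr lborel borel (\<lambda>x. c + s *\<^sub>R x)) (\<lambda>_. ennreal (\<bar>s\<bar> ^ DIM('a))))"
    using lborel_affine[of s c] s by simp
  also have "\<dots> = ennreal (\<bar>s\<bar> ^ DIM('a)) * (\<integral>\<^sup>+x. h ((1 / s) *\<^sub>R ((c + s *\<^sub>R x) - c)) \<partial>lborel)"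
    by (subst nn_integral_density) (simp_all add: nn_integral_distr nn_integral_cmult)
  finally show ?thesis using s by simp
qed

lemma mass_affine:
  fixes f :: "real ^ 'n::finite \<Rightarrow> real"
  assumes f: "f \<in> C1c \<Omega>" and s: "0 < s"
  shows "mass p (\<lambda>x. f ((1 / s) *\<^sub>R (x - c))) = ennreal (s ^ CARD('n)) * mass p f"
  unfolding mass_def using C1c_measurable[OF f]
    nn_integral_affine[of "\<lambda>x. ennreal (\<bar>f x\<bar> powr p)" s c] s
  by simp

lemma energy_affine:
  fixes f :: "real ^ 'n::finite \<Rightarrow> real"
  assumes f: "f \<in> C1c \<Omega>" and s: "0 < s"
  shows "energy p (\<lambda>x. f ((1 / s) *\<^sub>R (x - c))) = ennreal (s ^ CARD('n) * s powr (- p)) * energy p f"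
proof -
  have m: "(\<lambda>x. ennreal (norm (grad f x) powr p)) \<in> borel_measurable borel"
    using C1c_measurable[OF f] by measurable
  have sp: "norm ((1 / s) *\<^sub>R v) powr p = s powr (- p) * norm v powr p" for v :: "real ^ 'n"
  proof -
    have "norm ((1 / s) *\<^sub>R v) = norm v / s" using s by simp
    then show ?thesis using s by (simp add: powr_divide powr_minus_divide)
  qed
  have "energy p (\<lambda>x. f ((1 / s) *\<^sub>R (x - c)))
      = (\<integral>\<^sup>+x. ennreal (s powr (- p)) * ennreal (norm (grad f ((1 / s) *\<^sub>R (x - c))) powr p) \<partial>lborel)"
    unfolding energy_def C1c_affine(2)[OF f less_imp_neq[OF s, symmetric]] sp by (simp add: ennreal_mult)
  also have "\<dots> = ennreal (s powr (- p)) * (\<integral>\<^sup>+x. ennreal (norm (grad f ((1 / s) *\<^sub>R (x - c))) powr p) \<partial>lborel)"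
    by (intro nn_integral_cmult measurable_compose[OF _ m]) simp
  also have "\<dots> = ennreal (s powr (- p)) * (ennreal (s ^ CARD('n)) * energy p f)"
    using nn_integral_affine[OF m s, of c] by (simp add: energy_def)
  also have "\<dots> = ennreal (s ^ CARD('n) * s powr (- p)) * energy p f"
    using s by (simp add: ennreal_mult mult_ac)
  finally show ?thesis .
qed

lemma mass_eq_0_iff:
  fixes f :: "real ^ 'n::finite \<Rightarrow> real"
  assumes f: "f \<in> C1c \<Omega>"
  shows "mass p f = 0 \<longleftrightarrow> (AE x in lborel. f x = 0)"
  unfolding mass_def using C1c_measurable[OF f] by (subst nn_integral_0_iff_AE) auto

lemma mass_finite:
  fixes f :: "real ^ 'n::finite \<Rightarrow> real"
  assumes f: "f \<in> C1c \<Omega>" and p: "1 \<le> p"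
  shows "mass p f < top" "energy p f < top"
  unfolding mass_def energy_def using C1c_integrable_powr[OF f p]
  by (simp_all add: nn_integral_eq_integral)

lemma mass_pos:
  fixes f :: "real ^ 'n::finite \<Rightarrow> real"
  assumes f: "f \<in> C1c \<Omega>" and U: "open U" "U \<noteq> {}" "\<And>x. x \<in> U \<Longrightarrow> f x \<noteq> 0"
  shows "0 < mass p f"
proof -
  have "\<not> (AE x in lborel. f x = 0)"
  proof
    assume "AE x in lborel. f x = 0"
    then have "AE x in lborel. x \<notin> U" by eventually_elim (use U in auto)
    then have "U \<in> null_sets lborel"
      using U(1) by (subst AE_iff_null_sets) auto
    then have "negligible U"
      by (simp add: negligible_iff_null_sets null_sets_completionI)
    then show False using open_not_negligible[OF U(1,2)] by simp
  qed
  then show ?thesis using mass_eq_0_iff[OF f] by (simp add: zero_less_iff_neq_zero)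
qed

lemma exists_test_function:
  fixes \<Omega> :: "(real ^ 'n::finite) set"
  assumes "open \<Omega>" "\<Omega> \<noteq> {}"
  obtains f where "f \<in> C1c \<Omega>" "\<And>p. 0 < mass p f"
proof -
  obtain x e where e: "0 < e" "ball x e \<subseteq> \<Omega>"
    using assms by (meson openE ex_in_conv)
  define f where "f = (\<lambda>y. bump ((1 / (e / 2)) *\<^sub>R (y - x)))"
  have "f \<in> C1c ((\<lambda>y. x + (e / 2) *\<^sub>R y) ` ball 0 2)"
    unfolding f_def using e by (intro C1c_affine bump_C1c) auto
  moreover have "(\<lambda>y. x + (e / 2) *\<^sub>R y) ` ball 0 2 \<subseteq> \<Omega>"
    using e by (auto simp: dist_norm intro!: subsetD[OF e(2)])
  ultimately have f: "f \<in> C1c \<Omega>" using C1c_mono by blast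
  have "f y \<noteq> 0" if "y \<in> ball x (e / 2)" for y
  proof -
    have "norm ((1 / (e / 2)) *\<^sub>R (y - x)) = norm (x - y) / (e / 2)"
      using e by (simp only: norm_scaleR norm_minus_commute[of y x]) simp
    also have "\<dots> \<le> 1" using that e by (simp add: dist_norm)
    finally have "norm ((1 / (e / 2)) *\<^sub>R (y - x)) \<le> 1" .
    then show ?thesis unfolding f_def by (subst bump_values(3)) auto
  qed
  then have "0 < mass p f" for p using e by (intro mass_pos[OF f, of "ball x (e / 2)"]) auto
  with f that show ?thesis by blast
qed

text \<open>Compactness of the support places every test function in a bounded open subset, where it is its own
  approximating sequence; conversely inequalities pass to limits of test functions. From here on the
  frequencies are only used through inequalities between masses and energies of test functions.\<close>

lemma lambda_ge_iff:
  fixes \<Omega> :: "(real ^ 'n::finite) set"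
  assumes \<Omega>: "open \<Omega>" "\<Omega> \<noteq> {}" and p: "1 \<le> p" and c: "0 \<le> c"
  shows "c \<le> lambda p \<Omega> \<longleftrightarrow> (\<forall>f\<in>C1c \<Omega>. ennreal c * mass p f \<le> energy p f)"
proof -
  define Q where "Q A = {(\<integral>x. norm (g x) powr p \<partial>lebesgue_on A) / (\<integral>x. \<bar>u x\<bar> powr p \<partial>lebesgue_on A) | u g.
            W1p0 p A u g \<and> \<not> (AE x in lebesgue_on A. u x = 0)}" for A :: "(real ^ 'n) set"
  have lQ: "lambda_bdd p A = Inf (Q A)" for A :: "(real ^ 'n) set" by (simp add: lambda_bdd_def Q_def)
  have Qbdd: "bdd_below (Q A)" "\<And>x. x \<in> Q A \<Longrightarrow> 0 \<le> x" for A
    by (auto simp: Q_def bdd_below_def intro!: exI[of _ 0])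
  have Qmem: "(\<integral>x. norm (grad f x) powr p \<partial>lebesgue_on A) / (\<integral>x. \<bar>f x\<bar> powr p \<partial>lebesgue_on A) \<in> Q A"
    if A: "open A" and f: "f \<in> C1c A" "0 < mass p f" for A f
  proof -
    have "\<not> (AE x in lebesgue_on A. f x = 0)"
    proof
      assume "AE x in lebesgue_on A. f x = 0"
      then have "(\<integral>x. \<bar>f x\<bar> powr p \<partial>lebesgue_on A) = (\<integral>x. 0 \<partial>lebesgue_on A)"
        using borel_measurable_integrable[OF C1c_integrals(1)[OF f(1) A p]]
        by (intro integral_cong_AE) (auto elim: eventually_mono)
      then show False using f C1c_integrals(3)[OF f(1) A p] by simp
    qed
    then show ?thesis using C1c_W1p0[OF f(1) A p] unfolding Q_def by blast
  qed
  have Qne: "Q A \<noteq> {}" if "open A" "A \<noteq> {}" for A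
    using exists_test_function[OF that] Qmem[OF that(1)] by (metis empty_iff)
  have lbd0: "0 \<le> lambda_bdd p A" if "open A" "A \<noteq> {}" for A :: "(real ^ 'n) set"
    unfolding lQ using Qne[OF that] Qbdd by (intro cInf_greatest) auto
  let ?L = "{lambda_bdd p A | A. A \<subseteq> \<Omega> \<and> open A \<and> bounded A \<and> A \<noteq> {}}"
  have Lbdd: "bdd_below ?L" using lbd0 by (auto simp: bdd_below_def intro!: exI[of _ 0])
  obtain x0 e0 where e0: "0 < e0" "ball x0 e0 \<subseteq> \<Omega>"
    using \<Omega> by (meson openE ex_in_conv)
  have Lne: "?L \<noteq> {}" using e0 by (auto intro!: exI[of _ "ball x0 e0"])
  show ?thesis
  proof
    assume H: "c \<le> lambda p \<Omega>"
    show "\<forall>f\<in>C1c \<Omega>. ennreal c * mass p f \<le> energy p f"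
    proof
      fix f assume f: "f \<in> C1c \<Omega>"
      show "ennreal c * mass p f \<le> energy p f"
      proof (cases "mass p f = 0")
        case True then show ?thesis by simp
      next
        case False
        obtain K where K: "compact K" "K \<subseteq> \<Omega>" "\<And>x. x \<notin> K \<Longrightarrow> f x = 0"
          using C1c_support[OF f] by metis
        obtain R where R: "0 < R" "K \<subseteq> ball 0 R"
          using bounded_subset_ballD[OF compact_imp_bounded[OF K(1)]] by metis
        define A where "A = (\<Omega> \<inter> ball 0 R)"
        have A: "open A" "bounded A" "A \<subseteq> \<Omega>" "K \<subseteq> A"
          using \<Omega> K R by (auto simp: A_def)
        have fA: "f \<in> C1c A" using C1c_change_domain[OF f K(1) A(4) K(3)] .
        have "K \<noteq> {}" using False K(3) by (auto simp: mass_def)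
        with A have Ane: "A \<noteq> {}" by auto
        have m: "0 < mass p f" using False by (simp add: zero_less_iff_neq_zero)
        define G where "G = (\<integral>x. norm (grad f x) powr p \<partial>lebesgue_on A)"
        define U where "U = (\<integral>x. \<bar>f x\<bar> powr p \<partial>lebesgue_on A)"
        have GU: "ennreal G = energy p f" "ennreal U = mass p f"
          using C1c_integrals(3,4)[OF fA A(1) p] by (simp_all add: G_def U_def)
        have U: "0 < U" using m GU(2) by (metis ennreal_less_zero_iff)
        have "c \<le> lambda_bdd p A"
          using H cInf_lower[OF _ Lbdd] A Ane unfolding lambda_def by force
        also have "\<dots> \<le> G / U"
          unfolding lQ G_def U_def using Qmem[OF A(1) fA m] Qbdd by (intro cInf_lower) auto
        finally have "c * U \<le> G" using U by (simp add: field_simps)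
        then have "ennreal (c * U) \<le> ennreal G" by (rule ennreal_leI)
        then show ?thesis using c U by (simp add: GU[symmetric] ennreal_mult)
      qed
    qed
  next
    assume H: "\<forall>f\<in>C1c \<Omega>. ennreal c * mass p f \<le> energy p f"
    show "c \<le> lambda p \<Omega>"
      unfolding lambda_def
    proof (rule cInf_greatest[OF Lne])
      fix l assume "l \<in> ?L"
      then obtain A where A: "l = lambda_bdd p A" "A \<subseteq> \<Omega>" "open A" "A \<noteq> {}" by auto
      have HA: "ennreal c * mass p f \<le> energy p f" if "f \<in> C1c A" for f
        using H that C1c_mono[OF A(2)] by blast
      show "c \<le> l"
        unfolding A(1) lQ
      proof (rule cInf_greatest[OF Qne[OF A(3,4)]])
        fix y assume "y \<in> Q A"
        then obtain u g where "W1p0 p A u g" "\<not> (AE x in lebesgue_on A. u x = 0)"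
          "y = (\<integral>x. norm (g x) powr p \<partial>lebesgue_on A) / (\<integral>x. \<bar>u x\<bar> powr p \<partial>lebesgue_on A)"
          unfolding Q_def by auto
        then show "c \<le> y" using W1p0_quotient_ge[OF A(3) p c HA] by simp
      qed
    qed
  qed
qed

lemma lambda_nonneg:
  fixes \<Omega> :: "(real ^ 'n::finite) set"
  assumes "open \<Omega>" "\<Omega> \<noteq> {}" "1 \<le> p"
  shows "0 \<le> lambda p \<Omega>"
  using lambda_ge_iff[OF assms, of 0] by simp

section \<open>Structural properties of the frequencies\<close>

text \<open>Frequencies are compared through their positive real lower bounds a, since such a bound is an
  inequality for all test functions (or, for the inradius, for all balls).\<close>

lemma ennreal_le_by_reals:
  assumes "\<And>a. 0 < a \<Longrightarrow> ennreal a \<le> x \<Longrightarrow> ennreal a \<le> y"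
  shows "x \<le> y"
proof (rule ccontr)
  assume "\<not> x \<le> y"
  then obtain z where z: "y < z" "z < x" using dense by (metis not_le)
  then have "z \<noteq> top" "z \<noteq> 0" by auto
  then obtain a where "z = ennreal a" "0 < a"
    by (cases z) (auto simp: ennreal_eq_0_iff less_le)
  then have "z \<le> y" using assms[of a] z by simp
  with z(1) show False by simp
qed

lemma enn2real_ge_1:
  assumes "1 \<le> p" "p \<noteq> top"
  shows "1 \<le> enn2real p" "ennreal (enn2real p) = p"
  using assms by (cases p; auto simp: top_unique)+

lemma le_lambda_root_iff:
  fixes \<Omega> :: "(real ^ 'n::finite) set"
  assumes \<Omega>: "open \<Omega>" "\<Omega> \<noteq> {}" and p: "1 \<le> p" "p \<noteq> top" and a: "0 \<le> a"
  shows "ennreal a \<le> lambda_root p \<Omega> \<longleftrightarrow>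
    (\<forall>f\<in>C1c \<Omega>. ennreal (a powr enn2real p) * mass (enn2real p) f \<le> energy (enn2real p) f)"
proof -
  define r where "r = enn2real p"
  have r: "1 \<le> r" using enn2real_ge_1[OF p] by (simp add: r_def)
  define l where "l = lambda r \<Omega>"
  have l: "0 \<le> l" using lambda_nonneg[OF \<Omega> r] by (simp add: l_def)
  have "ennreal a \<le> lambda_root p \<Omega> \<longleftrightarrow> a \<le> l powr (1 / r)"
    using p by (simp add: lambda_root_def r_def[symmetric] l_def[symmetric])
  also have "\<dots> \<longleftrightarrow> a powr r \<le> l"
  proof
    assume "a \<le> l powr (1 / r)"
    then have "a powr r \<le> (l powr (1 / r)) powr r" using a r by (intro powr_mono2) auto
    then show "a powr r \<le> l" using r l by (simp add: powr_powr)
  next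
    assume "a powr r \<le> l"
    then have "(a powr r) powr (1 / r) \<le> l powr (1 / r)" using r by (intro powr_mono2) auto
    then show "a \<le> l powr (1 / r)" using r a by (simp add: powr_powr)
  qed
  also have "\<dots> \<longleftrightarrow> (\<forall>f\<in>C1c \<Omega>. ennreal (a powr r) * mass r f \<le> energy r f)"
    unfolding l_def by (rule lambda_ge_iff[OF \<Omega> r]) simp
  finally show ?thesis by (simp add: r_def)
qed

lemma le_inverse_ennreal_iff:
  fixes \<rho> :: ennreal
  assumes a: "0 < a"
  shows "ennreal a \<le> inverse \<rho> \<longleftrightarrow> \<rho> \<le> ennreal (1 / a)"
proof (cases \<rho>)
  case (real t)
  show ?thesis
  proof (cases "t = 0")
    case False
    then show ?thesis using real a by (simp add: inverse_ennreal field_simps)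
  qed (use real a in simp)
next
  case top
  then show ?thesis using a by (simp add: top_unique)
qed

lemma le_lambda_root_top_iff:
  fixes \<Omega> :: "(real ^ 'n::finite) set"
  assumes a: "0 < a"
  shows "ennreal a \<le> lambda_root top \<Omega> \<longleftrightarrow> (\<forall>x r. 0 < r \<and> ball x r \<subseteq> \<Omega> \<longrightarrow> r \<le> 1 / a)"
proof -
  have "ennreal a \<le> lambda_root top \<Omega> \<longleftrightarrow> inradius \<Omega> \<le> ennreal (1 / a)"
    using le_inverse_ennreal_iff[OF a] by (simp add: lambda_root_def)
  also have "\<dots> \<longleftrightarrow> (\<forall>x r. 0 < r \<and> ball x r \<subseteq> \<Omega> \<longrightarrow> ennreal r \<le> ennreal (1 / a))"
    unfolding inradius_def Sup_le_iff by blast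
  also have "\<dots> \<longleftrightarrow> (\<forall>x r. 0 < r \<and> ball x r \<subseteq> \<Omega> \<longrightarrow> r \<le> 1 / a)"
    using a by (simp add: ennreal_le_iff)
  finally show ?thesis .
qed

lemma lambda_root_antimono:
  fixes A B :: "(real ^ 'n::finite) set"
  assumes "open A" "A \<noteq> {}" "open B" "A \<subseteq> B" "1 \<le> p"
  shows "lambda_root p B \<le> lambda_root p A"
proof (rule ennreal_le_by_reals)
  fix a :: real assume a: "0 < a" "ennreal a \<le> lambda_root p B"
  show "ennreal a \<le> lambda_root p A"
  proof (cases "p = top")
    case True
    then show ?thesis using a assms by (auto simp: le_lambda_root_top_iff)
  next
    case False
    have "B \<noteq> {}" using assms by auto
    then have "\<forall>f\<in>C1c B. ennreal (a powr enn2real p) * mass (enn2real p) f \<le> energy (enn2real p) f"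
      using a le_lambda_root_iff[OF assms(3) _ assms(5) False, of a] by simp
    then show ?thesis
      using a(1) le_lambda_root_iff[OF assms(1,2,5) False, of a] subsetD[OF C1c_mono[OF assms(4)]] by simp
  qed
qed

lemma affine_image_open:
  fixes \<Omega> :: "'a::real_normed_vector set"
  assumes "open \<Omega>" "s \<noteq> 0"
  shows "open ((\<lambda>x. c + s *\<^sub>R x) ` \<Omega>)"
proof -
  have "(\<lambda>x. c + s *\<^sub>R x) ` \<Omega> = (+) c ` ((\<lambda>x. s *\<^sub>R x) ` \<Omega>)" by (simp only: image_image)
  then show ?thesis using assms by (simp add: open_translation open_scaling)
qed

lemma affine_ball:
  fixes x :: "'a::real_normed_vector"
  assumes "0 < s"
  shows "(\<lambda>y. c + s *\<^sub>R y) ` ball x r = ball (c + s *\<^sub>R x) (s * r)"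
proof -
  have "(\<lambda>y. c + s *\<^sub>R y) ` ball x r = (+) c ` ((\<lambda>y. s *\<^sub>R y) ` ball x r)" by (simp only: image_image)
  then show ?thesis using ball_scale[of s x r] assms by (simp add: ball_translation del: image_add_ball)
qed

lemma affine_image_inverse:
  fixes \<Omega> :: "'a::real_normed_vector set"
  assumes "s \<noteq> 0"
  shows "(\<lambda>x. - ((1 / s) *\<^sub>R c) + (1 / s) *\<^sub>R x) ` ((\<lambda>x. c + s *\<^sub>R x) ` \<Omega>) = \<Omega>"
  using assms by (simp add: image_image scaleR_add_right)

text \<open>Test functions are transported along the affine map; the powers of s in mass and energy differ by
  s powr (- p).\<close>

lemma lambda_root_affine_ge:
  fixes \<Omega> :: "(real ^ 'n::finite) set"
  assumes \<Omega>: "open \<Omega>" "\<Omega> \<noteq> {}" and p: "1 \<le> p" and s: "0 < s" and a: "0 < a"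
    and H: "ennreal a \<le> lambda_root p ((\<lambda>x. c + s *\<^sub>R x) ` \<Omega>)"
  shows "ennreal (a * s) \<le> lambda_root p \<Omega>"
proof (cases "p = top")
  case True
  have "r \<le> 1 / (a * s)" if "0 < r" "ball x r \<subseteq> \<Omega>" for x r
  proof -
    have "ball (c + s *\<^sub>R x) (s * r) \<subseteq> (\<lambda>x. c + s *\<^sub>R x) ` \<Omega>"
      unfolding affine_ball[OF s, symmetric] using that by blast
    then have "s * r \<le> 1 / a" using H that s a True by (simp add: le_lambda_root_top_iff)
    then show ?thesis using s a by (simp add: field_simps)
  qed
  then show ?thesis using le_lambda_root_top_iff[of "a * s" \<Omega>] True a s by auto
next
  case False
  let ?T = "\<lambda>x :: real ^ 'n. c + s *\<^sub>R x"
  let ?r = "enn2real p"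
  have T: "open (?T ` \<Omega>)" "?T ` \<Omega> \<noteq> {}" using affine_image_open[OF \<Omega>(1), of s c] \<Omega> s by auto
  have "ennreal ((a * s) powr ?r) * mass ?r f \<le> energy ?r f" if f: "f \<in> C1c \<Omega>" for f
  proof -
    have s0: "s \<noteq> 0" using s by simp
    have mm: "ennreal x * (ennreal y * M) = ennreal (x * y) * M" if "0 \<le> x" "0 \<le> y" for x y and M :: ennreal
      using that by (simp add: ennreal_mult mult.assoc)
    have "ennreal (a powr ?r) * mass ?r (\<lambda>x. f ((1 / s) *\<^sub>R (x - c))) \<le> energy ?r (\<lambda>x. f ((1 / s) *\<^sub>R (x - c)))"
      using H C1c_affine(1)[OF f s0, of c] le_lambda_root_iff[OF T p False] a by auto
    then have "ennreal (a powr ?r) * (ennreal (s ^ CARD('n)) * mass ?r f)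
        \<le> ennreal (s ^ CARD('n) * s powr (- ?r)) * energy ?r f"
      unfolding mass_affine[OF f s] energy_affine[OF f s] .
    then have "ennreal (s powr ?r / s ^ CARD('n)) * (ennreal (a powr ?r) * (ennreal (s ^ CARD('n)) * mass ?r f))
        \<le> ennreal (s powr ?r / s ^ CARD('n)) * (ennreal (s ^ CARD('n) * s powr (- ?r)) * energy ?r f)"
      by (rule mult_left_mono) simp
    moreover have "ennreal (s powr ?r / s ^ CARD('n)) * (ennreal (a powr ?r) * (ennreal (s ^ CARD('n)) * mass ?r f))
        = ennreal (s powr ?r / s ^ CARD('n) * (a powr ?r * s ^ CARD('n))) * mass ?r f"
      using s by (simp only: mm powr_ge_zero mult_nonneg_nonneg zero_le_power less_imp_le zero_le_divide_iff simp_thms)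
    moreover have "s powr ?r / s ^ CARD('n) * (a powr ?r * s ^ CARD('n)) = (a * s) powr ?r"
      using s a by (simp add: powr_mult)
    moreover have "ennreal (s powr ?r / s ^ CARD('n)) * (ennreal (s ^ CARD('n) * s powr (- ?r)) * energy ?r f)
        = ennreal (s powr ?r / s ^ CARD('n) * (s ^ CARD('n) * s powr (- ?r))) * energy ?r f"
      using s by (simp only: mm powr_ge_zero mult_nonneg_nonneg zero_le_power less_imp_le zero_le_divide_iff simp_thms)
    moreover have "s powr ?r / s ^ CARD('n) * (s ^ CARD('n) * s powr (- ?r)) = 1"
      using s by (simp add: powr_minus)
    ultimately show ?thesis by simp
  qed
  then show ?thesis using le_lambda_root_iff[OF \<Omega> p False, of "a * s"] a s by simp
qed

lemma lambda_root_affine_iff: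
  fixes \<Omega> :: "(real ^ 'n::finite) set"
  assumes \<Omega>: "open \<Omega>" "\<Omega> \<noteq> {}" and p: "1 \<le> p" and s: "0 < s" and a: "0 < a"
  shows "ennreal a \<le> lambda_root p ((\<lambda>x. c + s *\<^sub>R x) ` \<Omega>) \<longleftrightarrow> ennreal (a * s) \<le> lambda_root p \<Omega>"
proof
  assume H: "ennreal (a * s) \<le> lambda_root p \<Omega>"
  let ?A = "(\<lambda>x. c + s *\<^sub>R x) ` \<Omega>"
  have A: "open ?A" "?A \<noteq> {}" using affine_image_open[OF \<Omega>(1), of s c] \<Omega> s by auto
  have "ennreal (a * s * (1 / s)) \<le> lambda_root p ?A"
    by (rule lambda_root_affine_ge[OF A p, where c="- ((1 / s) *\<^sub>R c)"])
       (use H affine_image_inverse[of s c \<Omega>] s a in auto)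
  then show "ennreal a \<le> lambda_root p ?A" using s by simp
qed (rule lambda_root_affine_ge[OF assms])

lemma lambda_root_affine:
  fixes \<Omega> :: "(real ^ 'n::finite) set"
  assumes \<Omega>: "open \<Omega>" "\<Omega> \<noteq> {}" and p: "1 \<le> p" and s: "0 < s"
  shows "lambda_root p ((\<lambda>x. c + s *\<^sub>R x) ` \<Omega>) = lambda_root p \<Omega> / ennreal s"
proof -
  have *: "ennreal a \<le> L / ennreal s \<longleftrightarrow> ennreal (a * s) \<le> L" if "0 < a" for a and L :: ennreal
  proof -
    have "ennreal a \<le> L / ennreal s \<longleftrightarrow> ennreal a * ennreal s \<le> L"
    proof (cases L)
      case (real l)
      then show ?thesis using s that
        by (simp add: divide_ennreal ennreal_mult[symmetric] pos_le_divide_eq)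
    next
      case top
      then show ?thesis using s by (simp add: ennreal_top_divide)
    qed
    then show ?thesis using that s by (simp add: ennreal_mult)
  qed
  show ?thesis
  proof (rule antisym)
    show "lambda_root p ((\<lambda>x. c + s *\<^sub>R x) ` \<Omega>) \<le> lambda_root p \<Omega> / ennreal s"
      by (rule ennreal_le_by_reals) (simp add: * lambda_root_affine_iff[OF \<Omega> p s])
    show "lambda_root p \<Omega> / ennreal s \<le> lambda_root p ((\<lambda>x. c + s *\<^sub>R x) ` \<Omega>)"
      by (rule ennreal_le_by_reals) (simp add: * lambda_root_affine_iff[OF \<Omega> p s])
  qed
qed

text \<open>The part of a compact set inside one of two disjoint open sets is compact, so that the restriction
  vanishes near the boundary of U.\<close>

lemma C1c_restrict:
  fixes f :: "real ^ 'n::finite \<Rightarrow> real"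
  assumes f: "f \<in> C1c (U \<union> V)" and U: "open U" and V: "open V" and UV: "U \<inter> V = {}"
  shows "(\<lambda>x. if x \<in> U then f x else 0) \<in> C1c U"
    and "grad (\<lambda>x. if x \<in> U then f x else 0) = (\<lambda>x. if x \<in> U then grad f x else 0)"
proof -
  obtain K where K: "compact K" "K \<subseteq> U \<union> V" "\<And>x. x \<notin> K \<Longrightarrow> f x = 0" "\<And>x. x \<notin> K \<Longrightarrow> grad f x = 0"
    using C1c_support[OF f] by metis
  define H where "H = K - V"
  have H: "compact H" "H \<subseteq> U" "U \<inter> K \<subseteq> H" using K UV V by (auto simp: H_def compact_diff)
  have oH: "open (- H)" using H(1) by (simp add: compact_imp_closed open_Compl)
  let ?h = "\<lambda>x. if x \<in> U then f x else 0" and ?g = "\<lambda>x. if x \<in> U then grad f x else 0"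
  have z: "?h x = 0" "?g x = 0" if "x \<notin> H" for x using that H K(3,4) by auto
  have d: "(?h has_derivative (\<lambda>k. ?g x \<bullet> k)) (at x)" for x
  proof (cases "x \<in> U")
    case True
    have "(?h has_derivative (\<lambda>k. grad f x \<bullet> k)) (at x)"
      by (rule has_derivative_transform_within_open[OF C1c_derivative[OF f] U True]) simp
    with True show ?thesis by simp
  next
    case False
    then have x: "x \<in> - H" using H by auto
    have "(?h has_derivative (\<lambda>k. 0)) (at x)"
      by (rule has_derivative_transform_within_open[OF has_derivative_const oH x]) (use z(1) in auto)
    with False show ?thesis by simp
  qed
  have "continuous_on U ?g"
    by (rule continuous_on_eq[OF continuous_on_subset[OF C1c_continuous_grad[OF f]]]) auto
  moreover have "continuous_on (- H) ?g"
    by (rule continuous_on_eq[OF continuous_on_const[of _ 0]]) (use z(2) in auto)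
  ultimately have "continuous_on (U \<union> - H) ?g"
    using U oH by (intro continuous_on_open_Un) auto
  moreover have "U \<union> - H = UNIV" using H by auto
  ultimately have c: "continuous_on UNIV ?g" by simp
  show "?h \<in> C1c U" "grad ?h = ?g" using C1cI[OF d c H(1,2) z(1)] by auto
qed

lemma nn_integral_disjoint_cover:
  fixes h :: "'a \<Rightarrow> ennreal" and A :: "'i \<Rightarrow> 'a set"
  assumes h: "h \<in> borel_measurable M" and I: "countable I" and A: "\<And>i. i \<in> I \<Longrightarrow> A i \<in> sets M"
    and disj: "disjoint_family_on A I" and z: "\<And>x. x \<in> space M \<Longrightarrow> x \<notin> (\<Union>i\<in>I. A i) \<Longrightarrow> h x = 0"
  shows "(\<integral>\<^sup>+x. h x \<partial>M) = (\<integral>\<^sup>+i. (\<integral>\<^sup>+x. h x * indicator (A i) x \<partial>M) \<partial>count_space I)"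
proof -
  have U: "(\<Union>i\<in>I. A i) \<in> sets M" using A I by (intro sets.countable_UN') auto
  have "(\<integral>\<^sup>+x. h x \<partial>M) = (\<integral>\<^sup>+x. h x * indicator (\<Union>i\<in>I. A i) x \<partial>M)"
    using z by (intro nn_integral_cong) (auto simp: indicator_def)
  also have "\<dots> = emeasure (density M h) (\<Union>i\<in>I. A i)"
    using h U by (simp add: emeasure_density)
  also have "\<dots> = (\<integral>\<^sup>+i. emeasure (density M h) (A i) \<partial>count_space I)"
    using A I disj by (intro emeasure_UN_countable) auto
  also have "\<dots> = (\<integral>\<^sup>+i. (\<integral>\<^sup>+x. h x * indicator (A i) x \<partial>M) \<partial>count_space I)"
    using h A by (intro nn_integral_cong) (simp add: emeasure_density)
  finally show ?thesis .
qed

lemma powr_if_indicator: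
  fixes v :: "'a::real_normed_vector"
  shows "ennreal (norm (if x \<in> A then v else 0) powr p) = ennreal (norm v powr p) * indicator A x"
  by (simp add: indicator_def)

text \<open>A test function of a disjoint union is a sum of test functions of the members, whose masses and
  energies add up; hence a lower bound common to the members is one for the union. For the inradius,
  a ball is connected and lies in a single member.\<close>

lemma lambda_root_disjoint_Union:
  fixes A :: "nat \<Rightarrow> (real ^ 'n::finite) set"
  assumes A: "\<And>n. open (A n)" "\<And>n. A n \<noteq> {}" and disj: "disjoint_family A" and p: "1 \<le> p"
  shows "lambda_root p (\<Union>n. A n) = (INF n. lambda_root p (A n))"
proof (rule antisym)
  have U: "open (\<Union>n. A n)" "(\<Union>n. A n) \<noteq> {}" using A by auto
  show "lambda_root p (\<Union>n. A n) \<le> (INF n. lambda_root p (A n))"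
    using A U p by (intro INF_greatest lambda_root_antimono) auto
  show "(INF n. lambda_root p (A n)) \<le> lambda_root p (\<Union>n. A n)"
  proof (rule ennreal_le_by_reals)
    fix a :: real assume a: "0 < a" "ennreal a \<le> (INF n. lambda_root p (A n))"
    then have aA: "ennreal a \<le> lambda_root p (A n)" for n by (simp add: le_INF_iff)
    define V where "V n = (\<Union>m\<in>- {n}. A m)" for n
    have V: "open (V n)" "A n \<inter> V n = {}" "(\<Union>n. A n) = A n \<union> V n" for n
      using A(1) disj by (auto simp: V_def disjoint_family_on_def open_UN)
    show "ennreal a \<le> lambda_root p (\<Union>n. A n)"
    proof (cases "p = top")
      case True
      have "r \<le> 1 / a" if r: "0 < r" "ball x r \<subseteq> (\<Union>n. A n)" for x r
      proof -
        have "x \<in> (\<Union>n. A n)" using r by (auto simp: subset_iff)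
        then obtain n where n: "x \<in> A n" by blast
        have "V n \<inter> ball x r = {}"
        proof (rule ccontr)
          assume "V n \<inter> ball x r \<noteq> {}"
          moreover have "A n \<inter> ball x r \<noteq> {}" using n r by auto
          ultimately show False
            using connectedD[OF connected_ball A(1)[of n] V(1)[of n], of x r] V(2)[of n] r(2) unfolding V(3)[of n] by auto
        qed
        then have "ball x r \<subseteq> A n" using r V(3)[of n] by auto
        then show ?thesis using aA[of n] a(1) r True by (simp add: le_lambda_root_top_iff)
      qed
      then show ?thesis unfolding True le_lambda_root_top_iff[OF a(1)] by blast
    next
      case False
      let ?r = "enn2real p"
      have "ennreal (a powr ?r) * mass ?r f \<le> energy ?r f" if f: "f \<in> C1c (\<Union>n. A n)" for f
      proof -
        obtain K where K: "compact K" "K \<subseteq> (\<Union>n. A n)" "\<And>x. x \<notin> K \<Longrightarrow> f x = 0" "\<And>x. x \<notin> K \<Longrightarrow> grad f x = 0"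
          using C1c_support[OF f] by metis
        have z: "f x = 0" "grad f x = 0" if "x \<notin> (\<Union>n. A n)" for x
          using that K(2) K(3,4)[of x] by auto
        define h where "h n = (\<lambda>x. if x \<in> A n then f x else 0)" for n
        have h: "h n \<in> C1c (A n)" "grad (h n) = (\<lambda>x. if x \<in> A n then grad f x else 0)" for n
          unfolding h_def using C1c_restrict[OF f[unfolded V(3)[of n]] A(1) V(1,2)] by auto
        have m: "mass ?r f = (\<integral>\<^sup>+n. mass ?r (h n) \<partial>count_space UNIV)"
          unfolding mass_def h_def real_norm_def[symmetric] powr_if_indicator
          using C1c_measurable[OF f] A(1) disj z by (intro nn_integral_disjoint_cover) auto
        have e: "energy ?r f = (\<integral>\<^sup>+n. energy ?r (h n) \<partial>count_space UNIV)"
          unfolding energy_def h powr_if_indicator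
          using C1c_measurable[OF f] A(1) disj z by (intro nn_integral_disjoint_cover) auto
        have "ennreal (a powr ?r) * mass ?r f = (\<integral>\<^sup>+n. ennreal (a powr ?r) * mass ?r (h n) \<partial>count_space UNIV)"
          unfolding m by (simp add: nn_integral_cmult)
        also have "\<dots> \<le> (\<integral>\<^sup>+n. energy ?r (h n) \<partial>count_space UNIV)"
          using aA h(1) le_lambda_root_iff[OF A p False, of a] a(1) by (intro nn_integral_mono) auto
        finally show ?thesis unfolding e .
      qed
      then show ?thesis using le_lambda_root_iff[OF U p False, of a] a(1) by auto
    qed
  qed
qed

text \<open>A strict upper bound is witnessed by one test function, whose support is compact, or for p = top by
  one closed ball.\<close>

lemma lambda_root_inner_approx:
  fixes \<Omega> :: "(real ^ 'n::finite) set"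
  assumes \<Omega>: "open \<Omega>" "\<Omega> \<noteq> {}" and p: "1 \<le> p" and l: "lambda_root p \<Omega> < a"
  obtains K where "compact K" "K \<subseteq> \<Omega>" "\<And>A. open A \<Longrightarrow> A \<noteq> {} \<Longrightarrow> K \<subseteq> A \<Longrightarrow> lambda_root p A < a"
proof -
  obtain b' where b': "lambda_root p \<Omega> < b'" "b' < a" using l dense by blast
  then have "b' \<noteq> top" "b' \<noteq> 0" by auto
  then obtain b where b: "b' = ennreal b" "0 < b"
    by (cases b') (auto simp: ennreal_eq_0_iff less_le)
  have nb: "\<not> ennreal b \<le> lambda_root p \<Omega>" using b b' by auto
  have "\<exists>K. compact K \<and> K \<subseteq> \<Omega> \<and> (\<forall>A. open A \<longrightarrow> A \<noteq> {} \<longrightarrow> K \<subseteq> A \<longrightarrow> \<not> ennreal b \<le> lambda_root p A)"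
  proof (cases "p = top")
    case True
    then obtain x r where r: "0 < r" "ball x r \<subseteq> \<Omega>" "1 / b < r"
      using nb b by (auto simp: le_lambda_root_top_iff not_le)
    then obtain s where s: "1 / b < s" "s < r" using dense by blast
    have "0 < 1 / b" using b by simp
    then have s0: "0 < s" using s by linarith
    have "\<not> ennreal b \<le> lambda_root p A" if "cball x s \<subseteq> A" for A
    proof -
      have "ball x s \<subseteq> A" using that ball_subset_cball by blast
      then show ?thesis using True b s s0 by (auto simp: le_lambda_root_top_iff not_le)
    qed
    moreover have "cball x s \<subseteq> \<Omega>" using r s by auto
    ultimately show ?thesis by (intro exI[of _ "cball x s"]) auto
  next
    case False
    let ?r = "enn2real p"
    obtain f where f: "f \<in> C1c \<Omega>" "\<not> ennreal (b powr ?r) * mass ?r f \<le> energy ?r f"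
      using nb le_lambda_root_iff[OF \<Omega> p False, of b] b by auto
    obtain K where K: "compact K" "K \<subseteq> \<Omega>" "\<And>x. x \<notin> K \<Longrightarrow> f x = 0"
      using C1c_support[OF f(1)] by metis
    have "\<not> ennreal b \<le> lambda_root p A" if A: "open A" "A \<noteq> {}" "K \<subseteq> A" for A
      using f(2) C1c_change_domain[OF f(1) K(1) A(3) K(3)] le_lambda_root_iff[OF A(1,2) p False, of b] b by auto
    with K show ?thesis by blast
  qed
  then obtain K where K: "compact K" "K \<subseteq> \<Omega>"
    "\<And>A. open A \<Longrightarrow> A \<noteq> {} \<Longrightarrow> K \<subseteq> A \<Longrightarrow> \<not> ennreal b \<le> lambda_root p A" by blast
  show ?thesis
    by (rule that[OF K(1,2)]) (use K(3) b b' in \<open>auto simp: not_le intro: less_trans\<close>)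
qed

lemma lambda_root_finite:
  fixes \<Omega> :: "(real ^ 'n::finite) set"
  assumes "open \<Omega>" "\<Omega> \<noteq> {}" "1 \<le> p"
  shows "lambda_root p \<Omega> < top"
proof (cases "p = top")
  case True
  obtain x e where e: "0 < e" "ball x e \<subseteq> \<Omega>"
    using assms by (meson openE ex_in_conv)
  then have "ennreal e \<le> inradius \<Omega>" unfolding inradius_def by (intro Sup_upper) blast
  moreover have "0 < ennreal e" using e by simp
  ultimately have "inradius \<Omega> \<noteq> 0" by auto
  then show ?thesis using True by (simp add: lambda_root_def less_top[symmetric])
qed (simp add: lambda_root_def)

lemma lambda_pos_iff:
  fixes \<Omega> :: "(real ^ 'n::finite) set"
  assumes "open \<Omega>" "\<Omega> \<noteq> {}" "1 \<le> p"
  shows "lambda_pos p \<Omega> \<longleftrightarrow> 0 < lambda_root p \<Omega>"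
proof (cases "p = top")
  case True
  then show ?thesis by (simp add: lambda_pos_def lambda_root_def zero_less_iff_neq_zero less_top)
next
  case False
  then show ?thesis using enn2real_ge_1[OF assms(3) False] lambda_nonneg[OF assms(1,2), of "enn2real p"]
    by (auto simp: lambda_pos_def lambda_root_def)
qed

section \<open>Poincare inequalities on star-shaped sets\<close>

text \<open>The tangent of the power function at the weighted mean s = m / W, evaluated at the quotient of \<phi> and w
  and integrated against the weight.\<close>

lemma weighted_jensen:
  fixes \<phi> w :: "'a \<Rightarrow> real"
  assumes p: "1 \<le> p"
    and w: "integrable M w" "\<And>x. 0 \<le> w x" and \<phi>: "integrable M \<phi>" "\<And>x. 0 \<le> \<phi> x"
    and z: "\<And>x. w x = 0 \<Longrightarrow> \<phi> x = 0"
    and i: "integrable M (\<lambda>x. \<phi> x powr p * w x powr (1 - p))"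
    and W: "W = (\<integral>x. w x \<partial>M)" "0 < W"
  shows "(\<integral>x. \<phi> x \<partial>M) powr p \<le> W powr (p - 1) * (\<integral>x. \<phi> x powr p * w x powr (1 - p) \<partial>M)"
proof -
  define m where "m = (\<integral>x. \<phi> x \<partial>M)"
  have m0: "0 \<le> m" using \<phi> by (simp add: m_def)
  show ?thesis
  proof (cases "m = 0")
    case True
    then show ?thesis using p by (simp add: m_def[symmetric])
  next
    case False
    define s where "s = m / W"
    have s: "0 < s" using False m0 W by (simp add: s_def)
    have pw: "w x * s powr p + p * s powr (p - 1) * (\<phi> x - s * w x) \<le> \<phi> x powr p * w x powr (1 - p)" for x
    proof (cases "w x = 0")
      case True
      then show ?thesis using z p by simp
    next
      case False
      then have wx: "0 < w x" using w(2)[of x] by simp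
      have "w x * (s powr p + p * s powr (p - 1) * (\<phi> x / w x - s)) \<le> w x * (\<phi> x / w x) powr p"
        using wx \<phi>(2)[of x] p s by (intro mult_left_mono powr_tangent) auto
      also have "\<dots> = \<phi> x powr p * (w x powr 1 / w x powr p)"
        using wx \<phi>(2)[of x] by (simp add: powr_divide)
      also have "\<dots> = \<phi> x powr p * w x powr (1 - p)"
        by (simp only: powr_diff)
      also have "w x * (s powr p + p * s powr (p - 1) * (\<phi> x / w x - s))
          = w x * s powr p + p * s powr (p - 1) * (\<phi> x - s * w x)"
        using wx by (simp add: field_simps)
      finally show ?thesis .
    qed
    have "(\<integral>x. w x * s powr p + p * s powr (p - 1) * (\<phi> x - s * w x) \<partial>M)
        \<le> (\<integral>x. \<phi> x powr p * w x powr (1 - p) \<partial>M)"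
      using w \<phi> i pw by (intro integral_mono) auto
    also have "(\<integral>x. w x * s powr p + p * s powr (p - 1) * (\<phi> x - s * w x) \<partial>M)
        = W * s powr p + p * s powr (p - 1) * (m - s * W)"
      using w \<phi> by (simp add: W(1) m_def)
    also have "\<dots> = W * s powr p" using W by (simp add: s_def)
    finally have *: "W * s powr p \<le> (\<integral>x. \<phi> x powr p * w x powr (1 - p) \<partial>M)" .
    have "m powr p = W powr (p - 1) * (W * s powr p)"
    proof -
      have "W powr (p - 1) * W = W powr p"
        using W(2) powr_mult_base[of W "p - 1"] by (simp add: mult.commute)
      moreover have "W powr p * s powr p = m powr p"
        using W(2) s m0 by (simp add: powr_mult[symmetric] s_def)
      ultimately show ?thesis by (simp add: mult.assoc[symmetric])
    qed
    then show ?thesis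
      using * unfolding m_def[symmetric] by (simp add: mult_left_mono)
  qed
qed

lemma integral_powr_Icc:
  fixes b \<tau> :: real
  assumes \<tau>: "0 < \<tau>" "\<tau> < 1" and b: "b \<noteq> 1"
  shows "(\<integral>t. indicator {\<tau>..1} t *\<^sub>R t powr (- b) \<partial>lborel) = (1 - \<tau> powr (1 - b)) / (1 - b)"
    and "0 < (1 - \<tau> powr (1 - b)) / (1 - b)"
proof -
  have "(\<integral>t. indicator {\<tau>..1} t *\<^sub>R t powr (- b) \<partial>lborel) = 1 powr (1 - b) / (1 - b) - \<tau> powr (1 - b) / (1 - b)"
  proof (rule integral_FTC_atLeastAtMost)
    show "\<tau> \<le> 1" using \<tau> by simp
    fix t assume t: "\<tau> \<le> t" "t \<le> 1"
    have "((\<lambda>t. t powr (1 - b) / (1 - b)) has_real_derivative t powr (- b)) (at t)"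
      using t \<tau> b by (auto intro!: derivative_eq_intros)
    then show "((\<lambda>t. t powr (1 - b) / (1 - b)) has_vector_derivative t powr (- b)) (at t within {\<tau>..1})"
      by (simp add: has_real_derivative_iff_has_vector_derivative has_vector_derivative_at_within)
  next
    show "continuous_on {\<tau>..1} (\<lambda>t. t powr (- b))"
      using \<tau> by (intro continuous_intros) auto
  qed
  then show "(\<integral>t. indicator {\<tau>..1} t *\<^sub>R t powr (- b) \<partial>lborel) = (1 - \<tau> powr (1 - b)) / (1 - b)"
    by (simp add: diff_divide_distrib)
  show "0 < (1 - \<tau> powr (1 - b)) / (1 - b)"
  proof (cases "b < 1")
    case True
    then have "\<tau> powr (1 - b) < 1 powr (1 - b)" using \<tau> by (intro powr_less_mono2) auto
    with True show ?thesis by simp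
  next
    case False
    with b have b1: "1 < b" by simp
    then have "1 powr (1 - b) < \<tau> powr (1 - b)" using \<tau> by (intro powr_less_mono2_neg) auto
    with b1 show ?thesis by (simp add: divide_neg_neg)
  qed
qed

text \<open>A function vanishing near the centre c of a star-shaped set is controlled along the rays from c by
  its gradient. Jensen's inequality is applied on each ray with the weight t powr (- b), and the
  integrals over Q are compared by the substitution y = c + t (x - c), whose Jacobian is t to the power
  of the dimension d. Since d \<le> b p, what remains is again an integral of the weight, so that W appears
  with the power p. For b < 1 it stays bounded as \<tau> tends to 0.\<close>

lemma star_poincare:
  fixes f :: "real ^ 'n::finite \<Rightarrow> real" and Q :: "(real ^ 'n) set"
  assumes f: "\<And>x. (f has_derivative (\<lambda>h. g x \<bullet> h)) (at x)" and g: "continuous_on UNIV g"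
    and Q: "Q \<in> sets borel" "\<And>x t. x \<in> Q \<Longrightarrow> 0 \<le> t \<Longrightarrow> t \<le> 1 \<Longrightarrow> c + t *\<^sub>R (x - c) \<in> Q"
    and D: "\<And>x. x \<in> Q \<Longrightarrow> norm (x - c) \<le> D" "0 < D"
    and p: "1 \<le> p" and b: "real CARD('n) \<le> b * p" "b \<noteq> 1"
    and \<tau>: "0 < \<tau>" "\<tau> < 1" and z: "\<And>x. x \<in> Q \<Longrightarrow> f (c + \<tau> *\<^sub>R (x - c)) = 0"
  defines "W \<equiv> (1 - \<tau> powr (1 - b)) / (1 - b)"
  shows "(\<integral>\<^sup>+x. ennreal (\<bar>f x\<bar> powr p) * indicator Q x \<partial>lborel)
    \<le> ennreal ((D * W) powr p) * (\<integral>\<^sup>+x. ennreal (norm (g x) powr p) * indicator Q x \<partial>lborel)"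
proof -
  let ?d = "CARD('n)"
  let ?I = "{\<tau>..1::real}"
  define w where "w t = indicator ?I t *\<^sub>R t powr (- b)" for t :: real
  note W = integral_powr_Icc[OF \<tau> b(2), folded W_def]
  have W0: "0 < W" using W(2) .
  have Ww: "integral\<^sup>L lborel w = W" using W(1) by (simp add: w_def[abs_def])
  define \<phi> where "\<phi> x t = indicator ?I t *\<^sub>R norm (g (c + t *\<^sub>R (x - c)))" for x and t :: real
  define \<psi> where "\<psi> x t = indicator ?I t *\<^sub>R (norm (g (c + t *\<^sub>R (x - c))) powr p * t powr (b * (p - 1)))" for x and t :: real
  have g': "continuous_on A (\<lambda>t. g (c + t *\<^sub>R (x - c)))" for A :: "real set" and x
    by (intro continuous_on_compose2[OF g] continuous_intros) auto
  have iw: "integrable lborel w"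
    unfolding w_def using \<tau> by (intro borel_integrable_compact continuous_intros) auto
  have i\<phi>: "integrable lborel (\<phi> x)" for x
    unfolding \<phi>_def by (intro borel_integrable_compact continuous_intros g') auto
  have i\<psi>: "integrable lborel (\<psi> x)" for x
    unfolding \<psi>_def using \<tau> p by (intro borel_integrable_compact continuous_intros continuous_on_powr' g') auto
  have \<psi>: "\<phi> x t powr p * w t powr (1 - p) = \<psi> x t" for x t
  proof (cases "t \<in> ?I")
    case True
    have "- (b * (1 - p)) = b * (p - 1)" by (simp add: algebra_simps)
    then show ?thesis using True \<tau> by (simp add: \<phi>_def w_def \<psi>_def powr_powr)
  qed (use p in \<open>simp add: \<phi>_def w_def \<psi>_def\<close>)
  have ray: "\<bar>f x\<bar> powr p \<le> D powr p * (W powr (p - 1) * (\<integral>t. \<psi> x t \<partial>lborel))" if x: "x \<in> Q" for x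
  proof -
    let ?\<gamma> = "\<lambda>t. c + t *\<^sub>R (x - c)"
    have "(\<integral>t. indicator ?I t *\<^sub>R (g (?\<gamma> t) \<bullet> (x - c)) \<partial>lborel) = f (?\<gamma> 1) - f (?\<gamma> \<tau>)"
    proof (rule integral_FTC_atLeastAtMost)
      show "\<tau> \<le> 1" using \<tau> by simp
      show "continuous_on ?I (\<lambda>t. g (?\<gamma> t) \<bullet> (x - c))" by (intro continuous_intros g')
      fix t
      have "(?\<gamma> has_derivative (\<lambda>s. s *\<^sub>R (x - c))) (at t)"
        by (rule has_derivative_eq_rhs, (rule derivative_intros)+) auto
      from has_derivative_compose[OF this f]
      have "((\<lambda>t. f (?\<gamma> t)) has_derivative (\<lambda>s. s *\<^sub>R (g (?\<gamma> t) \<bullet> (x - c)))) (at t)" by simp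
      then show "((\<lambda>t. f (?\<gamma> t)) has_vector_derivative (g (?\<gamma> t) \<bullet> (x - c))) (at t within ?I)"
        by (simp add: has_vector_derivative_def has_derivative_at_withinI)
    qed
    also have "\<dots> = f x" using z[OF x] by simp
    finally have fx: "f x = (\<integral>t. indicator ?I t *\<^sub>R (g (?\<gamma> t) \<bullet> (x - c)) \<partial>lborel)" by simp
    have "\<bar>f x\<bar> \<le> (\<integral>t. D * \<phi> x t \<partial>lborel)"
      unfolding fx real_norm_def[symmetric]
    proof (rule order_trans[OF integral_norm_bound integral_mono])
      show "integrable lborel (\<lambda>t. norm (indicator ?I t *\<^sub>R (g (?\<gamma> t) \<bullet> (x - c))))"
        by (intro integrable_norm borel_integrable_compact continuous_intros g') auto
      show "integrable lborel (\<lambda>t. D * \<phi> x t)" using i\<phi> by simp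
      fix t
      have "norm (g (?\<gamma> t) \<bullet> (x - c)) \<le> norm (g (?\<gamma> t)) * norm (x - c)"
        using Cauchy_Schwarz_ineq2 by simp
      also have "\<dots> \<le> norm (g (?\<gamma> t)) * D" using D(1)[OF x] by (intro mult_left_mono) auto
      finally show "norm (indicator ?I t *\<^sub>R (g (?\<gamma> t) \<bullet> (x - c))) \<le> D * \<phi> x t"
        by (simp add: \<phi>_def indicator_def mult.commute)
    qed
    then have "\<bar>f x\<bar> powr p \<le> (D * (\<integral>t. \<phi> x t \<partial>lborel)) powr p"
      using p by (intro powr_mono2) auto
    also have "\<dots> = D powr p * (\<integral>t. \<phi> x t \<partial>lborel) powr p"
      using D(2) by (simp add: powr_mult)
    also have "\<dots> \<le> D powr p * (W powr (p - 1) * (\<integral>t. \<phi> x t powr p * w t powr (1 - p) \<partial>lborel))"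
    proof (intro mult_left_mono weighted_jensen[OF p iw _ i\<phi>])
      show "W = (\<integral>t. w t \<partial>lborel)" using W(1) by (simp add: w_def)
      show "w t = 0 \<Longrightarrow> \<phi> x t = 0" for t
        using \<tau> by (auto simp: w_def \<phi>_def indicator_def split: if_splits)
      show "integrable lborel (\<lambda>t. \<phi> x t powr p * w t powr (1 - p))" unfolding \<psi> by (rule i\<psi>)
    qed (use W0 in \<open>auto simp: w_def \<phi>_def\<close>)
    finally show ?thesis by (simp add: \<psi>)
  qed
  define C where "C = D powr p * W powr (p - 1)"
  have C0: "0 \<le> C" by (simp add: C_def)
  define h where "h x = ennreal (norm (g x) powr p)" for x
  have gm [measurable]: "g \<in> borel_measurable borel" using g by (rule borel_measurable_continuous_onI)
  have hm [measurable]: "h \<in> borel_measurable borel" unfolding h_def by measurable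
  note Qm [measurable] = Q(1)
  let ?H = "\<integral>\<^sup>+x. h x * indicator Q x \<partial>lborel"
  let ?k = "\<lambda>x t. ennreal (t powr (b * (p - 1))) * indicator ?I t * (h (c + t *\<^sub>R (x - c)) * indicator Q x)"
  have "(\<integral>\<^sup>+x. ennreal (\<bar>f x\<bar> powr p) * indicator Q x \<partial>lborel)
      \<le> (\<integral>\<^sup>+x. ennreal C * (\<integral>\<^sup>+t. ?k x t \<partial>lborel) \<partial>lborel)"
  proof (rule nn_integral_mono)
    fix x :: "real ^ 'n"
    show "ennreal (\<bar>f x\<bar> powr p) * indicator Q x \<le> ennreal C * (\<integral>\<^sup>+t. ?k x t \<partial>lborel)"
    proof (cases "x \<in> Q")
      case True
      have "ennreal (\<bar>f x\<bar> powr p) \<le> ennreal (C * (\<integral>t. \<psi> x t \<partial>lborel))"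
        using ray[OF True] by (intro ennreal_leI) (simp add: C_def mult.assoc)
      also have "\<dots> = ennreal C * ennreal (\<integral>t. \<psi> x t \<partial>lborel)"
        using C0 by (intro ennreal_mult) (auto simp: \<psi>_def)
      also have "ennreal (\<integral>t. \<psi> x t \<partial>lborel) = (\<integral>\<^sup>+t. ennreal (\<psi> x t) \<partial>lborel)"
        by (rule nn_integral_eq_integral[OF i\<psi>, symmetric]) (simp add: \<psi>_def)
      also have "\<dots> = (\<integral>\<^sup>+t. ?k x t \<partial>lborel)"
        using True by (intro nn_integral_cong) (simp add: \<psi>_def h_def indicator_def ennreal_mult mult.commute)
      finally show ?thesis using True by simp
    qed simp
  qed
  also have "\<dots> = ennreal C * (\<integral>\<^sup>+x. (\<integral>\<^sup>+t. ?k x t \<partial>lborel) \<partial>lborel)"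
    by (intro nn_integral_cmult) measurable
  also have "(\<integral>\<^sup>+x. (\<integral>\<^sup>+t. ?k x t \<partial>lborel) \<partial>lborel) = (\<integral>\<^sup>+t. (\<integral>\<^sup>+x. ?k x t \<partial>lborel) \<partial>lborel)"
    by (rule lborel_pair.Fubini') measurable
  also have "\<dots> \<le> (\<integral>\<^sup>+t. ennreal (w t) * ?H \<partial>lborel)"
  proof (rule nn_integral_mono)
    fix t :: real
    show "(\<integral>\<^sup>+x. ?k x t \<partial>lborel) \<le> ennreal (w t) * ?H"
    proof (cases "t \<in> ?I")
      case True
      then have t: "0 < t" "t \<le> 1" using \<tau> by auto
      \<comment> \<open>The map taking y to c' + y / t inverts the contraction taking x to c + t (x - c).\<close>
      define c' where "c' = c - (1 / t) *\<^sub>R c"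
      have c': "(1 / (1 / t)) *\<^sub>R (x - c') = c + t *\<^sub>R (x - c)" for x
        using t by (simp add: c'_def algebra_simps)
      have "(\<integral>\<^sup>+x. ?k x t \<partial>lborel)
          = ennreal (t powr (b * (p - 1))) * (\<integral>\<^sup>+x. h (c + t *\<^sub>R (x - c)) * indicator Q x \<partial>lborel)"
        using True by (simp add: nn_integral_cmult)
      also have "\<dots> \<le> ennreal (t powr (b * (p - 1))) * (\<integral>\<^sup>+x. h (c + t *\<^sub>R (x - c)) * indicator Q (c + t *\<^sub>R (x - c)) \<partial>lborel)"
        using Q(2) t by (intro mult_left_mono nn_integral_mono) (auto simp: indicator_def)
      also have "\<dots> = ennreal (t powr (b * (p - 1))) * (ennreal ((1 / t) ^ ?d) * ?H)"
        using nn_integral_affine[of "\<lambda>x. h x * indicator Q x" "1 / t" c'] t unfolding c' by simp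
      also have "\<dots> = ennreal (t powr (b * (p - 1)) * (1 / t) ^ ?d) * ?H"
        using t by (simp add: ennreal_mult mult.assoc)
      also have "\<dots> \<le> ennreal (w t) * ?H"
      proof (intro mult_right_mono ennreal_leI)
        have "(1 / t) ^ ?d = t powr (- real ?d)"
          using t by (simp add: powr_minus powr_realpow divide_inverse power_inverse)
        then have "t powr (b * (p - 1)) * (1 / t) ^ ?d = t powr (b * (p - 1) - real ?d)"
          by (simp add: powr_add[symmetric])
        also have "\<dots> \<le> t powr (- b)"
          using t b(1) by (intro powr_mono') (auto simp: algebra_simps)
        finally show "t powr (b * (p - 1)) * (1 / t) ^ ?d \<le> w t" using True by (simp add: w_def)
      qed simp
      finally show ?thesis .
    qed simp
  qed
  also have "\<dots> = (\<integral>\<^sup>+t. ennreal (w t) \<partial>lborel) * ?H"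
    using borel_measurable_integrable[OF iw] by (intro nn_integral_multc) auto
  also have "(\<integral>\<^sup>+t. ennreal (w t) \<partial>lborel) = ennreal W"
    by (subst nn_integral_eq_integral[OF iw]) (auto simp: Ww, simp add: w_def)
  also have "ennreal C * (ennreal W * ?H) = ennreal ((D * W) powr p) * ?H"
  proof -
    have "W powr (p - 1) * W = W powr p"
      using W0 powr_mult_base[of W "p - 1"] by (simp add: mult.commute)
    then have "C * W = (D * W) powr p" using D(2) W0 by (simp add: C_def powr_mult mult.assoc)
    moreover have "ennreal C * (ennreal W * ?H) = ennreal (C * W) * ?H"
      using C0 W0 by (simp add: ennreal_mult mult.assoc)
    ultimately show ?thesis by simp
  qed
  finally show ?thesis by (simp add: h_def mult_left_mono)
qed

lemma mass_eq_on_support: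
  assumes "\<And>x. x \<notin> Q \<Longrightarrow> f x = 0"
  shows "mass p f = (\<integral>\<^sup>+x. ennreal (\<bar>f x\<bar> powr p) * indicator Q x \<partial>lborel)"
  unfolding mass_def using assms by (intro nn_integral_cong) (auto simp: indicator_def)

lemma energy_ge_on:
  "(\<integral>\<^sup>+x. ennreal (norm (grad f x) powr p) * indicator Q x \<partial>lborel) \<le> energy p f"
  unfolding energy_def by (intro nn_integral_mono) (auto simp: indicator_def)

lemma lambda_root_ge_of_inequality:
  fixes \<Omega> :: "(real ^ 'n::finite) set"
  assumes \<Omega>: "open \<Omega>" "\<Omega> \<noteq> {}" and p: "1 \<le> p" "p \<noteq> top" and C: "0 < C"
    and H: "\<And>f. f \<in> C1c \<Omega> \<Longrightarrow> mass (enn2real p) f \<le> ennreal (C powr enn2real p) * energy (enn2real p) f"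
  shows "ennreal (1 / C) \<le> lambda_root p \<Omega>"
proof -
  let ?r = "enn2real p"
  have "ennreal ((1 / C) powr ?r) * mass ?r f \<le> energy ?r f" if f: "f \<in> C1c \<Omega>" for f
  proof -
    have "ennreal ((1 / C) powr ?r) * mass ?r f \<le> ennreal ((1 / C) powr ?r) * (ennreal (C powr ?r) * energy ?r f)"
      by (intro mult_left_mono H f) simp
    also have "\<dots> = ennreal ((1 / C) powr ?r * C powr ?r) * energy ?r f"
      by (simp add: ennreal_mult mult.assoc)
    also have "(1 / C) powr ?r * C powr ?r = 1" using C by (simp add: powr_mult[symmetric])
    finally show ?thesis by simp
  qed
  then show ?thesis using le_lambda_root_iff[OF \<Omega> p, of "1 / C"] C by simp
qed

text \<open>The Poincare inequality of bounded sets, from rays issuing from a point c outside the set: all test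
  functions vanish near c, at a scale given by the size of the set alone.\<close>

lemma lambda_root_bounded_pos:
  fixes \<Omega> :: "(real ^ 'n::finite) set"
  assumes \<Omega>: "open \<Omega>" "\<Omega> \<noteq> {}" and p: "1 \<le> p" and bd: "bounded \<Omega>"
  shows "0 < lambda_root p \<Omega>"
proof -
  obtain R where R: "0 < R" "\<Omega> \<subseteq> ball 0 R"
    using bounded_subset_ballD[OF bd] by metis
  show ?thesis
  proof (cases "p = top")
    case True
    have "r \<le> 1 / (1 / R)" if "0 < r" "ball x r \<subseteq> \<Omega>" for x r
    proof -
      have "ball x r \<subseteq> ball 0 R" using that R by blast
      then have "norm x + r \<le> R" using that(1) by (simp add: ball_subset_ball_iff)
      moreover have "1 / (1 / R) = R" by simp
      ultimately show ?thesis using norm_ge_zero[of x] by linarith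
    qed
    then have "ennreal (1 / R) \<le> lambda_root p \<Omega>"
      using le_lambda_root_top_iff[of "1 / R" \<Omega>] R True by auto
    from less_le_trans[OF _ this, of 0] R show ?thesis by simp
  next
    case False
    let ?r = "enn2real p"
    have r: "1 \<le> ?r" using enn2real_ge_1[OF p False] by simp
    define b where "b = real CARD('n) + 1"
    \<comment> \<open>The point c has distance at least R from \<Omega>, and every x in the ball of radius 3 R has distance at most 5 R from c; hence the factor 1/6.\<close>
    define c where "c = (2 * R) *\<^sub>R (axis undefined 1 :: real ^ 'n)"
    have nc: "norm c = 2 * R" using R by (simp add: c_def)
    let ?Q = "ball (0 :: real ^ 'n) (3 * R)"
    define C where "C = (5 * R) * ((1 - (1/6) powr (1 - b)) / (1 - b))"
    have b: "real CARD('n) \<le> b * ?r" "b \<noteq> 1"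
    proof -
      have "b * 1 \<le> b * ?r" using r by (intro mult_left_mono) (auto simp: b_def)
      then show "real CARD('n) \<le> b * ?r" by (rule order_trans[rotated]) (simp add: b_def)
    qed (simp add: b_def)
    have C: "0 < C" unfolding C_def using integral_powr_Icc(2)[of "1/6" b] b R by (intro mult_pos_pos) auto
    have "ennreal (1 / C) \<le> lambda_root p \<Omega>"
    proof (rule lambda_root_ge_of_inequality[OF \<Omega> p False C])
      fix f assume f: "f \<in> C1c \<Omega>"
      obtain K where K: "K \<subseteq> \<Omega>" "\<And>x. x \<notin> K \<Longrightarrow> f x = 0" using C1c_support[OF f] by metis
      have z: "f x = 0" if "R \<le> norm x" for x
        by (rule K(2)) (use that K(1) R in auto)
      have "mass ?r f = (\<integral>\<^sup>+x. ennreal (\<bar>f x\<bar> powr ?r) * indicator ?Q x \<partial>lborel)"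
        using R by (intro mass_eq_on_support z) auto
      also have "\<dots> \<le> ennreal (C powr ?r) * (\<integral>\<^sup>+x. ennreal (norm (grad f x) powr ?r) * indicator ?Q x \<partial>lborel)"
        unfolding C_def
      proof (rule star_poincare[OF C1c_derivative[OF f] C1c_continuous_grad[OF f]])
        fix x assume x: "x \<in> ?Q"
        have cQ: "c \<in> ?Q" using nc R by simp
        show "c + t *\<^sub>R (x - c) \<in> ?Q" if "0 \<le> t" "t \<le> 1" for t
        proof -
          have "(1 - t) *\<^sub>R c + t *\<^sub>R x \<in> ?Q"
            using convexD_alt[OF convex_ball cQ x that] .
          then show ?thesis by (simp add: algebra_simps)
        qed
        have nx: "norm (x - c) \<le> 5 * R" using norm_triangle_ineq4[of x c] nc x by simp
        then show "norm (x - c) \<le> 5 * R" .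
        have "norm c \<le> norm (c + (1/6) *\<^sub>R (x - c)) + norm ((1/6) *\<^sub>R (x - c))"
          by (metis add_diff_cancel_right' norm_triangle_ineq4)
        then show "f (c + (1/6) *\<^sub>R (x - c)) = 0" using nx nc R by (intro z) simp
      qed (use R r b in auto)
      also have "\<dots> \<le> ennreal (C powr ?r) * energy ?r f" by (intro mult_left_mono energy_ge_on) simp
      finally show "mass ?r f \<le> ennreal (C powr ?r) * energy ?r f" .
    qed
    from less_le_trans[OF _ this, of 0] C show ?thesis by simp
  qed
qed

text \<open>The half-open unit cubes with integer corners.\<close>

definition cell :: "('n::finite \<Rightarrow> int) \<Rightarrow> (real ^ 'n) set" where
  "cell z = {x. \<forall>i. \<lfloor>x $ i\<rfloor> = z i}"

lemma cell_measurable [measurable]: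
  fixes z :: "'n::finite \<Rightarrow> int"
  shows "cell z \<in> sets borel"
proof -
  have "cell z = (\<Inter>i. {x. \<lfloor>x $ i\<rfloor> = z i})" by (auto simp: cell_def)
  moreover have "{x :: real ^ 'n. \<lfloor>x $ i\<rfloor> = z i} \<in> sets borel" for i
  proof -
    have "{x :: real ^ 'n. \<lfloor>x $ i\<rfloor> = z i} = {x. real_of_int (z i) \<le> x $ i} \<inter> {x. x $ i < real_of_int (z i) + 1}"
      by (auto simp: floor_eq_iff)
    moreover have "closed {x :: real ^ 'n. real_of_int (z i) \<le> x $ i}"
      by (intro closed_Collect_le continuous_intros)
    moreover have "open {x :: real ^ 'n. x $ i < real_of_int (z i) + 1}"
      by (intro open_Collect_less continuous_intros)
    ultimately show ?thesis by auto
  qed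
  ultimately show ?thesis by (simp add: sets.finite_INT)
qed

lemma cell_star:
  assumes "x \<in> cell z" "c \<in> cell z" "0 \<le> t" "t \<le> 1"
  shows "c + t *\<^sub>R (x - c) \<in> cell z"
proof -
  have "real_of_int (z i) \<le> c $ i + t * (x $ i - c $ i) \<and> c $ i + t * (x $ i - c $ i) < real_of_int (z i) + 1" for i
  proof -
    have xi: "real_of_int (z i) \<le> x $ i" "x $ i < real_of_int (z i) + 1"
      and ci: "real_of_int (z i) \<le> c $ i" "c $ i < real_of_int (z i) + 1"
      using assms(1,2) by (auto simp: cell_def floor_eq_iff)
    have e: "c $ i + t * (x $ i - c $ i) = (1 - t) * (c $ i) + t * (x $ i)" by (simp add: algebra_simps)
    have "(1 - t) * real_of_int (z i) + t * real_of_int (z i) \<le> (1 - t) * (c $ i) + t * (x $ i)"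
      using assms xi ci by (intro add_mono mult_left_mono) auto
    moreover have "(1 - t) * (c $ i) + t * (x $ i) < real_of_int (z i) + 1"
      using assms xi ci by (intro convex_bound_lt) auto
    ultimately show ?thesis unfolding e by (simp add: algebra_simps)
  qed
  then show ?thesis by (simp add: cell_def floor_eq_iff)
qed

lemma cell_diameter:
  fixes x c :: "real ^ 'n::finite"
  assumes "x \<in> cell z" "c \<in> cell z"
  shows "norm (x - c) \<le> real CARD('n)"
proof -
  have "\<bar>x $ i - c $ i\<bar> \<le> 1" for i
    using assms floor_correct[of "x $ i"] floor_correct[of "c $ i"] by (auto simp: cell_def abs_if)
  then have "(\<Sum>i\<in>UNIV. \<bar>(x - c) $ i\<bar>) \<le> (\<Sum>i\<in>(UNIV::'n set). 1)" by (intro sum_mono) simp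
  then show ?thesis using norm_le_l1_cart[of "x - c"] by simp
qed

text \<open>The inequality on the whole space is the sum of the inequalities on the cells. Their constants enter
  only through a common bound W, so that the scales \<tau> of vanishing may tend to 0 if b < 1.\<close>

lemma cellwise_poincare:
  fixes f :: "real ^ 'n::finite \<Rightarrow> real"
  assumes f: "f \<in> C1c \<Omega>" and p: "1 \<le> p" and b: "real CARD('n) \<le> b * p" "b \<noteq> 1"
    and H: "\<And>z. \<exists>c\<in>cell z. \<exists>\<tau>. 0 < \<tau> \<and> \<tau> < 1 \<and> (\<forall>x\<in>cell z. f (c + \<tau> *\<^sub>R (x - c)) = 0)
      \<and> (1 - \<tau> powr (1 - b)) / (1 - b) \<le> W"
  shows "mass p f \<le> ennreal ((real CARD('n) * W) powr p) * energy p f"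
proof -
  let ?D = "real CARD('n)"
  let ?C = "ennreal ((?D * W) powr p)"
  let ?m = "\<lambda>x. ennreal (\<bar>f x\<bar> powr p)" and ?e = "\<lambda>x. ennreal (norm (grad f x) powr p)"
  note fm [measurable] = C1c_measurable[OF f]
  have disj: "disjoint_family_on cell (UNIV :: ('n \<Rightarrow> int) set)"
    by (auto simp: disjoint_family_on_def cell_def fun_eq_iff)
  have cm: "cell z \<in> sets lborel" "?m \<in> borel_measurable lborel" "?e \<in> borel_measurable lborel" for z :: "'n \<Rightarrow> int"
    using cell_measurable[of z] by simp_all
  have cover: "x \<in> (\<Union>z. cell z)" for x :: "real ^ 'n"
    by (auto simp: cell_def intro: exI[of _ "\<lambda>i. \<lfloor>x $ i\<rfloor>"])
  have c: "(\<integral>\<^sup>+x. ?m x * indicator (cell z) x \<partial>lborel) \<le> ?C * (\<integral>\<^sup>+x. ?e x * indicator (cell z) x \<partial>lborel)" for z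
  proof -
    obtain c \<tau> where c: "c \<in> cell z" and \<tau>: "0 < \<tau>" "\<tau> < 1" and z: "\<And>x. x \<in> cell z \<Longrightarrow> f (c + \<tau> *\<^sub>R (x - c)) = 0"
      and W: "(1 - \<tau> powr (1 - b)) / (1 - b) \<le> W" using H[of z] by blast
    define w where "w = (1 - \<tau> powr (1 - b)) / (1 - b)"
    have W0: "0 < w" "w \<le> W" using integral_powr_Icc(2)[OF \<tau> b(2)] W by (auto simp: w_def)
    have "(\<integral>\<^sup>+x. ?m x * indicator (cell z) x \<partial>lborel)
        \<le> ennreal ((?D * w) powr p) * (\<integral>\<^sup>+x. ?e x * indicator (cell z) x \<partial>lborel)"
      unfolding w_def using cell_star[OF _ c] cell_diameter[OF _ c] z
      by (intro star_poincare[OF C1c_derivative[OF f] C1c_continuous_grad[OF f]] p b \<tau>) auto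
    also have "\<dots> \<le> ?C * (\<integral>\<^sup>+x. ?e x * indicator (cell z) x \<partial>lborel)"
      using W0 p by (intro mult_right_mono ennreal_leI powr_mono2 mult_left_mono) auto
    finally show ?thesis .
  qed
  have "mass p f = (\<integral>\<^sup>+z. (\<integral>\<^sup>+x. ?m x * indicator (cell z) x \<partial>lborel) \<partial>count_space UNIV)"
    unfolding mass_def using disj cover by (intro nn_integral_disjoint_cover cm) auto
  also have "\<dots> \<le> (\<integral>\<^sup>+z. ?C * (\<integral>\<^sup>+x. ?e x * indicator (cell z) x \<partial>lborel) \<partial>count_space UNIV)"
    by (intro nn_integral_mono c)
  also have "\<dots> = ?C * (\<integral>\<^sup>+z. (\<integral>\<^sup>+x. ?e x * indicator (cell z) x \<partial>lborel) \<partial>count_space UNIV)"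
    by (intro nn_integral_cmult) simp
  also have "(\<integral>\<^sup>+z. (\<integral>\<^sup>+x. ?e x * indicator (cell z) x \<partial>lborel) \<partial>count_space UNIV) = energy p f"
    unfolding energy_def using disj cover by (intro nn_integral_disjoint_cover[symmetric] cm) auto
  finally show ?thesis .
qed

section \<open>Domains with polynomial boundary\<close>

lemma partial_deriv_eqI:
  assumes "(f has_derivative f') (at x)"
  shows "partial_deriv i f x = f' (axis i 1)"
  using frechet_derivative_at[OF assms] by (simp add: partial_deriv_def)

text \<open>Polynomials are closed under partial derivatives, which makes them smooth in the iterated sense
  required of defining functions.\<close>

lemma real_polynomial_function_partial_deriv:
  fixes f :: "real ^ 'n::finite \<Rightarrow> real"
  assumes "real_polynomial_function f"
  shows "(\<forall>x. f differentiable (at x)) \<and> real_polynomial_function (partial_deriv i f)"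
  using assms
proof (induction f rule: real_polynomial_function.induct)
  case (linear f)
  have d: "(f has_derivative f) (at x)" for x
    using linear by (rule bounded_linear_imp_has_derivative)
  then have "partial_deriv i f = (\<lambda>x. f (axis i 1))" by (auto simp: partial_deriv_eqI)
  then show ?case using d by (auto simp: differentiable_def)
next
  case (const c)
  have d: "((\<lambda>x :: real ^ 'n. c) has_derivative (\<lambda>x. 0)) (at x)" for x by simp
  then have "partial_deriv i (\<lambda>x :: real ^ 'n. c) = (\<lambda>x. 0)" by (auto simp: partial_deriv_eqI[OF d])
  then show ?case by auto
next
  case (add f g)
  have d: "((\<lambda>x. f x + g x) has_derivative (\<lambda>h. grad f x \<bullet> h + grad g x \<bullet> h)) (at x)" for x
    using add.IH differentiable_has_grad by (intro has_derivative_add) auto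
  have "partial_deriv i (\<lambda>x. f x + g x) = (\<lambda>x. partial_deriv i f x + partial_deriv i g x)"
    by (auto simp: partial_deriv_eqI[OF d] inner_axis grad_def)
  then show ?case using d add.IH by (auto simp: differentiable_def)
next
  case (mult f g)
  have d: "((\<lambda>x. f x * g x) has_derivative (\<lambda>h. f x * (grad g x \<bullet> h) + (grad f x \<bullet> h) * g x)) (at x)" for x
    using mult.IH differentiable_has_grad by (intro has_derivative_mult) auto
  have "partial_deriv i (\<lambda>x. f x * g x) = (\<lambda>x. f x * partial_deriv i g x + partial_deriv i f x * g x)"
    by (auto simp: partial_deriv_eqI[OF d] inner_axis grad_def)
  then show ?case using d mult.IH mult.hyps by (auto simp: differentiable_def)
qed

lemma real_polynomial_function_smooth_on:
  fixes f :: "real ^ 'n::finite \<Rightarrow> real"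
  assumes "real_polynomial_function f"
  shows "smooth_on U f"
proof -
  have "Ck_on k U f" for k
    using assms
  proof (induction k arbitrary: f)
    case 0
    then show ?case
      using real_polynomial_function_partial_deriv[OF 0]
      by (auto intro!: continuous_at_imp_continuous_on differentiable_imp_continuous_within)
  next
    case (Suc k)
    then show ?case using real_polynomial_function_partial_deriv[OF Suc.prems] by auto
  qed
  then show ?thesis by (simp add: smooth_on_def)
qed

lemma real_polynomial_function_continuous:
  fixes f :: "real ^ 'n::finite \<Rightarrow> real"
  assumes "real_polynomial_function f"
  shows "continuous_on U f" "continuous_on U (grad f)"
proof -
  have 1: "continuous_on U g" if "real_polynomial_function g" for g :: "real ^ 'n \<Rightarrow> real"
    using real_polynomial_function_smooth_on[OF that, of U] by (auto simp: smooth_on_def dest: spec[of _ 0])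
  then show "continuous_on U f" using assms by blast
  have "continuous_on U (partial_deriv i f)" for i
    using 1 real_polynomial_function_partial_deriv[OF assms] by blast
  then show "continuous_on U (grad f)" unfolding grad_def by (intro continuous_on_vec_lambda) auto
qed

lemma real_polynomial_function_has_grad:
  fixes f :: "real ^ 'n::finite \<Rightarrow> real"
  assumes "real_polynomial_function f"
  shows "(f has_derivative (\<lambda>h. grad f x \<bullet> h)) (at x)"
  using real_polynomial_function_partial_deriv[OF assms] by (intro differentiable_has_grad) auto

text \<open>The compact set C keeps the boundary of A inside V, where it is cut out by the polynomial alone. This form
  of a smooth boundary is invariant under affine maps.\<close>

definition poly_domain :: "(real ^ 'n::finite) set \<Rightarrow> bool" where
  "poly_domain A \<longleftrightarrow> A \<noteq> {} \<and> (\<exists>\<Phi> V C. real_polynomial_function \<Phi> \<and> open V \<and> compact C \<and> A \<subseteq> C \<and> C \<subseteq> V \<and>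
     A = {x \<in> V. \<Phi> x < 0} \<and> (\<forall>x. \<Phi> x = 0 \<longrightarrow> grad \<Phi> x \<noteq> 0))"

lemma poly_domain_open_bounded:
  assumes "poly_domain A"
  shows "open A" "bounded A" "A \<noteq> {}"
proof -
  obtain \<Phi> V C where P: "real_polynomial_function \<Phi>" "open V" "compact C" "A \<subseteq> C" "A = {x \<in> V. \<Phi> x < 0}"
    using assms unfolding poly_domain_def by blast
  have "open {x. \<Phi> x < 0}"
    using real_polynomial_function_continuous(1)[OF P(1)] by (intro open_Collect_less) auto
  moreover have "A = V \<inter> {x. \<Phi> x < 0}" using P(5) by auto
  ultimately show "open A" using P(2) by auto
  show "bounded A" using P(3,4) bounded_subset compact_imp_bounded by blast
  show "A \<noteq> {}" using assms by (simp add: poly_domain_def)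
qed

lemma poly_domain_affine:
  fixes A :: "(real ^ 'n::finite) set"
  assumes "poly_domain A" and s: "0 < s"
  shows "poly_domain ((\<lambda>x. c + s *\<^sub>R x) ` A)"
proof -
  let ?T = "\<lambda>x :: real ^ 'n. c + s *\<^sub>R x"
  let ?S = "\<lambda>x :: real ^ 'n. (1 / s) *\<^sub>R (x - c)"
  obtain \<Phi> V C where P: "real_polynomial_function \<Phi>" "open V" "compact C" "A \<subseteq> C" "C \<subseteq> V"
    "A = {x \<in> V. \<Phi> x < 0}" "\<And>x. \<Phi> x = 0 \<Longrightarrow> grad \<Phi> x \<noteq> 0"
    using assms unfolding poly_domain_def by blast
  have ST: "?S (?T x) = x" "?T (?S x) = x" for x using s by simp_all
  have mem: "y \<in> ?T ` X \<longleftrightarrow> ?S y \<in> X" for X y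
  proof
    assume "y \<in> ?T ` X"
    then obtain x where x: "x \<in> X" "y = ?T x" by (rule imageE)
    show "?S y \<in> X" unfolding x(2) ST(1) by (rule x(1))
  next
    assume "?S y \<in> X"
    then have "?T (?S y) \<in> ?T ` X" by (rule imageI)
    then show "y \<in> ?T ` X" unfolding ST(2) .
  qed
  let ?\<Phi> = "\<lambda>x. \<Phi> (?S x)"
  have "polynomial_function ?S"
    by (intro polynomial_function_cmul polynomial_function_diff polynomial_function_id polynomial_function_const)
  from real_polynomial_function_compose[OF this P(1)]
  have rp: "real_polynomial_function ?\<Phi>" by (simp add: o_def)
  have "grad ?\<Phi> x = (1 / s) *\<^sub>R grad \<Phi> (?S x)" for x
  proof (rule grad_eqI)
    have "(?S has_derivative (\<lambda>h. (1 / s) *\<^sub>R h)) (at x)"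
      by (auto intro!: derivative_eq_intros)
    from has_derivative_compose[OF this real_polynomial_function_has_grad[OF P(1)]]
    show "(?\<Phi> has_derivative (\<lambda>h. ((1 / s) *\<^sub>R grad \<Phi> (?S x)) \<bullet> h)) (at x)" by simp
  qed
  then have nz: "grad ?\<Phi> x \<noteq> 0" if "?\<Phi> x = 0" for x using P(7)[OF that] s by simp
  have cC: "compact (?T ` C)" using P(3) by (intro compact_continuous_image continuous_intros) auto
  have oV: "open (?T ` V)" using affine_image_open[OF P(2), of s c] s by simp
  have eA: "?T ` A = {x \<in> ?T ` V. ?\<Phi> x < 0}"
    unfolding set_eq_iff mem_Collect_eq mem using P(6) by blast
  have sub: "?T ` A \<subseteq> ?T ` C" "?T ` C \<subseteq> ?T ` V" using P(4,5) by blast+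
  have ne: "?T ` A \<noteq> {}" using poly_domain_open_bounded(3)[OF assms(1)] by simp
  show ?thesis
    unfolding poly_domain_def
    by (intro conjI exI[of _ ?\<Phi>] exI[of _ "?T ` V"] exI[of _ "?T ` C"] allI impI ne rp cC oV eA sub nz)
qed

text \<open>A polynomial close to a separating function has a sublevel set between K and \<Omega>. Subtracting an affine
  function a x + c makes 0 a regular value unless (a, c) is the tangent data of the polynomial at some
  point; these data form the image of a space of smaller dimension, hence a null set.\<close>

lemma poly_domain_between:
  fixes \<Omega> :: "(real ^ 'n::finite) set"
  assumes K: "compact K" "K \<subseteq> \<Omega>" and \<Omega>: "open \<Omega>" "\<Omega> \<noteq> {}"
  obtains A where "poly_domain A" "K \<subseteq> A" "A \<subseteq> \<Omega>"
proof -
  obtain x0 where x0: "x0 \<in> \<Omega>" using \<Omega> by blast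
  \<comment> \<open>The point x0 keeps the domain nonempty in case K is empty.\<close>
  define K' where "K' = insert x0 K"
  have K': "compact K'" "K' \<subseteq> \<Omega>" "x0 \<in> K'" "K \<subseteq> K'" using K x0 by (auto simp: K'_def compact_insert)
  obtain R where R: "0 < R" "K' \<subseteq> ball 0 R"
    using bounded_subset_ballD[OF compact_imp_bounded[OF K'(1)]] by metis
  define \<Omega>' where "\<Omega>' = \<Omega> \<inter> ball 0 R"
  have \<Omega>': "open \<Omega>'" "K' \<subseteq> \<Omega>'" using \<Omega> K' R by (auto simp: \<Omega>'_def)
  have cl: "closed K'" "closed (- \<Omega>')" "K' \<inter> - \<Omega>' = {}"
    using K'(1) \<Omega>' by (auto simp: compact_imp_closed)
  obtain g :: "real ^ 'n \<Rightarrow> real" where g: "continuous_on UNIV g"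
    "\<And>x. x \<in> K' \<Longrightarrow> g x = - 1" "\<And>x. x \<in> - \<Omega>' \<Longrightarrow> g x = 1"
    by (rule Urysohn[OF cl, of "- 1" 1]) blast
  obtain h where h: "real_polynomial_function h" "\<And>x. x \<in> cball 0 (R + 1) \<Longrightarrow> \<bar>g x - h x\<bar> < 1/4"
    by (rule Stone_Weierstrass_real_polynomial_function[of "cball 0 (R + 1)" g "1/4"])
       (use continuous_on_subset[OF g(1)] in auto)
  let ?T = "\<lambda>x. (grad h x, h x - grad h x \<bullet> x)"
  have gradh: "grad h = (\<lambda>x. \<Sum>i\<in>UNIV. partial_deriv i h x *\<^sub>R axis i 1)"
    by (auto simp: fun_eq_iff vec_eq_iff grad_def axis_def if_distrib sum.delta cong: if_cong)
  have dh: "h differentiable (at x)" "partial_deriv i h differentiable (at x)" for i x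
    using real_polynomial_function_partial_deriv[OF h(1), of i]
      real_polynomial_function_partial_deriv[of "partial_deriv i h" i] by auto
  have dgrad: "grad h differentiable (at x)" for x
    unfolding gradh using dh by (intro differentiable_sum differentiable_scaleR) auto
  have "?T differentiable (at x)" for x
    using dh dgrad by (intro differentiable_Pair differentiable_diff differentiable_inner) auto
  then have "?T differentiable_on UNIV" by (simp add: differentiable_on_def differentiable_at_withinI)
  then have negl: "negligible (range ?T)"
    by (intro negligible_differentiable_image_lowdim) auto
  \<comment> \<open>The affine perturbation must stay below 1/4 on the ball of radius R + 1.\<close>
  define \<delta> where "\<delta> = 1 / (4 * (R + 2))"
  have \<delta>: "0 < \<delta>" "\<delta> * (R + 2) = 1/4" using R by (auto simp: \<delta>_def)
  have "\<not> ball (0 :: (real ^ 'n) \<times> real) \<delta> \<subseteq> range ?T"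
    using negl \<delta>(1) negligible_subset open_not_negligible[of "ball (0 :: (real ^ 'n) \<times> real) \<delta>"] by auto
  then obtain a c where ac: "norm (a, c) < \<delta>" "(a, c) \<notin> range ?T" by force
  have na: "norm a < \<delta>" "\<bar>c\<bar> < \<delta>"
    using ac(1) norm_fst_le[of a c] norm_snd_le[of c a] by auto
  define \<Phi> where "\<Phi> x = h x - a \<bullet> x - c" for x
  have "real_polynomial_function (\<lambda>x. a \<bullet> x)"
    by (intro real_polynomial_function.intros(1) bounded_linear_inner_right)
  then have rp: "real_polynomial_function \<Phi>"
    unfolding \<Phi>_def using h(1) by (intro real_polynomial_function_diff real_polynomial_function.intros(2))
  have grad\<Phi>: "grad \<Phi> x = grad h x - a" for x
  proof (rule grad_eqI)
    show "(\<Phi> has_derivative (\<lambda>v. (grad h x - a) \<bullet> v)) (at x)"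
      unfolding \<Phi>_def
      by (rule has_derivative_eq_rhs, (rule derivative_intros real_polynomial_function_has_grad[OF h(1)])+)
         (simp add: inner_diff_left)
  qed
  have reg: "grad \<Phi> x \<noteq> 0" if "\<Phi> x = 0" for x
  proof
    assume "grad \<Phi> x = 0"
    then have "a = grad h x" "c = h x - grad h x \<bullet> x" using that by (auto simp: grad\<Phi> \<Phi>_def)
    then have "(a, c) = ?T x" by simp
    with ac(2) show False by blast
  qed
  have small: "\<bar>a \<bullet> x + c\<bar> \<le> 1/4" if "x \<in> cball 0 (R + 1)" for x
  proof -
    have "\<bar>a \<bullet> x\<bar> \<le> norm a * norm x" by (rule Cauchy_Schwarz_ineq2)
    also have "\<dots> \<le> \<delta> * (R + 1)" using na that by (intro mult_mono) auto
    finally have "\<bar>a \<bullet> x + c\<bar> \<le> \<delta> * (R + 1) + \<delta>" using na(2) by linarith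
    also have "\<dots> = \<delta> * (R + 2)" by (simp add: algebra_simps)
    finally show ?thesis using \<delta> by simp
  qed
  have \<Phi>K: "\<Phi> x < 0" if "x \<in> K'" for x
  proof -
    have x: "x \<in> cball 0 (R + 1)" using that R by (auto simp: subset_iff less_imp_le intro: less_le_trans)
    show ?thesis using small[OF x] h(2)[OF x] g(2)[OF that] unfolding \<Phi>_def by linarith
  qed
  have \<Phi>\<Omega>: "0 < \<Phi> x" if "x \<in> cball 0 (R + 1)" "x \<notin> \<Omega>'" for x
  proof -
    have "g x = 1" using g(3) that(2) by simp
    then show ?thesis using small[OF that(1)] h(2)[OF that(1)] unfolding \<Phi>_def by linarith
  qed
  define V where "V = ball (0 :: real ^ 'n) (R + 1)"
  define A where "A = {x \<in> V. \<Phi> x < 0}"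
  define C where "C = cball 0 (R + 1) \<inter> {x. \<Phi> x \<le> 0}"
  have "closed {x. \<Phi> x \<le> 0}"
    using real_polynomial_function_continuous(1)[OF rp] by (intro closed_Collect_le) auto
  then have "compact C" by (simp add: C_def compact_Int_closed)
  moreover have "C \<subseteq> V"
  proof
    fix x assume x: "x \<in> C"
    then have "x \<in> \<Omega>'" using \<Phi>\<Omega>[of x] by (force simp: C_def)
    then show "x \<in> V" by (auto simp: \<Omega>'_def V_def)
  qed
  moreover have "A \<subseteq> C" by (auto simp: A_def C_def V_def)
  moreover have K'A: "K' \<subseteq> A"
    using \<Phi>K R by (auto simp: A_def V_def subset_iff intro: less_trans)
  ultimately have "poly_domain A"
    unfolding poly_domain_def using rp reg K'(3) K'A
    by (intro conjI exI[of _ \<Phi>] exI[of _ V] exI[of _ C]) (auto simp: A_def V_def)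
  moreover have "A \<subseteq> \<Omega>"
  proof
    fix x assume x: "x \<in> A"
    then have "x \<in> \<Omega>'" using \<Phi>\<Omega>[of x] by (force simp: A_def V_def)
    then show "x \<in> \<Omega>" by (simp add: \<Omega>'_def)
  qed
  ultimately show ?thesis using that K'A K'(4) by blast
qed

text \<open>Translated far apart along an axis, domains with polynomial boundary have a smooth union: balls of
  radius 1 meet at most one of them.\<close>

lemma poly_domains_spread:
  fixes A :: "nat \<Rightarrow> (real ^ 'n::finite) set"
  assumes A: "\<And>n. poly_domain (A n)"
  obtains B c where "\<And>n. B n = (\<lambda>x. c n + 1 *\<^sub>R x) ` A n" "disjoint_family B" "smooth_boundary (\<Union>n. B n)"
proof -
  have "\<exists>R>0. A n \<subseteq> ball 0 R" for n
    using bounded_subset_ballD[OF poly_domain_open_bounded(2)[OF A[of n]], of 0] by metis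
  then obtain R where R: "\<And>n. 0 < R n" "\<And>n. A n \<subseteq> ball 0 (R n)" by metis
  define e where "e = (axis undefined 1 :: real ^ 'n)"
  have ne: "norm e = 1" by (simp add: e_def)
  \<comment> \<open>Consecutive enclosing balls are placed along the axis with gaps of length 2.\<close>
  define \<sigma> where "\<sigma> n = 2 * (\<Sum>i<n. R i + 1) + R n" for n
  define c where "c n = \<sigma> n *\<^sub>R e" for n
  define B where "B n = (\<lambda>x. c n + 1 *\<^sub>R x) ` A n" for n
  have BR: "norm (y - c n) < R n" if "y \<in> B n" for y n
    using that R(2)[of n] by (auto simp: B_def subset_iff)
  have \<sigma>: "R m + R n + 2 \<le> \<sigma> n - \<sigma> m" if "m < n" for m n
  proof -
    have "(\<Sum>i<n. R i + 1) = (\<Sum>i<m. R i + 1) + (\<Sum>i=m..<n. R i + 1)"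
      using that by (metis less_imp_le sum.atLeastLessThan_concat lessThan_atLeast0 le0)
    moreover have "R m + 1 \<le> (\<Sum>i=m..<n. R i + 1)"
      using that R(1) by (intro member_le_sum[of m "{m..<n}" "\<lambda>i. R i + 1"]) (auto simp: less_imp_le add_nonneg_nonneg)
    ultimately show ?thesis by (simp add: \<sigma>_def)
  qed
  have far': "2 \<le> dist y y'" if "y \<in> B m" "y' \<in> B n" "m < n" for y y' m n
  proof -
    have "c n - c m = (\<sigma> n - \<sigma> m) *\<^sub>R e" by (simp add: c_def scaleR_diff_left)
    then have "norm (c n - c m) = \<bar>\<sigma> n - \<sigma> m\<bar>" by (simp add: ne)
    then have 1: "R m + R n + 2 \<le> norm (c n - c m)" using \<sigma>[OF that(3)] by linarith
    have "c n - c m = (y - c m) + ((y' - y) - (y' - c n))" by simp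
    then have "norm (c n - c m) \<le> norm (y - c m) + (norm (y' - y) + norm (y' - c n))"
      by (smt (verit) norm_triangle_ineq norm_triangle_ineq4)
    then show ?thesis using 1 BR[OF that(1)] BR[OF that(2)] by (simp add: dist_norm norm_minus_commute)
  qed
  have far: "2 \<le> dist y y'" if "y \<in> B m" "y' \<in> B n" "m \<noteq> n" for y y' m n
    using far' that by (metis dist_commute nat_neq_iff)
  have disj: "disjoint_family B"
    using far by (fastforce simp: disjoint_family_on_def)
  have pB: "poly_domain (B n)" for n unfolding B_def by (rule poly_domain_affine[OF A]) simp
  have "smooth_boundary (\<Union>n. B n)"
    unfolding smooth_boundary_def
  proof
    fix x assume x: "x \<in> frontier (\<Union>n. B n)"
    have oB: "open (\<Union>n. B n)" using poly_domain_open_bounded(1)[OF pB] by auto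
    have xc: "x \<in> closure (\<Union>n. B n)" and xn: "x \<notin> (\<Union>n. B n)"
      using x oB by (auto simp: frontier_def interior_open)
    obtain n where n: "ball x 1 \<inter> B n \<noteq> {}"
    proof -
      obtain y where "y \<in> (\<Union>n. B n)" "dist y x < 1" using xc closure_approachable zero_less_one by blast
      then obtain m where "y \<in> ball x 1 \<inter> B m" by (auto simp: dist_commute)
      then show ?thesis using that by blast
    qed
    have only: "m = n" if "y \<in> B m" "dist x y < 1" for y m
    proof (rule ccontr)
      assume "m \<noteq> n"
      obtain z where z: "z \<in> B n" "dist x z < 1" using n by auto
      have "dist y z < 2" using dist_triangle[of y z x] z(2) that(2) by (simp add: dist_commute)
      then show False using far[OF that(1) z(1) \<open>m \<noteq> n\<close>] by simp
    qed
    have xcn: "x \<in> closure (B n)"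
      unfolding closure_approachable
    proof (intro allI impI)
      fix \<epsilon> :: real assume "0 < \<epsilon>"
      then have "0 < min \<epsilon> 1" by simp
      then obtain y where y: "y \<in> (\<Union>n. B n)" "dist y x < min \<epsilon> 1" using xc closure_approachable by blast
      then obtain m where "y \<in> B m" by blast
      with only[of y m] y have "y \<in> B n" by (simp add: dist_commute)
      with y show "\<exists>y\<in>B n. dist y x < \<epsilon>" by auto
    qed
    obtain \<Phi> V C where P: "real_polynomial_function \<Phi>" "open V" "compact C" "B n \<subseteq> C" "C \<subseteq> V"
      "B n = {x \<in> V. \<Phi> x < 0}" "\<And>x. \<Phi> x = 0 \<Longrightarrow> grad \<Phi> x \<noteq> 0"
      using pB[of n] unfolding poly_domain_def by blast
    have "closure (B n) \<subseteq> C" using P(3,4) by (simp add: closure_minimal compact_imp_closed)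
    then have xV: "x \<in> V" using xcn P(5) by auto
    have "\<Phi> x \<le> 0"
      using continuous_le_on_closure[OF real_polynomial_function_continuous(1)[OF P(1)] xcn, of 0] P(6) by force
    moreover have "\<not> \<Phi> x < 0" using xn xV P(6) by blast
    ultimately have gx: "grad \<Phi> x \<noteq> 0" using P(7) by simp
    define U where "U = ball x 1 \<inter> V \<inter> {y. grad \<Phi> y \<noteq> 0}"
    have "open {y. grad \<Phi> y \<noteq> 0}"
      using real_polynomial_function_continuous(2)[OF P(1), of UNIV] by (intro open_Collect_neq) auto
    then have "open U" unfolding U_def using P(2) by (intro open_Int) auto
    moreover have "x \<in> U" using xV gx by (simp add: U_def)
    moreover have "(\<Union>n. B n) \<inter> U = {y \<in> U. \<Phi> y < 0}"
    proof (intro equalityI subsetI)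
      fix y assume y: "y \<in> (\<Union>n. B n) \<inter> U"
      then obtain m where "y \<in> B m" by blast
      with only[of y m] y have "y \<in> B n" by (auto simp: U_def)
      then show "y \<in> {y \<in> U. \<Phi> y < 0}" using y unfolding P(6) by blast
    next
      fix y assume "y \<in> {y \<in> U. \<Phi> y < 0}"
      then have "y \<in> U" "y \<in> B n" unfolding P(6) by (auto simp: U_def)
      then show "y \<in> (\<Union>n. B n) \<inter> U" by blast
    qed
    moreover have "\<forall>y\<in>U. grad \<Phi> y \<noteq> 0" by (simp add: U_def)
    ultimately show "\<exists>U \<Phi>. open U \<and> x \<in> U \<and> smooth_on U \<Phi> \<and> (\<forall>y\<in>U. grad \<Phi> y \<noteq> 0) \<and> (\<Union>n. B n) \<inter> U = {y \<in> U. \<Phi> y < 0}"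
      using real_polynomial_function_smooth_on[OF P(1)] by blast
  qed
  then show ?thesis using that[OF B_def disj] by blast
qed

section \<open>Extremal domains\<close>

lemma ennreal_divide_less_iff:
  fixes x z a :: ennreal
  assumes "0 < z" "z < top"
  shows "x / z < a \<longleftrightarrow> x < a * z" "a < x / z \<longleftrightarrow> a * z < x"
proof -
  obtain r where r: "z = ennreal r" "0 < r" using assms by (cases z) auto
  have 1: "x / z < a \<longleftrightarrow> x < a * z" for x a
  proof (cases x)
    case (real s)
    show ?thesis
    proof (cases a)
      case (real t)
      then show ?thesis using r \<open>x = ennreal s\<close> \<open>0 \<le> s\<close>
        by (simp add: divide_ennreal ennreal_mult[symmetric] ennreal_less_iff pos_divide_less_eq)
    next
      case top
      then show ?thesis using r \<open>x = ennreal s\<close> \<open>0 \<le> s\<close>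
        by (simp add: divide_ennreal ennreal_top_mult)
    qed
  next
    case top
    then show ?thesis using r by (simp add: ennreal_top_divide)
  qed
  have 2: "a < x / z \<longleftrightarrow> a * z < x" for x a
  proof (cases x)
    case (real s)
    show ?thesis
    proof (cases a)
      case (real t)
      then show ?thesis using r \<open>x = ennreal s\<close> \<open>0 \<le> s\<close>
        by (simp add: divide_ennreal ennreal_mult[symmetric] ennreal_less_iff pos_less_divide_eq)
    next
      case top
      then show ?thesis using r \<open>x = ennreal s\<close> by (simp add: ennreal_top_mult)
    qed
  next
    case top
    show ?thesis
    proof (cases a)
      case (real t)
      then show ?thesis using r \<open>x = top\<close> by (simp add: ennreal_top_divide ennreal_mult[symmetric])
    next
      case top
      then show ?thesis using r \<open>x = top\<close> by (simp add: ennreal_top_divide ennreal_top_mult)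
    qed
  qed
  show "x / z < a \<longleftrightarrow> x < a * z" "a < x / z \<longleftrightarrow> a * z < x" by (fact 1 2)+
qed

text \<open>A smooth domain inside \<Omega> has larger frequencies, and either one of them can be kept close to that
  of \<Omega>. Keeping that of order p close brings the ratio below every number above the ratio of \<Omega>;
  keeping that of order q close brings it above every number below.\<close>

lemma poly_domain_Fratio_less:
  fixes \<Omega> :: "(real ^ 'n::finite) set"
  assumes pq: "1 \<le> q" "1 \<le> p" and \<Omega>: "open \<Omega>" "\<Omega> \<noteq> {}" "lambda_pos q \<Omega>" and a: "Fratio p q \<Omega> < a"
  obtains A :: "(real ^ 'n) set" where "poly_domain A" "Fratio p q A < a"
proof -
  have q\<Omega>: "0 < lambda_root q \<Omega>" "lambda_root q \<Omega> < top"
    using lambda_pos_iff[OF \<Omega>(1,2) pq(1)] \<Omega>(3) lambda_root_finite[OF \<Omega>(1,2) pq(1)] by auto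
  have "lambda_root p \<Omega> < a * lambda_root q \<Omega>"
    using a ennreal_divide_less_iff(1)[OF q\<Omega>] by (simp add: Fratio_def)
  then obtain K where K: "compact K" "K \<subseteq> \<Omega>"
    "\<And>A. open A \<Longrightarrow> A \<noteq> {} \<Longrightarrow> K \<subseteq> A \<Longrightarrow> lambda_root p A < a * lambda_root q \<Omega>"
    using lambda_root_inner_approx[OF \<Omega>(1,2) pq(2)] by metis
  obtain A where A: "poly_domain A" "K \<subseteq> A" "A \<subseteq> \<Omega>"
    using poly_domain_between[OF K(1,2) \<Omega>(1,2)] by metis
  note oA = poly_domain_open_bounded[OF A(1)]
  have "lambda_root p A < a * lambda_root q \<Omega>" using K(3) oA A by simp
  also have "\<dots> \<le> a * lambda_root q A"
    using lambda_root_antimono[OF oA(1,3) \<Omega>(1) A(3) pq(1)] by (intro mult_left_mono) auto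
  finally have "Fratio p q A < a"
    using ennreal_divide_less_iff(1)[OF lambda_root_bounded_pos[OF oA(1,3) pq(1) oA(2)] lambda_root_finite[OF oA(1,3) pq(1)]]
    by (simp add: Fratio_def)
  with A(1) that show ?thesis by blast
qed

lemma poly_domain_Fratio_greater:
  fixes \<Omega> :: "(real ^ 'n::finite) set"
  assumes pq: "1 \<le> q" "1 \<le> p" and \<Omega>: "open \<Omega>" "\<Omega> \<noteq> {}" "lambda_pos q \<Omega>" and a: "a < Fratio p q \<Omega>"
  obtains A :: "(real ^ 'n) set" where "poly_domain A" "a < Fratio p q A"
proof -
  have q\<Omega>: "0 < lambda_root q \<Omega>" "lambda_root q \<Omega> < top"
    using lambda_pos_iff[OF \<Omega>(1,2) pq(1)] \<Omega>(3) lambda_root_finite[OF \<Omega>(1,2) pq(1)] by auto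
  obtain b where b: "a < b" "b < Fratio p q \<Omega>" using a dense by blast
  have b0: "0 < b" "b < top" using b by (auto intro: le_less_trans less_le_trans)
  have "b * lambda_root q \<Omega> < lambda_root p \<Omega>"
    using b(2) ennreal_divide_less_iff(2)[OF q\<Omega>] by (simp add: Fratio_def)
  then have "lambda_root q \<Omega> < lambda_root p \<Omega> / b"
    using ennreal_divide_less_iff(2)[OF b0] by (simp add: mult.commute)
  then obtain K where K: "compact K" "K \<subseteq> \<Omega>"
    "\<And>A. open A \<Longrightarrow> A \<noteq> {} \<Longrightarrow> K \<subseteq> A \<Longrightarrow> lambda_root q A < lambda_root p \<Omega> / b"
    using lambda_root_inner_approx[OF \<Omega>(1,2) pq(1)] by metis
  obtain A where A: "poly_domain A" "K \<subseteq> A" "A \<subseteq> \<Omega>"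
    using poly_domain_between[OF K(1,2) \<Omega>(1,2)] by metis
  note oA = poly_domain_open_bounded[OF A(1)]
  have "lambda_root q A < lambda_root p \<Omega> / b" using K(3) oA A by simp
  then have "b * lambda_root q A < lambda_root p \<Omega>"
    using ennreal_divide_less_iff(2)[OF b0] by (simp add: mult.commute)
  also have "\<dots> \<le> lambda_root p A"
    using lambda_root_antimono[OF oA(1,3) \<Omega>(1) A(3) pq(2)] .
  finally have "b < Fratio p q A"
    using ennreal_divide_less_iff(2)[OF lambda_root_bounded_pos[OF oA(1,3) pq(1) oA(2)] lambda_root_finite[OF oA(1,3) pq(1)]]
    by (simp add: Fratio_def)
  with A(1) that b(1) show ?thesis by (meson less_trans)
qed

lemma poly_domain_lambda_pos:
  assumes "poly_domain A" "1 \<le> q"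
  shows "lambda_pos q A"
  using poly_domain_open_bounded[OF assms(1)] lambda_pos_iff lambda_root_bounded_pos assms(2) by metis

lemma m_inf_poly_domains:
  assumes pq: "1 \<le> q" "1 \<le> p"
  shows "m_inf TYPE('n::finite) p q = (INF A\<in>{A :: (real ^ 'n) set. poly_domain A}. Fratio p q A)"
proof (rule antisym)
  show "m_inf TYPE('n) p q \<le> (INF A\<in>{A :: (real ^ 'n) set. poly_domain A}. Fratio p q A)"
    unfolding m_inf_def using poly_domain_open_bounded poly_domain_lambda_pos[OF _ pq(1)]
    by (intro INF_superset_mono) auto
  show "(INF A\<in>{A :: (real ^ 'n) set. poly_domain A}. Fratio p q A) \<le> m_inf TYPE('n) p q"
    unfolding m_inf_def
  proof (rule INF_greatest)
    fix \<Omega> :: "(real ^ 'n) set" assume "\<Omega> \<in> {\<Omega>. open \<Omega> \<and> \<Omega> \<noteq> {} \<and> lambda_pos q \<Omega>}"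
    then have \<Omega>: "open \<Omega>" "\<Omega> \<noteq> {}" "lambda_pos q \<Omega>" by auto
    show "(INF A\<in>{A :: (real ^ 'n) set. poly_domain A}. Fratio p q A) \<le> Fratio p q \<Omega>"
    proof (rule dense_ge)
      fix a assume "Fratio p q \<Omega> < a"
      then obtain A :: "(real ^ 'n) set" where "poly_domain A" "Fratio p q A < a"
        using poly_domain_Fratio_less[OF pq \<Omega>] by metis
      then show "(INF A\<in>{A :: (real ^ 'n) set. poly_domain A}. Fratio p q A) \<le> a"
        by (intro INF_lower2[of A]) auto
    qed
  qed
qed

lemma M_sup_poly_domains:
  assumes pq: "1 \<le> q" "1 \<le> p"
  shows "M_sup TYPE('n::finite) p q = (SUP A\<in>{A :: (real ^ 'n) set. poly_domain A}. Fratio p q A)"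
proof (rule antisym)
  show "(SUP A\<in>{A :: (real ^ 'n) set. poly_domain A}. Fratio p q A) \<le> M_sup TYPE('n) p q"
    unfolding M_sup_def using poly_domain_open_bounded poly_domain_lambda_pos[OF _ pq(1)]
    by (intro SUP_subset_mono) auto
  show "M_sup TYPE('n) p q \<le> (SUP A\<in>{A :: (real ^ 'n) set. poly_domain A}. Fratio p q A)"
    unfolding M_sup_def
  proof (rule SUP_least)
    fix \<Omega> :: "(real ^ 'n) set" assume "\<Omega> \<in> {\<Omega>. open \<Omega> \<and> \<Omega> \<noteq> {} \<and> lambda_pos q \<Omega>}"
    then have \<Omega>: "open \<Omega>" "\<Omega> \<noteq> {}" "lambda_pos q \<Omega>" by auto
    show "Fratio p q \<Omega> \<le> (SUP A\<in>{A :: (real ^ 'n) set. poly_domain A}. Fratio p q A)"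
    proof (rule dense_le)
      fix a assume "a < Fratio p q \<Omega>"
      then obtain A :: "(real ^ 'n) set" where "poly_domain A" "a < Fratio p q A"
        using poly_domain_Fratio_greater[OF pq \<Omega>] by metis
      then show "a \<le> (SUP A\<in>{A :: (real ^ 'n) set. poly_domain A}. Fratio p q A)"
        by (intro SUP_upper2[of A]) auto
    qed
  qed
qed

lemma poly_domain_exists: "\<exists>A :: (real ^ 'n::finite) set. poly_domain A"
proof -
  have "ball (0 :: real ^ 'n) 1 \<noteq> {}" by simp
  from poly_domain_between[OF compact_empty empty_subsetI open_ball this] show ?thesis by metis
qed

lemma divide_ennreal_pos:
  assumes "0 < s" "0 < r"
  shows "ennreal r / ennreal s = ennreal (r / s)"
  using assms by (simp add: divide_ennreal)

text \<open>The ratio is invariant under scaling while both frequencies are divided by the factor. Normalizing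
  the denominator to 1 turns an infimum of ratios into an infimum of frequencies; normalizing the
  numerator turns a supremum of ratios into an infimum of frequencies of order q.\<close>

lemma poly_domain_rescaled:
  fixes A :: "(real ^ 'n::finite) set"
  assumes A: "poly_domain A" and p: "1 \<le> p" and q: "1 \<le> q"
  shows "\<exists>B :: (real ^ 'n) set. poly_domain B \<and> lambda_root q B = 1 \<and> lambda_root p B = Fratio p q A"
    and "\<exists>B :: (real ^ 'n) set. poly_domain B \<and> lambda_root p B = 1 \<and> lambda_root q B = inverse (Fratio p q A)"
proof -
  note oA = poly_domain_open_bounded[OF A]
  obtain x where x: "lambda_root p A = ennreal x" "0 < x"
    using lambda_root_finite[OF oA(1,3) p] lambda_root_bounded_pos[OF oA(1,3) p oA(2)]
    by (cases "lambda_root p A") auto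
  obtain y where y: "lambda_root q A = ennreal y" "0 < y"
    using lambda_root_finite[OF oA(1,3) q] lambda_root_bounded_pos[OF oA(1,3) q oA(2)]
    by (cases "lambda_root q A") auto
  have F: "Fratio p q A = ennreal (x / y)" using x y by (simp add: Fratio_def divide_ennreal_pos)
  let ?B = "\<lambda>s. (\<lambda>z. 0 + s *\<^sub>R z) ` A"
  have B: "lambda_root p (?B s) = ennreal (x / s)" "lambda_root q (?B s) = ennreal (y / s)" "poly_domain (?B s)"
    if "0 < s" for s
    using lambda_root_affine[OF oA(1,3) p that, of 0] lambda_root_affine[OF oA(1,3) q that, of 0] x y that
      poly_domain_affine[OF A that, of 0]
    by (simp_all add: divide_ennreal_pos)
  show "\<exists>B :: (real ^ 'n) set. poly_domain B \<and> lambda_root q B = 1 \<and> lambda_root p B = Fratio p q A"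
    using B[OF y(2)] y(2) F by (intro exI[of _ "?B y"]) simp
  have "inverse (Fratio p q A) = ennreal (y / x)" using F x y by (simp add: inverse_ennreal)
  then show "\<exists>B :: (real ^ 'n) set. poly_domain B \<and> lambda_root p B = 1 \<and> lambda_root q B = inverse (Fratio p q A)"
    using B[OF x(2)] x(2) by (intro exI[of _ "?B x"]) simp
qed

text \<open>The smooth unions that carry the extremal values.\<close>

lemma poly_domains_union:
  fixes A :: "nat \<Rightarrow> (real ^ 'n::finite) set"
  assumes A: "\<And>n. poly_domain (A n)"
  obtains \<Omega> :: "(real ^ 'n) set" where "open \<Omega>" "\<Omega> \<noteq> {}" "smooth_boundary \<Omega>"
    "\<And>p. 1 \<le> p \<Longrightarrow> lambda_root p \<Omega> = (INF n. lambda_root p (A n))"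
proof -
  obtain B c where B: "\<And>n. B n = (\<lambda>x. c n + 1 *\<^sub>R x) ` A n" "disjoint_family B" "smooth_boundary (\<Union>n. B n)"
    by (rule poly_domains_spread[OF A]; rule that; assumption)
  have pB: "poly_domain (B n)" for n unfolding B(1) by (rule poly_domain_affine[OF A]) simp
  note oB = poly_domain_open_bounded[OF pB]
  have "lambda_root p (\<Union>n. B n) = (INF n. lambda_root p (A n))" if p: "1 \<le> p" for p
  proof -
    have "lambda_root p (B n) = lambda_root p (A n)" for n
      using lambda_root_affine[OF poly_domain_open_bounded(1,3)[OF A[of n]] p, of 1 "c n"]
      unfolding B(1) by (simp add: divide_ennreal_def)
    then show ?thesis using lambda_root_disjoint_Union[OF oB(1,3) B(2) p] by simp
  qed
  moreover have "open (\<Union>n. B n)" using oB(1) by auto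
  moreover have "(\<Union>n. B n) \<noteq> {}" using oB(3) by auto
  ultimately show ?thesis using B(3) that by blast
qed

text \<open>In a union of domains forming a minimizing sequence, all of frequency 1 of order q, the frequency
  of order q remains 1 and that of order p becomes the infimum of the ratios.\<close>

lemma extremal_m:
  assumes pq: "1 \<le> q" "1 \<le> p"
  shows "\<exists>\<Omega> :: (real ^ 'n::finite) set. open \<Omega> \<and> \<Omega> \<noteq> {} \<and> smooth_boundary \<Omega> \<and> Fratio_defined p q \<Omega> \<and>
    Fratio p q \<Omega> = m_inf TYPE('n) p q"
proof -
  let ?P = "{A :: (real ^ 'n) set. poly_domain A}"
  have "Fratio p q ` ?P \<noteq> {}" using poly_domain_exists by auto
  from ennreal_Inf_countable_INF[OF this] obtain f :: "nat \<Rightarrow> ennreal"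
    where f: "range f \<subseteq> Fratio p q ` ?P" "Inf (Fratio p q ` ?P) = (INF i. f i)"
    by (elim exE conjE)
  have "\<exists>B :: (real ^ 'n) set. poly_domain B \<and> lambda_root q B = 1 \<and> lambda_root p B = f n" for n :: nat
  proof -
    obtain A :: "(real ^ 'n) set" where "poly_domain A" "f n = Fratio p q A" using f(1) by auto
    then show ?thesis using poly_domain_rescaled(1)[OF _ pq(2,1)] by metis
  qed
  then obtain B where B: "\<And>n. poly_domain (B n :: (real ^ 'n) set)" "\<And>n. lambda_root q (B n) = 1" "\<And>n. lambda_root p (B n) = f n"
    by metis
  obtain \<Omega> :: "(real ^ 'n) set" where \<Omega>: "open \<Omega>" "\<Omega> \<noteq> {}" "smooth_boundary \<Omega>"
    "\<And>p. 1 \<le> p \<Longrightarrow> lambda_root p \<Omega> = (INF n. lambda_root p (B n))"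
    by (rule poly_domains_union[of B, OF B(1)]; rule that; assumption)
  have q: "lambda_root q \<Omega> = 1" and p: "lambda_root p \<Omega> = (INF n. f n)"
    using \<Omega>(4)[OF pq(1)] \<Omega>(4)[OF pq(2)] B by auto
  have "Fratio p q \<Omega> = m_inf TYPE('n) p q"
    unfolding m_inf_poly_domains[OF pq] f(2) by (simp add: Fratio_def p q divide_ennreal_def)
  then show ?thesis using \<Omega> q by (auto simp: Fratio_defined_def)
qed

lemma INF_inverse_ennreal:
  fixes f :: "nat \<Rightarrow> ennreal"
  shows "(INF n. inverse (f n)) = inverse (SUP n. f n)"
proof (rule antisym)
  show "(INF n. inverse (f n)) \<le> inverse (SUP n. f n)"
    by (rule ennreal_le_by_reals) (auto simp: le_inverse_ennreal_iff le_INF_iff SUP_le_iff)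
  show "inverse (SUP n. f n) \<le> (INF n. inverse (f n))"
    by (rule ennreal_le_by_reals) (auto simp: le_inverse_ennreal_iff le_INF_iff SUP_le_iff)
qed

text \<open>In a union of domains forming a maximizing sequence, all of frequency 1 of order p, the frequency of
  order q becomes the reciprocal of the supremum of the ratios, which is 0 if the supremum is infinite.\<close>

lemma extremal_M:
  assumes pq: "1 \<le> q" "1 \<le> p"
  shows "\<exists>\<Omega> :: (real ^ 'n::finite) set. open \<Omega> \<and> \<Omega> \<noteq> {} \<and> smooth_boundary \<Omega> \<and> Fratio_defined p q \<Omega> \<and>
    Fratio p q \<Omega> = M_sup TYPE('n) p q"
proof -
  let ?P = "{A :: (real ^ 'n) set. poly_domain A}"
  have "Fratio p q ` ?P \<noteq> {}" using poly_domain_exists by auto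
  from ennreal_Sup_countable_SUP[OF this] obtain f :: "nat \<Rightarrow> ennreal"
    where f: "range f \<subseteq> Fratio p q ` ?P" "Sup (Fratio p q ` ?P) = (SUP i. f i)"
    by (elim exE conjE)
  have "\<exists>B :: (real ^ 'n) set. poly_domain B \<and> lambda_root p B = 1 \<and> lambda_root q B = inverse (f n)" for n :: nat
  proof -
    obtain A :: "(real ^ 'n) set" where "poly_domain A" "f n = Fratio p q A" using f(1) by auto
    then show ?thesis using poly_domain_rescaled(2)[OF _ pq(2,1)] by metis
  qed
  then obtain B where B: "\<And>n. poly_domain (B n :: (real ^ 'n) set)" "\<And>n. lambda_root p (B n) = 1" "\<And>n. lambda_root q (B n) = inverse (f n)"
    by metis
  obtain \<Omega> :: "(real ^ 'n) set" where \<Omega>: "open \<Omega>" "\<Omega> \<noteq> {}" "smooth_boundary \<Omega>"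
    "\<And>p. 1 \<le> p \<Longrightarrow> lambda_root p \<Omega> = (INF n. lambda_root p (B n))"
    by (rule poly_domains_union[of B, OF B(1)]; rule that; assumption)
  have p: "lambda_root p \<Omega> = 1" and q: "lambda_root q \<Omega> = inverse (SUP n. f n)"
    using \<Omega>(4)[OF pq(1)] \<Omega>(4)[OF pq(2)] B INF_inverse_ennreal[of f] by auto
  have "inverse (inverse x) = x" for x :: ennreal
  proof (cases x)
    case (real r)
    then show ?thesis by (cases "r = 0") (auto simp: inverse_ennreal)
  qed simp
  then have "Fratio p q \<Omega> = M_sup TYPE('n) p q"
    unfolding M_sup_poly_domains[OF pq] f(2) by (simp add: Fratio_def p q divide_ennreal_def)
  then show ?thesis using \<Omega> p by (auto simp: Fratio_defined_def)
qed

section \<open>Finiteness of the supremum above the dimension\<close>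

definition lattice_pt :: "('n::finite \<Rightarrow> int) \<Rightarrow> real ^ 'n" where
  "lattice_pt z = (\<chi> i. real_of_int (z i))"

lemma lattice_pt_in_cell: "lattice_pt z \<in> cell z"
  by (simp add: lattice_pt_def cell_def)

lemma half_ball_in_cell:
  fixes z :: "'n::finite \<Rightarrow> int"
  shows "ball (lattice_pt z + (\<chi> i. 1/2)) (1/2) \<subseteq> cell z"
proof
  fix x assume x: "x \<in> ball (lattice_pt z + (\<chi> i. 1/2)) (1/2)"
  have "\<bar>x $ i - (real_of_int (z i) + 1/2)\<bar> < 1/2" for i
  proof -
    have "\<bar>(x - (lattice_pt z + (\<chi> i. 1/2))) $ i\<bar> \<le> norm (x - (lattice_pt z + (\<chi> i. 1/2)))"
      by (rule component_le_norm_cart)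
    also have "\<dots> < 1/2" using x by (simp add: dist_norm norm_minus_commute)
    finally show ?thesis by (simp add: lattice_pt_def)
  qed
  then have "real_of_int (z i) \<le> x $ i \<and> x $ i < real_of_int (z i) + 1" for i
    using abs_less_iff[of "x $ i - (real_of_int (z i) + 1/2)" "1/2"] by (smt (verit) field_sum_of_halves)
  then show "x \<in> cell z" by (simp add: cell_def floor_eq_iff)
qed

text \<open>If no cell lies in \<Omega>, every test function vanishes near a point of each cell. Above the dimension
  the size of the region of vanishing does not matter.\<close>

lemma lambda_root_ge_of_inradius:
  fixes \<Omega> :: "(real ^ 'n::finite) set"
  assumes \<Omega>: "open \<Omega>" "\<Omega> \<noteq> {}" and q: "of_nat CARD('n) < q" "q \<noteq> top"
    and H: "\<And>x. \<not> ball x (1/2) \<subseteq> \<Omega>"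
  shows "ennreal (1 / (real CARD('n) * (1 / (1 - real CARD('n) / enn2real q)))) \<le> lambda_root q \<Omega>"
proof -
  let ?d = "real CARD('n)"
  define r where "r = enn2real q"
  have d1: "1 \<le> ?d" using zero_less_card_finite[where 'a='n] by linarith
  have rq: "q = ennreal r" "0 \<le> r" using q(2) by (auto simp: r_def less_top)
  have dr: "?d < r"
    using q(1) unfolding rq(1) by (metis ennreal_less_iff ennreal_of_nat_eq_real_of_nat of_nat_0_le_iff)
  \<comment> \<open>The smallest admissible exponent, which is less than 1 above the dimension.\<close>
  define b where "b = ?d / r"
  have b: "?d \<le> b * r" "b \<noteq> 1" "b < 1" using dr d1 by (auto simp: b_def)
  have r1: "1 \<le> r" using dr d1 by linarith
  have q1: "1 \<le> q" unfolding rq(1) using r1 by simp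
  show ?thesis
    unfolding r_def[symmetric] b_def[symmetric]
  proof (rule lambda_root_ge_of_inequality[OF \<Omega> q1 q(2), folded r_def])
    show "0 < ?d * (1 / (1 - b))" using d1 b by (intro mult_pos_pos) auto
    fix f assume f: "f \<in> C1c \<Omega>"
    obtain K where K: "compact K" "K \<subseteq> \<Omega>" "\<And>x. x \<notin> K \<Longrightarrow> f x = 0" using C1c_support[OF f] by metis
    show "mass r f \<le> ennreal ((?d * (1 / (1 - b))) powr r) * energy r f"
    proof (rule cellwise_poincare[OF f r1 b(1,2)])
      fix z :: "'n \<Rightarrow> int"
      obtain c where c: "c \<in> cell z" "c \<notin> \<Omega>"
        using H[of "lattice_pt z + (\<chi> i. 1/2)"] half_ball_in_cell[of z] by blast
      have "open (- K)" "c \<in> - K" using K(1,2) c by (auto simp: compact_imp_closed open_Compl)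
      then obtain \<epsilon> where \<epsilon>: "0 < \<epsilon>" "ball c \<epsilon> \<subseteq> - K" by (rule openE)
      define \<tau> where "\<tau> = min (1/2) (\<epsilon> / (2 * ?d))"
      have \<tau>: "0 < \<tau>" "\<tau> < 1" "\<tau> * ?d < \<epsilon>"
      proof -
        show "0 < \<tau>" "\<tau> < 1" using \<epsilon> d1 by (auto simp: \<tau>_def)
        have "\<tau> * ?d \<le> \<epsilon> / (2 * ?d) * ?d" using d1 by (intro mult_right_mono) (auto simp: \<tau>_def)
        also have "\<dots> = \<epsilon> / 2" using d1 by simp
        finally show "\<tau> * ?d < \<epsilon>" using \<epsilon>(1) by linarith
      qed
      have "f (c + \<tau> *\<^sub>R (x - c)) = 0" if x: "x \<in> cell z" for x
      proof (rule K(3))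
        have "norm (\<tau> *\<^sub>R (x - c)) \<le> \<tau> * ?d"
          using cell_diameter[OF x c(1)] \<tau>(1) by (simp add: mult_left_mono)
        then have "c + \<tau> *\<^sub>R (x - c) \<in> ball c \<epsilon>" using \<tau>(3) by (simp add: dist_norm)
        then show "c + \<tau> *\<^sub>R (x - c) \<notin> K" using \<epsilon>(2) by blast
      qed
      moreover have "(1 - \<tau> powr (1 - b)) / (1 - b) \<le> 1 / (1 - b)"
        using b by (intro divide_right_mono) auto
      ultimately show "\<exists>c\<in>cell z. \<exists>\<tau>. 0 < \<tau> \<and> \<tau> < 1 \<and> (\<forall>x\<in>cell z. f (c + \<tau> *\<^sub>R (x - c)) = 0) \<and>
          (1 - \<tau> powr (1 - b)) / (1 - b) \<le> 1 / (1 - b)"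
        using c(1) \<tau>(1,2) by blast
    qed
  qed
qed

lemma lambda_root_ball:
  fixes x :: "real ^ 'n::finite"
  assumes "0 < r" "1 \<le> p"
  shows "lambda_root p (ball x r) = lambda_root p (ball (0 :: real ^ 'n) 1) / ennreal r"
proof -
  have "ball x r = (\<lambda>y. x + r *\<^sub>R y) ` ball 0 1" using affine_ball[OF assms(1), of x 0 1] by simp
  moreover have "ball (0 :: real ^ 'n) 1 \<noteq> {}" by simp
  ultimately show ?thesis using lambda_root_affine[OF open_ball _ assms(2,1), of 0 1 x] by metis
qed

text \<open>The radii of the balls inside \<Omega> are bounded because the frequency of a large ball is small; a radius
  above half of their supremum cannot be doubled.\<close>

lemma ball_of_almost_maximal_radius:
  fixes \<Omega> :: "(real ^ 'n::finite) set"
  assumes \<Omega>: "open \<Omega>" "\<Omega> \<noteq> {}" and q: "1 \<le> q" and pos: "0 < lambda_root q \<Omega>"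
  obtains x r where "0 < r" "ball x r \<subseteq> \<Omega>" "\<And>y. \<not> ball y (2 * r) \<subseteq> \<Omega>"
proof -
  define X where "X = {r. 0 < r \<and> (\<exists>x. ball x r \<subseteq> \<Omega>)}"
  obtain y where y: "lambda_root q \<Omega> = ennreal y" "0 < y"
    using lambda_root_finite[OF \<Omega> q] pos by (cases "lambda_root q \<Omega>") auto
  have ne1: "ball (0 :: real ^ 'n) 1 \<noteq> {}" by simp
  obtain k where k: "lambda_root q (ball (0 :: real ^ 'n) 1) = ennreal k" "0 \<le> k"
    using lambda_root_finite[OF open_ball ne1 q] by (cases "lambda_root q (ball (0 :: real ^ 'n) 1)") auto
  have bd: "r \<le> k / y" if "r \<in> X" for r
  proof -
    have "0 < r" "\<exists>x. ball x r \<subseteq> \<Omega>" using that unfolding X_def by blast+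
    then obtain x where r: "0 < r" "ball x r \<subseteq> \<Omega>" by blast
    have "lambda_root q \<Omega> \<le> lambda_root q (ball x r)"
      using r \<Omega> q by (intro lambda_root_antimono) auto
    then have "ennreal y \<le> ennreal (k / r)"
      using r k by (simp add: lambda_root_ball[OF r(1) q] y divide_ennreal)
    then have "y \<le> k / r" using k r by (simp add: ennreal_le_iff)
    then show ?thesis using r y by (simp add: field_simps)
  qed
  obtain x0 e0 where e0: "0 < e0" "ball x0 e0 \<subseteq> \<Omega>" using \<Omega> by (meson openE ex_in_conv)
  then have e0X: "e0 \<in> X" by (auto simp: X_def)
  have bdd: "bdd_above X" using bd by (auto simp: bdd_above_def)
  have s: "0 < Sup X" using cSup_upper[OF e0X bdd] e0 by linarith
  have "Sup X / 2 < Sup X" using s by simp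
  then obtain r where r: "r \<in> X" "Sup X / 2 < r" using less_cSup_iff[OF _ bdd] e0X by blast
  have "0 < r" "\<exists>x. ball x r \<subseteq> \<Omega>" using r(1) unfolding X_def by blast+
  then obtain x where x: "0 < r" "ball x r \<subseteq> \<Omega>" by blast
  have "\<not> ball y (2 * r) \<subseteq> \<Omega>" for y
  proof
    assume "ball y (2 * r) \<subseteq> \<Omega>"
    then have "2 * r \<in> X" using x by (auto simp: X_def)
    then show False using cSup_upper[OF _ bdd] r(2) by fastforce
  qed
  with x that show ?thesis by blast
qed

text \<open>Up to scaling, \<Omega> contains a ball of radius 1/4 but none of radius 1/2. The former bounds the frequency
  of order p from above by that of the ball, the latter bounds that of order q away from 0.\<close>

lemma M_sup_finite:
  assumes q: "of_nat CARD('n::finite) < q" "q \<noteq> top" and qp: "q \<le> p"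
  shows "M_sup TYPE('n) p q < top"
proof -
  have "(1::ennreal) \<le> of_nat CARD('n)"
    using zero_less_card_finite[where 'a='n] by (metis One_nat_def Suc_leI of_nat_1 of_nat_mono)
  from le_less_trans[OF this q(1)] have q1: "1 \<le> q" by (rule less_imp_le)
  have p1: "1 \<le> p" using q1 qp by (rule order_trans)
  have ne1: "ball (0 :: real ^ 'n) 1 \<noteq> {}" by simp
  obtain k where k: "lambda_root p (ball (0 :: real ^ 'n) 1) = ennreal k" "0 \<le> k"
    using lambda_root_finite[OF open_ball ne1 p1] by (cases "lambda_root p (ball (0 :: real ^ 'n) 1)") auto
  define C where "C = real CARD('n) * (1 / (1 - real CARD('n) / enn2real q))"
  have C: "0 < C"
  proof -
    obtain r where r: "q = ennreal r" "0 \<le> r" using q(2) by (cases q) auto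
    have "real CARD('n) < r"
      using q(1) unfolding r(1) by (metis ennreal_less_iff ennreal_of_nat_eq_real_of_nat of_nat_0_le_iff)
    then show ?thesis unfolding C_def using r zero_less_card_finite[where 'a='n] by (intro mult_pos_pos) auto
  qed
  have "Fratio p q \<Omega> \<le> ennreal (4 * k * C)" if \<Omega>: "open \<Omega>" "\<Omega> \<noteq> {}" "lambda_pos q \<Omega>" for \<Omega> :: "(real ^ 'n) set"
  proof -
    have L: "0 < lambda_root q \<Omega>" "lambda_root q \<Omega> < top"
      using lambda_pos_iff[OF \<Omega>(1,2) q1] \<Omega>(3) lambda_root_finite[OF \<Omega>(1,2) q1] by auto
    obtain x r where r: "0 < r" "ball x r \<subseteq> \<Omega>" "\<And>y. \<not> ball y (2 * r) \<subseteq> \<Omega>"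
      using ball_of_almost_maximal_radius[OF \<Omega>(1,2) q1 L(1)] by metis
    \<comment> \<open>The scaling that turns the excluded radius 2 r into 1/2, the inradius of a unit cell.\<close>
    define s where "s = 1 / (4 * r)"
    have s: "0 < s" "s \<noteq> 0" and s': "0 < 1 / s" using r by (auto simp: s_def)
    let ?\<Omega> = "(\<lambda>x. 0 + s *\<^sub>R x) ` \<Omega>"
    have o: "open ?\<Omega>" "?\<Omega> \<noteq> {}" using affine_image_open[OF \<Omega>(1) s(2), of 0] \<Omega>(2) by auto
    have "\<not> ball y (1/2) \<subseteq> ?\<Omega>" for y
    proof
      assume "ball y (1/2) \<subseteq> ?\<Omega>"
      then have "(\<lambda>x. - ((1 / s) *\<^sub>R 0) + (1 / s) *\<^sub>R x) ` ball y (1/2) \<subseteq> \<Omega>"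
        using affine_image_inverse[OF s(2), of 0 \<Omega>] by blast
      then have "ball (- ((1 / s) *\<^sub>R 0) + (1 / s) *\<^sub>R y) ((1 / s) * (1/2)) \<subseteq> \<Omega>"
        unfolding affine_ball[OF s'] .
      then show False using r(3)[of "- ((1 / s) *\<^sub>R 0) + (1 / s) *\<^sub>R y"] by (simp add: s_def)
    qed
    from lambda_root_ge_of_inradius[OF o q this]
    have "ennreal (1 / C) \<le> lambda_root q ?\<Omega>" by (simp add: C_def)
    then have lq: "ennreal (1 / C * s) \<le> lambda_root q \<Omega>"
      using lambda_root_affine_ge[OF \<Omega>(1,2) q1 s(1), of "1 / C" 0] C by simp
    have "lambda_root p \<Omega> \<le> lambda_root p (ball x r)"
      using r \<Omega> p1 by (intro lambda_root_antimono) auto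
    also have "\<dots> = ennreal (k / r)" using k r by (simp add: lambda_root_ball[OF r(1) p1] divide_ennreal)
    also have "k / r = 4 * k * C * (1 / C * s)" using C r by (simp add: s_def)
    also have "ennreal (4 * k * C * (1 / C * s)) = ennreal (4 * k * C) * ennreal (1 / C * s)"
      using C k s by (intro ennreal_mult) auto
    also have "\<dots> \<le> ennreal (4 * k * C) * lambda_root q \<Omega>" using lq by (rule mult_left_mono) simp
    finally show ?thesis
      using ennreal_divide_less_iff(2)[OF L, of "ennreal (4 * k * C)" "lambda_root p \<Omega>"]
      by (simp add: Fratio_def flip: not_less)
  qed
  then have "M_sup TYPE('n) p q \<le> ennreal (4 * k * C)"
    unfolding M_sup_def by (intro SUP_least) auto
  also have "\<dots> < top" by simp
  finally show ?thesis .
qed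

section \<open>Periodically perforated space\<close>

text \<open>The lattice of integer points, thickened to closed balls of radius r, is removed. The distance to the
  lattice makes the set visibly open.\<close>

definition perforated :: "real \<Rightarrow> (real ^ 'n::finite) set" where
  "perforated r = {x. r < infdist x (range lattice_pt)}"

lemma perforated_open: "open (perforated r)"
  unfolding perforated_def by (intro open_Collect_less continuous_intros)

lemma perforated_far:
  assumes "x \<in> perforated r"
  shows "r < norm (x - lattice_pt z)"
  using assms infdist_le[of "lattice_pt z" "range lattice_pt" x] by (auto simp: perforated_def dist_norm)

lemma infdist_lattice_ge:
  assumes "\<And>z. s \<le> norm (x - lattice_pt z)"
  shows "s \<le> infdist x (range lattice_pt)"
  unfolding infdist_def using assms by (auto simp: dist_norm intro!: cINF_greatest)

lemma cell_centre_far: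
  fixes z z' :: "'n::finite \<Rightarrow> int"
  shows "1/2 \<le> norm (lattice_pt z + (\<chi> i. 1/2) - lattice_pt z')"
proof -
  fix i :: 'n
  have "1/2 \<le> \<bar>real_of_int (z i) + 1/2 - real_of_int (z' i)\<bar>"
  proof (cases "z' i \<le> z i")
    case True
    then have "real_of_int (z' i) \<le> real_of_int (z i)" by simp
    then show ?thesis by simp
  next
    case False
    then have "z i + 1 \<le> z' i" by simp
    then have "real_of_int (z i + 1) \<le> real_of_int (z' i)" by (simp only: of_int_le_iff)
    then show ?thesis by simp
  qed
  also have "\<dots> = \<bar>(lattice_pt z + (\<chi> i. 1/2) - lattice_pt z') $ i\<bar>" by (simp add: lattice_pt_def)
  also have "\<dots> \<le> norm (lattice_pt z + (\<chi> i. 1/2) - lattice_pt z')" by (rule component_le_norm_cart)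
  finally show ?thesis .
qed

lemma perforated_nonempty:
  assumes "r < 1/2"
  shows "perforated r \<noteq> ({} :: (real ^ 'n::finite) set)"
proof -
  let ?x = "lattice_pt (\<lambda>_. 0) + (\<chi> i. 1/2) :: real ^ 'n"
  have "1/2 \<le> infdist ?x (range lattice_pt)" by (intro infdist_lattice_ge cell_centre_far)
  then have "?x \<in> perforated r" using assms by (simp add: perforated_def)
  then show ?thesis by blast
qed

lemma cell_of: "\<exists>z. (x :: real ^ 'n::finite) \<in> cell z"
  by (auto simp: cell_def intro: exI[of _ "\<lambda>i. \<lfloor>x $ i\<rfloor>"])

lemma perforated_lambda_root_top:
  assumes "0 < r"
  shows "ennreal (1 / real CARD('n)) \<le> lambda_root top (perforated r :: (real ^ 'n::finite) set)"
proof -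
  have d: "0 < real CARD('n)" by simp
  have "s \<le> real CARD('n)" if s: "0 < s" "ball x s \<subseteq> perforated r" for x :: "real ^ 'n" and s
  proof (rule ccontr)
    assume "\<not> s \<le> real CARD('n)"
    obtain z where z: "x \<in> cell z" using cell_of by blast
    have "norm (x - lattice_pt z) \<le> real CARD('n)" by (rule cell_diameter[OF z lattice_pt_in_cell])
    then have "lattice_pt z \<in> ball x s" using \<open>\<not> s \<le> real CARD('n)\<close> by (simp add: dist_norm)
    then have "lattice_pt z \<in> perforated r" using s(2) by blast
    from perforated_far[OF this, of z] assms show False by simp
  qed
  then show ?thesis using le_lambda_root_top_iff[of "1 / real CARD('n)" "perforated r"] d by auto
qed

text \<open>Test functions vanish in the balls around the lattice points, each of which lies in its own cell, so
  that the rays may start there with \<tau> = r / d.\<close>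

lemma perforated_lambda_root_ge:
  assumes p: "1 \<le> p" "p \<noteq> top" and r: "0 < r" "r < 1/2"
    and b: "real CARD('n) \<le> b * enn2real p" "b \<noteq> 1"
    and W: "(1 - (r / real CARD('n)) powr (1 - b)) / (1 - b) \<le> W"
  shows "ennreal (1 / (real CARD('n) * W)) \<le> lambda_root p (perforated r :: (real ^ 'n::finite) set)"
proof -
  let ?d = "real CARD('n)"
  have d1: "1 \<le> ?d" using zero_less_card_finite[where 'a='n] by linarith
  define \<tau> where "\<tau> = r / ?d"
  have rd: "r < ?d" by (rule less_le_trans[OF _ d1]) (use r in linarith)
  have "r / ?d < 1" by (subst divide_less_eq_1_pos) (simp, rule rd)
  then have \<tau>: "0 < \<tau>" "\<tau> < 1" "\<tau> * ?d = r" using r(1) by (simp_all add: \<tau>_def)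
  have "0 < W" using W integral_powr_Icc(2)[OF \<tau>(1,2) b(2)] unfolding \<tau>_def by linarith
  then have C: "0 < ?d * W" using d1 by simp
  show ?thesis
  proof (rule lambda_root_ge_of_inequality[OF perforated_open perforated_nonempty[OF r(2)] p C])
    fix f assume f: "f \<in> C1c (perforated r :: (real ^ 'n) set)"
    obtain K where K: "K \<subseteq> perforated r" "\<And>x. x \<notin> K \<Longrightarrow> f x = 0" using C1c_support[OF f] by metis
    show "mass (enn2real p) f \<le> ennreal ((?d * W) powr enn2real p) * energy (enn2real p) f"
    proof (rule cellwise_poincare[OF f enn2real_ge_1(1)[OF p] b])
      fix z :: "'n \<Rightarrow> int"
      have "f (lattice_pt z + \<tau> *\<^sub>R (x - lattice_pt z)) = 0" if x: "x \<in> cell z" for x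
      proof (rule K(2))
        have "norm (\<tau> *\<^sub>R (x - lattice_pt z)) \<le> \<tau> * ?d"
          using cell_diameter[OF x lattice_pt_in_cell] \<tau>(1) by (simp add: mult_left_mono)
        then have "norm (lattice_pt z + \<tau> *\<^sub>R (x - lattice_pt z) - lattice_pt z) \<le> r" using \<tau>(3) by simp
        then show "lattice_pt z + \<tau> *\<^sub>R (x - lattice_pt z) \<notin> K"
          using K(1) perforated_far[of _ r z] by (meson not_less subsetD)
      qed
      then show "\<exists>c\<in>cell z. \<exists>\<tau>. 0 < \<tau> \<and> \<tau> < 1 \<and> (\<forall>x\<in>cell z. f (c + \<tau> *\<^sub>R (x - c)) = 0) \<and>
          (1 - \<tau> powr (1 - b)) / (1 - b) \<le> W"
        using lattice_pt_in_cell[of z] \<tau>(1,2) W unfolding \<tau>_def[symmetric] by blast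
    qed
  qed
qed

lemma perforated_admissible:
  assumes q: "1 \<le> q" and r: "0 < r" "r < 1/2"
  shows "0 < lambda_root q (perforated r :: (real ^ 'n::finite) set)"
proof (cases "q = top")
  case True
  have "0 < ennreal (1 / real CARD('n))" by simp
  from less_le_trans[OF this perforated_lambda_root_top[OF r(1)]] True show ?thesis by simp
next
  case False
  define b where "b = real CARD('n) + 1"
  have "b * 1 \<le> b * enn2real q" using enn2real_ge_1(1)[OF q False] by (intro mult_left_mono) (auto simp: b_def)
  then have b: "real CARD('n) \<le> b * enn2real q" by (rule order_trans[rotated]) (simp add: b_def)
  have b1: "b \<noteq> 1" by (simp add: b_def)
  define W where "W = (1 - (r / real CARD('n)) powr (1 - b)) / (1 - b)"
  have d1: "1 \<le> real CARD('n)" using zero_less_card_finite[where 'a='n] by linarith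
  have rd: "r < real CARD('n)" by (rule less_le_trans[OF _ d1]) (use r in linarith)
  have rd1: "r / real CARD('n) < 1" by (subst divide_less_eq_1_pos) (simp, rule rd)
  have rd0: "0 < r / real CARD('n)" using r(1) by simp
  have "0 < W" unfolding W_def by (rule integral_powr_Icc(2)[OF rd0 rd1 b1])
  then have "0 < ennreal (1 / (real CARD('n) * W))" using d1 by simp
  from less_le_trans[OF this perforated_lambda_root_ge[OF q False r b b1]] show ?thesis by (simp add: W_def)
qed

lemma lattice_pt_separated:
  assumes "norm (x - lattice_pt z) < 1/2" "norm (x - lattice_pt z') < 1/2"
  shows "z = z'"
proof (rule ccontr)
  assume "z \<noteq> z'"
  then obtain i where "z i \<noteq> z' i" by blast
  then have "1 \<le> \<bar>z i - z' i\<bar>" by simp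
  then have "1 \<le> \<bar>real_of_int (z i) - real_of_int (z' i)\<bar>" by linarith
  also have "\<dots> = \<bar>(lattice_pt z - lattice_pt z') $ i\<bar>" by (simp add: lattice_pt_def)
  also have "\<dots> \<le> norm (lattice_pt z - lattice_pt z')" by (rule component_le_norm_cart)
  also have "\<dots> \<le> norm (x - lattice_pt z) + norm (x - lattice_pt z')"
    using norm_triangle_ineq4[of "x - lattice_pt z'" "x - lattice_pt z"] by simp
  finally show False using assms by simp
qed

text \<open>Copies of a profile around the lattice points of G. At each point at most one copy is active, so that
  the powers of the gradients add up without loss.\<close>

lemma lattice_copies:
  fixes \<beta> :: "real ^ 'n::finite \<Rightarrow> real" and G :: "('n \<Rightarrow> int) set"
  assumes \<beta>: "\<beta> \<in> C1c (ball 0 (1/4))" "\<And>x. 0 \<le> \<beta> x" "\<And>x. \<beta> x \<le> 1"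
    and G: "finite G" and s: "1 \<le> s"
  defines "S \<equiv> \<lambda>x. \<Sum>z\<in>G. \<beta> (x - lattice_pt z)" and "S' \<equiv> \<lambda>x. \<Sum>z\<in>G. grad \<beta> (x - lattice_pt z)"
  shows "(S has_derivative (\<lambda>h. S' x \<bullet> h)) (at x)"
    and "continuous_on UNIV S'"
    and "0 \<le> S x" "S x \<le> 1"
    and "z \<in> G \<Longrightarrow> norm (x - lattice_pt z) < 1/4 \<Longrightarrow> S x = \<beta> (x - lattice_pt z)"
    and "(\<And>z. 1/4 \<le> norm (x - lattice_pt z)) \<Longrightarrow> S x = 0"
    and "norm (S' x) powr s \<le> (\<Sum>z\<in>G. norm (grad \<beta> (x - lattice_pt z)) powr s)"
proof -
  obtain K where K: "K \<subseteq> ball 0 (1/4)" "\<And>x. x \<notin> K \<Longrightarrow> \<beta> x = 0" "\<And>x. x \<notin> K \<Longrightarrow> grad \<beta> x = 0"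
    using C1c_support[OF \<beta>(1)] by metis
  have z0: "\<beta> y = 0" "grad \<beta> y = 0" if "1/4 \<le> norm y" for y
  proof -
    have "y \<notin> K" using that K(1) by auto
    then show "\<beta> y = 0" "grad \<beta> y = 0" using K by auto
  qed
  have d1: "((\<lambda>x. \<beta> (x - lattice_pt z)) has_derivative (\<lambda>h. grad \<beta> (x - lattice_pt z) \<bullet> h)) (at x)" for z
  proof -
    have "((\<lambda>x. x - lattice_pt z) has_derivative (\<lambda>h. h)) (at x)" by (auto intro!: derivative_eq_intros)
    from has_derivative_compose[OF this C1c_derivative[OF \<beta>(1)]] show ?thesis by simp
  qed
  show "(S has_derivative (\<lambda>h. S' x \<bullet> h)) (at x)"
    unfolding S_def S'_def inner_sum_left by (intro has_derivative_sum d1)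
  show "continuous_on UNIV S'"
    unfolding S'_def
    by (intro continuous_on_sum continuous_on_compose2[OF C1c_continuous_grad[OF \<beta>(1)]] continuous_intros) auto
  have one: "(\<Sum>z'\<in>G. F (x - lattice_pt z')) = F (x - lattice_pt z)"
    if z: "z \<in> G" "norm (x - lattice_pt z) < 1/4" and F: "\<And>y. 1/4 \<le> norm y \<Longrightarrow> F y = 0"
    for z and F :: "real ^ 'n \<Rightarrow> 'b::comm_monoid_add"
  proof -
    have "F (x - lattice_pt z') = (if z' = z then F (x - lattice_pt z) else 0)" for z'
    proof (cases "z' = z")
      case False
      then have "\<not> norm (x - lattice_pt z') < 1/4" using lattice_pt_separated[of x z z'] z(2) by auto
      then show ?thesis using F False by simp
    qed simp
    then have "(\<Sum>z'\<in>G. F (x - lattice_pt z')) = (\<Sum>z'\<in>G. if z' = z then F (x - lattice_pt z) else 0)"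
      by (intro sum.cong) auto
    then show ?thesis using z(1) G by simp
  qed
  have none: "(\<Sum>z'\<in>G. F (x - lattice_pt z')) = 0"
    if "\<And>z. z \<in> G \<Longrightarrow> 1/4 \<le> norm (x - lattice_pt z)" and F: "\<And>y. 1/4 \<le> norm y \<Longrightarrow> F y = 0"
    for F :: "real ^ 'n \<Rightarrow> 'b::comm_monoid_add"
    using that by (intro sum.neutral) auto
  show S1: "S x = \<beta> (x - lattice_pt z)" if "z \<in> G" "norm (x - lattice_pt z) < 1/4" for z
    unfolding S_def by (rule one[OF that z0(1)])
  show S0: "S x = 0" if "\<And>z. 1/4 \<le> norm (x - lattice_pt z)"
    unfolding S_def by (rule none[OF that z0(1)])
  have zs: "norm (grad \<beta> y) powr s = 0" if "1/4 \<le> norm y" for y using z0(2)[OF that] s by simp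
  show "0 \<le> S x" "S x \<le> 1" "norm (S' x) powr s \<le> (\<Sum>z\<in>G. norm (grad \<beta> (x - lattice_pt z)) powr s)"
  proof -
    consider z where "z \<in> G" "norm (x - lattice_pt z) < 1/4" | "\<And>z. z \<in> G \<Longrightarrow> 1/4 \<le> norm (x - lattice_pt z)"
      by (meson not_less)
    then have "0 \<le> S x \<and> S x \<le> 1 \<and> norm (S' x) powr s \<le> (\<Sum>z\<in>G. norm (grad \<beta> (x - lattice_pt z)) powr s)"
    proof cases
      case (1 z)
      have "S' x = grad \<beta> (x - lattice_pt z)" unfolding S'_def by (rule one[OF 1 z0(2)])
      moreover have "(\<Sum>z\<in>G. norm (grad \<beta> (x - lattice_pt z)) powr s) = norm (grad \<beta> (x - lattice_pt z)) powr s"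
        using one[OF 1, of "\<lambda>y. norm (grad \<beta> y) powr s"] zs by simp
      ultimately show ?thesis using S1[OF 1] \<beta>(2,3) by simp
    next
      case 2
      have "S' x = 0" unfolding S'_def by (rule none[OF 2 z0(2)])
      moreover have "S x = 0" unfolding S_def by (rule none[OF 2 z0(1)])
      ultimately show ?thesis using s by (simp add: sum_nonneg)
    qed
    then show "0 \<le> S x" "S x \<le> 1" "norm (S' x) powr s \<le> (\<Sum>z\<in>G. norm (grad \<beta> (x - lattice_pt z)) powr s)" by auto
  qed
qed

definition lattice_box :: "nat \<Rightarrow> ('n::finite \<Rightarrow> int) set" where
  "lattice_box m = {z. \<forall>i. \<bar>z i\<bar> \<le> int m}"

lemma lattice_box_card:
  "finite (lattice_box m :: ('n::finite \<Rightarrow> int) set)" "card (lattice_box m :: ('n \<Rightarrow> int) set) = (2 * m + 1) ^ CARD('n)"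
proof -
  have k: "\<bar>y\<bar> \<le> int m \<longleftrightarrow> - int m \<le> y \<and> y \<le> int m" for y by linarith
  have e: "(lattice_box m :: ('n \<Rightarrow> int) set) = PiE UNIV (\<lambda>_. {- int m..int m})"
    by (auto simp: lattice_box_def PiE_def Pi_def k)
  have "nat (2 * int m + 1) = 2 * m + 1" by simp
  then show "card (lattice_box m :: ('n \<Rightarrow> int) set) = (2 * m + 1) ^ CARD('n)"
    unfolding e by (subst card_PiE) simp_all
  show "finite (lattice_box m :: ('n \<Rightarrow> int) set)" unfolding e by (intro finite_PiE) auto
qed

lemma norm_le_of_components:
  fixes x :: "real ^ 'n::finite"
  assumes "\<And>i. \<bar>x $ i\<bar> \<le> c"
  shows "norm x \<le> real CARD('n) * c"
proof -
  have "norm x \<le> (\<Sum>i\<in>UNIV. \<bar>x $ i\<bar>)" by (rule norm_le_l1_cart)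
  also have "\<dots> \<le> (\<Sum>i\<in>(UNIV::'n set). c)" by (intro sum_mono assms)
  finally show ?thesis by simp
qed

text \<open>The test function is 1 minus the copies of the profile, cut off at scale N. It equals 1 on a fixed
  ball in each of (2 n + 1) ^ d cells. Its energy comes from at most (4 N + 3) ^ d copies of the profile,
  a comparable number for N = d (n + 1), and from the cutoff.\<close>

lemma perforated_test_inequality:
  fixes \<beta> :: "real ^ 'n::finite \<Rightarrow> real"
  assumes q: "1 \<le> q" "q \<noteq> top" and r: "0 < r" "r < 1/8"
    and \<beta>: "\<beta> \<in> C1c (ball 0 (1/4))" "\<And>x. 0 \<le> \<beta> x" "\<And>x. \<beta> x \<le> 1" "\<And>x. norm x \<le> 2 * r \<Longrightarrow> \<beta> x = 1"
    and \<epsilon>: "energy (enn2real q) \<beta> \<le> ennreal \<epsilon>" "0 \<le> \<epsilon>"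
    and \<eta>: "energy (enn2real q) (bump :: real ^ 'n \<Rightarrow> real) \<le> ennreal E" "0 \<le> E"
    and a: "0 < a" "ennreal a \<le> lambda_root q (perforated r :: (real ^ 'n) set)"
    and N: "N = CARD('n) * (n + 1)"
  shows "a powr enn2real q * (real (2 * n + 1) ^ CARD('n) * measure lborel (ball (0 :: real ^ 'n) (1/4)))
    \<le> 2 powr enn2real q * (real N ^ CARD('n) * real N powr (- enn2real q) * E + real (4 * N + 3) ^ CARD('n) * \<epsilon>)"
proof -
  define s where "s = enn2real q"
  have s: "1 \<le> s" using enn2real_ge_1(1)[OF q] by (simp add: s_def)
  let ?d = "CARD('n)"
  have "0 < N" unfolding N by (intro mult_pos_pos) auto
  then have N0: "0 < real N" by simp
  define G :: "('n \<Rightarrow> int) set" where "G = lattice_box (2 * N + 1)"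
  have "2 * (2 * N + 1) + 1 = 4 * N + 3" by simp
  then have G: "finite G" "card G = (4 * N + 3) ^ ?d"
    unfolding G_def lattice_box_card(2) by (simp_all only: lattice_box_card(1))
  define S where "S = (\<lambda>x. \<Sum>z\<in>G. \<beta> (x - lattice_pt z))"
  define S' where "S' = (\<lambda>x. \<Sum>z\<in>G. grad \<beta> (x - lattice_pt z))"
  have S_eq: "(\<Sum>z\<in>G. \<beta> (x - lattice_pt z)) = S x" "(\<Sum>z\<in>G. grad \<beta> (x - lattice_pt z)) = S' x" for x
    by (simp_all add: S_def S'_def)
  note C = lattice_copies[OF \<beta>(1-3) G(1) s, unfolded S_eq]
  define \<eta> where "\<eta> = (\<lambda>x :: real ^ 'n. bump ((1 / real N) *\<^sub>R (x - 0)))"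
  have \<eta>1: "\<eta> \<in> C1c ((\<lambda>x. 0 + real N *\<^sub>R x) ` ball 0 2)"
    unfolding \<eta>_def using N0 by (intro C1c_affine(1) bump_C1c) auto
  have nN: "norm ((1 / real N) *\<^sub>R (x - 0)) = norm x / real N" for x :: "real ^ 'n" using N0 by simp
  have \<eta>v: "0 \<le> \<eta> x" "\<eta> x \<le> 1" for x by (auto simp: \<eta>_def bump_values)
  have \<eta>one: "\<eta> x = 1" if "norm x \<le> real N" for x
    unfolding \<eta>_def using that N0 nN[of x] by (intro bump_values(3)) (simp add: divide_le_eq)
  have \<eta>zero: "\<eta> x = 0" if "2 * real N < norm x" for x
    unfolding \<eta>_def using that N0 nN[of x] by (intro bump_values(4)) (simp add: le_divide_eq)
  have g: "((\<lambda>x. 1 - S x) has_derivative (\<lambda>h. (- S' x) \<bullet> h)) (at x)" for x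
    using has_derivative_diff[OF has_derivative_const C(1)] by simp
  have g': "continuous_on UNIV (\<lambda>x. - S' x)" by (intro continuous_intros C(2))
  define u where "u = (\<lambda>x. \<eta> x * (1 - S x))"
  note u1 = C1c_mult[OF \<eta>1 g g', folded u_def]
  have uC: "u \<in> C1c (perforated r)"
  proof (rule C1c_change_domain[OF u1(1)])
    \<comment> \<open>The set K is closed and stays at distance 2 r from the lattice, inside the perforated space.\<close>
    let ?K = "cball (0 :: real ^ 'n) (2 * real N) \<inter> {x. 2 * r \<le> infdist x (range lattice_pt)}"
    show "compact ?K"
      by (intro compact_Int_closed compact_cball closed_Collect_le continuous_intros)
    show "?K \<subseteq> perforated r" using r by (auto simp: perforated_def)
    fix x assume x: "x \<notin> ?K"
    show "u x = 0"
    proof (cases "norm x \<le> 2 * real N")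
      case False
      then show ?thesis by (simp add: u_def \<eta>zero)
    next
      case True
      then have "\<not> 2 * r \<le> infdist x (range lattice_pt)" using x by simp
      then obtain z where z: "norm (x - lattice_pt z) < 2 * r"
        using infdist_lattice_ge[of "2 * r" x] by (meson not_less)
      have "z \<in> G"
        unfolding G_def lattice_box_def
      proof (intro CollectI allI)
        fix i
        have "\<bar>(x - lattice_pt z) $ i\<bar> \<le> norm (x - lattice_pt z)" "\<bar>x $ i\<bar> \<le> norm x"
          by (rule component_le_norm_cart)+
        then have "\<bar>real_of_int (z i)\<bar> \<le> 2 * real N + 1"
          using z r True by (simp add: lattice_pt_def)
        then show "\<bar>z i\<bar> \<le> int (2 * N + 1)" by linarith
      qed
      then have "S x = \<beta> (x - lattice_pt z)" using C(5) z r by simp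
      also have "\<dots> = 1" using z by (intro \<beta>(4)) simp
      finally show ?thesis by (simp add: u_def)
    qed
  qed
  have E\<eta>: "energy s \<eta> \<le> ennreal (real N ^ ?d * real N powr (- s) * E)"
  proof -
    have "energy s \<eta> = ennreal (real N ^ ?d * real N powr (- s)) * energy s (bump :: real ^ 'n \<Rightarrow> real)"
      unfolding \<eta>_def by (rule energy_affine[OF bump_C1c N0])
    also have "\<dots> \<le> ennreal (real N ^ ?d * real N powr (- s)) * ennreal E"
      using \<eta>(1) by (intro mult_left_mono) (auto simp: s_def)
    also have "\<dots> = ennreal (real N ^ ?d * real N powr (- s) * E)"
      using \<eta>(2) by (intro ennreal_mult[symmetric]) auto
    finally show ?thesis .
  qed
  note \<beta>m [measurable] = C1c_measurable[OF \<beta>(1)]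
  note \<eta>m [measurable] = C1c_measurable[OF \<eta>1]
  have Ecopy: "(\<integral>\<^sup>+x. ennreal (norm (grad \<beta> (x - lattice_pt z)) powr s) \<partial>lborel) = energy s \<beta>" for z
    unfolding energy_def using nn_integral_affine[of "\<lambda>x. ennreal (norm (grad \<beta> x) powr s)" 1 "lattice_pt z"]
    by simp
  have pw: "norm (grad u x) powr s \<le> 2 powr s * (norm (grad \<eta> x) powr s + (\<Sum>z\<in>G. norm (grad \<beta> (x - lattice_pt z)) powr s))" for x
  proof -
    let ?A = "norm (grad \<eta> x)" and ?B = "norm (S' x)"
    have "norm (\<eta> x *\<^sub>R (- S' x) + (1 - S x) *\<^sub>R grad \<eta> x) \<le> \<bar>\<eta> x\<bar> * ?B + \<bar>1 - S x\<bar> * ?A"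
      using norm_triangle_ineq[of "\<eta> x *\<^sub>R (- S' x)" "(1 - S x) *\<^sub>R grad \<eta> x"] by simp
    also have "\<dots> \<le> 1 * ?B + 1 * ?A"
      using \<eta>v[of x] C(3,4)[of x] by (intro add_mono mult_right_mono) auto
    also have "\<dots> \<le> 2 * max ?A ?B" by simp
    finally have "norm (grad u x) \<le> 2 * max ?A ?B" unfolding u1(2) .
    then have "norm (grad u x) powr s \<le> (2 * max ?A ?B) powr s" using s by (intro powr_mono2) auto
    also have "\<dots> = 2 powr s * (max ?A ?B) powr s" by (simp add: powr_mult)
    also have "(max ?A ?B) powr s \<le> ?A powr s + ?B powr s" by (auto simp: max_def)
    also have "\<dots> \<le> ?A powr s + (\<Sum>z\<in>G. norm (grad \<beta> (x - lattice_pt z)) powr s)"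
      using C(7)[of x] by simp
    finally show ?thesis by simp
  qed
  have "energy s u \<le> (\<integral>\<^sup>+x. ennreal (2 powr s) * (ennreal (norm (grad \<eta> x) powr s) + (\<Sum>z\<in>G. ennreal (norm (grad \<beta> (x - lattice_pt z)) powr s))) \<partial>lborel)"
    unfolding energy_def
  proof (rule nn_integral_mono)
    fix x :: "real ^ 'n"
    have "ennreal (norm (grad u x) powr s) \<le> ennreal (2 powr s * (norm (grad \<eta> x) powr s + (\<Sum>z\<in>G. norm (grad \<beta> (x - lattice_pt z)) powr s)))"
      by (rule ennreal_leI[OF pw])
    then show "ennreal (norm (grad u x) powr s) \<le> ennreal (2 powr s) * (ennreal (norm (grad \<eta> x) powr s) + (\<Sum>z\<in>G. ennreal (norm (grad \<beta> (x - lattice_pt z)) powr s)))"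
      by (simp add: ennreal_mult ennreal_plus sum_ennreal sum_nonneg)
  qed
  also have "\<dots> = ennreal (2 powr s) * (\<integral>\<^sup>+x. (ennreal (norm (grad \<eta> x) powr s) + (\<Sum>z\<in>G. ennreal (norm (grad \<beta> (x - lattice_pt z)) powr s))) \<partial>lborel)"
    by (intro nn_integral_cmult) measurable
  also have "(\<integral>\<^sup>+x. (ennreal (norm (grad \<eta> x) powr s) + (\<Sum>z\<in>G. ennreal (norm (grad \<beta> (x - lattice_pt z)) powr s))) \<partial>lborel)
      = energy s \<eta> + (\<integral>\<^sup>+x. (\<Sum>z\<in>G. ennreal (norm (grad \<beta> (x - lattice_pt z)) powr s)) \<partial>lborel)"
    unfolding energy_def by (intro nn_integral_add) measurable
  also have "(\<integral>\<^sup>+x. (\<Sum>z\<in>G. ennreal (norm (grad \<beta> (x - lattice_pt z)) powr s)) \<partial>lborel)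
      = (\<Sum>z\<in>G. (\<integral>\<^sup>+x. ennreal (norm (grad \<beta> (x - lattice_pt z)) powr s) \<partial>lborel))"
    by (intro nn_integral_sum) measurable
  also have "\<dots> = of_nat (card G) * energy s \<beta>" by (simp add: Ecopy)
  also have "ennreal (2 powr s) * (energy s \<eta> + of_nat (card G) * energy s \<beta>)
      \<le> ennreal (2 powr s) * (ennreal (real N ^ ?d * real N powr (- s) * E) + of_nat (card G) * ennreal \<epsilon>)"
    using E\<eta> \<epsilon>(1) by (intro mult_left_mono add_mono) (auto simp: s_def)
  also have "of_nat (card G) * ennreal \<epsilon> = ennreal (real (4 * N + 3) ^ ?d * \<epsilon>)"
    using \<epsilon>(2) by (simp add: G(2) ennreal_mult ennreal_of_nat_eq_real_of_nat)
  also have "ennreal (2 powr s) * (ennreal (real N ^ ?d * real N powr (- s) * E) + ennreal (real (4 * N + 3) ^ ?d * \<epsilon>))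
      = ennreal (2 powr s * (real N ^ ?d * real N powr (- s) * E + real (4 * N + 3) ^ ?d * \<epsilon>))"
    using \<eta>(2) \<epsilon>(2) by (simp add: ennreal_mult ennreal_plus)
  finally have Eu: "energy s u \<le> ennreal (2 powr s * (real N ^ ?d * real N powr (- s) * E + real (4 * N + 3) ^ ?d * \<epsilon>))" .
  define v where "v = measure lborel (ball (0 :: real ^ 'n) (1/4))"
  define P where "P z = ball (lattice_pt z + (\<chi> i. 1/2)) (1/4)" for z :: "'n \<Rightarrow> int"
  define H :: "('n \<Rightarrow> int) set" where "H = lattice_box n"
  have H: "finite H" "card H = (2 * n + 1) ^ ?d" unfolding H_def by (rule lattice_box_card)+
  have Pcell: "P z \<subseteq> cell z" for z
    unfolding P_def by (rule order_trans[OF subset_ball half_ball_in_cell]) simp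
  have disj: "disjoint_family_on P H"
    unfolding disjoint_family_on_def
  proof (intro ballI impI)
    fix z z' :: "'n \<Rightarrow> int" assume "z \<noteq> z'"
    then obtain i where "z i \<noteq> z' i" by blast
    then have "cell z \<inter> cell z' = {}" by (auto simp: cell_def)
    then show "P z \<inter> P z' = {}" using Pcell[of z] Pcell[of z'] by blast
  qed
  have Pm: "P z \<in> sets lborel" for z by (simp add: P_def)
  have Pv: "emeasure lborel (P z) = ennreal v" for z
    by (simp add: P_def v_def measure_def emeasure_ball)
  have uP: "u x = 1" if z: "z \<in> H" and x: "x \<in> P z" for x z
  proof -
    have "norm x \<le> real ?d * real (n + 1)"
    proof (rule norm_le_of_components)
      fix i
      have "\<lfloor>x $ i\<rfloor> = z i" using Pcell x by (auto simp: cell_def)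
      moreover have "\<bar>z i\<bar> \<le> int n" using z by (simp add: H_def lattice_box_def)
      ultimately show "\<bar>x $ i\<bar> \<le> real (n + 1)" by linarith
    qed
    then have "\<eta> x = 1" by (intro \<eta>one) (simp only: N of_nat_mult)
    moreover have "S x = 0"
    proof (rule C(6))
      fix z'
      have "1/2 \<le> norm (lattice_pt z + (\<chi> i. 1/2) - lattice_pt z')" by (rule cell_centre_far)
      also have "\<dots> \<le> norm (lattice_pt z + (\<chi> i. 1/2) - x) + norm (x - lattice_pt z')"
        using dist_triangle[of "lattice_pt z + (\<chi> i. 1/2)" "lattice_pt z'" x] by (simp only: dist_norm)
      finally show "1/4 \<le> norm (x - lattice_pt z')" using x by (simp add: P_def dist_norm)
    qed
    ultimately show ?thesis by (simp add: u_def)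
  qed
  have "ennreal (real (2 * n + 1) ^ ?d * v) = (\<Sum>z\<in>H. emeasure lborel (P z))"
    by (simp add: Pv H(2) ennreal_mult ennreal_of_nat_eq_real_of_nat v_def)
  also have "\<dots> = emeasure lborel (\<Union>z\<in>H. P z)"
    using Pm by (intro sum_emeasure disj H(1)) auto
  also have "\<dots> = (\<integral>\<^sup>+x. indicator (\<Union>z\<in>H. P z) x \<partial>lborel)"
    using Pm H(1) by (intro nn_integral_indicator[symmetric] sets.finite_UN) auto
  also have "\<dots> \<le> mass s u"
    unfolding mass_def using uP by (intro nn_integral_mono) (auto simp: indicator_def)
  finally have Mu: "ennreal (real (2 * n + 1) ^ ?d * v) \<le> mass s u" .
  have r2: "r < 1/2" using r by simp
  have "ennreal (a powr s * (real (2 * n + 1) ^ ?d * v)) = ennreal (a powr s) * ennreal (real (2 * n + 1) ^ ?d * v)"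
    by (intro ennreal_mult) (auto simp: v_def)
  also have "\<dots> \<le> ennreal (a powr s) * mass s u" by (intro mult_left_mono Mu) simp
  also have "\<dots> \<le> energy s u"
    using le_lambda_root_iff[OF perforated_open perforated_nonempty[OF r2] q, of a] a uC by (auto simp: s_def)
  also note Eu
  finally show ?thesis
    using \<eta>(2) \<epsilon>(2) unfolding s_def[symmetric] v_def[symmetric] by (subst (asm) ennreal_le_iff) auto
qed

text \<open>After division by the number of cells the contribution of the cutoff tends to 0 as n tends to infinity.
  What remains bounds the frequency of the perforated space by the energy of the profile, that is by
  the capacity of a ball of radius 2 r.\<close>

lemma perforated_capacity_bound:
  fixes \<beta> :: "real ^ 'n::finite \<Rightarrow> real"
  assumes q: "1 \<le> q" "q \<noteq> top" and r: "0 < r" "r < 1/8"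
    and \<beta>: "\<beta> \<in> C1c (ball 0 (1/4))" "\<And>x. 0 \<le> \<beta> x" "\<And>x. \<beta> x \<le> 1" "\<And>x. norm x \<le> 2 * r \<Longrightarrow> \<beta> x = 1"
    and \<epsilon>: "energy (enn2real q) \<beta> \<le> ennreal \<epsilon>" "0 \<le> \<epsilon>"
    and a: "0 < a" "ennreal a \<le> lambda_root q (perforated r :: (real ^ 'n) set)"
  shows "a powr enn2real q * measure lborel (ball (0 :: real ^ 'n) (1/4))
    \<le> 2 powr enn2real q * (7 * real CARD('n)) ^ CARD('n) * \<epsilon>"
proof -
  define s where "s = enn2real q"
  define v where "v = measure lborel (ball (0 :: real ^ 'n) (1/4))"
  let ?d = "CARD('n)"
  have s: "1 \<le> s" using enn2real_ge_1(1)[OF q] by (simp add: s_def)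
  have d1: "1 \<le> real ?d" using zero_less_card_finite[where 'a='n] by linarith
  have bC: "(bump :: real ^ 'n \<Rightarrow> real) \<in> C1c (ball 0 2)" by (rule bump_C1c)
  obtain E where E: "energy s (bump :: real ^ 'n \<Rightarrow> real) = ennreal E" "0 \<le> E"
    using mass_finite(2)[OF bC s] by (cases "energy s (bump :: real ^ 'n \<Rightarrow> real)") auto
  define B where "B = 2 powr s * (7 * real ?d) ^ ?d * \<epsilon>"
  define D where "D = 2 powr s * real ?d ^ ?d * E"
  have D0: "0 \<le> D" using E by (simp add: D_def)
  have n: "a powr s * v \<le> D * inverse (real (Suc n)) + B" for n
  proof -
    define N where "N = ?d * (n + 1)"
    define X where "X = real (2 * n + 1)"
    have X: "1 \<le> X" by (simp add: X_def)
    have Nr: "real N = real ?d * real (n + 1)" by (simp only: N_def of_nat_mult)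
    have NX: "real N \<le> real ?d * X" unfolding Nr X_def by (intro mult_left_mono) auto
    have "1 * 1 \<le> real ?d * X" using d1 X by (intro mult_mono) auto
    then have NX': "real (4 * N + 3) \<le> 7 * real ?d * X" using NX by simp
    have "1 * real (Suc n) \<le> real ?d * real (n + 1)" using d1 by (intro mult_mono) auto
    then have Nn: "real (Suc n) \<le> real N" unfolding Nr by simp
    then have N1: "1 \<le> real N" by simp
    have "real N powr (- s) \<le> real N powr (- 1)" using s N1 by (intro powr_mono) auto
    also have "\<dots> = inverse (real N)" using N1 by (simp add: powr_minus)
    also have "\<dots> \<le> inverse (real (Suc n))" using Nn by (intro le_imp_inverse_le) auto
    finally have Ns: "real N powr (- s) \<le> inverse (real (Suc n))" .
    have "a powr s * (X ^ ?d * v)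
        \<le> 2 powr s * (real N ^ ?d * real N powr (- s) * E + real (4 * N + 3) ^ ?d * \<epsilon>)"
      using perforated_test_inequality[OF q r \<beta> \<epsilon> _ E(2) a N_def] E(1) by (simp add: s_def v_def X_def)
    also have "\<dots> \<le> 2 powr s * ((real ?d * X) ^ ?d * inverse (real (Suc n)) * E + (7 * real ?d * X) ^ ?d * \<epsilon>)"
      using NX NX' Ns E(2) \<epsilon>(2) by (intro mult_left_mono add_mono mult_right_mono mult_mono power_mono) auto
    also have "\<dots> = X ^ ?d * (D * inverse (real (Suc n)) + B)"
      by (simp add: D_def B_def power_mult_distrib algebra_simps)
    finally have "X ^ ?d * (a powr s * v) \<le> X ^ ?d * (D * inverse (real (Suc n)) + B)" by (simp add: mult_ac)
    then show ?thesis using X by (subst (asm) mult_le_cancel_left_pos) auto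
  qed
  have "(\<lambda>n. D * inverse (real (Suc n)) + B) \<longlonglongrightarrow> D * 0 + B"
    by (intro tendsto_intros LIMSEQ_inverse_real_of_nat)
  then have "a powr s * v \<le> D * 0 + B" by (rule LIMSEQ_le_const) (use n in blast)
  then show ?thesis by (simp add: B_def s_def v_def)
qed

section \<open>Vanishing capacity of points up to the dimension\<close>

lemma scaled_bump:
  fixes \<sigma> :: real
  assumes \<sigma>: "0 < \<sigma>" "\<sigma> \<le> 1/8"
  defines "\<beta> \<equiv> \<lambda>x :: real ^ 'n::finite. bump ((1 / \<sigma>) *\<^sub>R (x - 0))"
  shows "\<beta> \<in> C1c (ball 0 (1/4))" "0 \<le> \<beta> x" "\<beta> x \<le> 1" "norm x \<le> \<sigma> \<Longrightarrow> \<beta> x = 1"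
    and "energy s \<beta> = ennreal (\<sigma> ^ CARD('n) * \<sigma> powr (- s)) * energy s (bump :: real ^ 'n \<Rightarrow> real)"
    and "grad \<beta> x = (1 / \<sigma>) *\<^sub>R grad bump ((1 / \<sigma>) *\<^sub>R (x - 0))"
    and "norm x < \<sigma> \<or> 2 * \<sigma> \<le> norm x \<Longrightarrow> grad \<beta> x = 0"
    and "3/16 \<le> norm x \<Longrightarrow> \<beta> x = 0"
proof -
  have s0: "\<sigma> \<noteq> 0" using \<sigma> by simp
  have n: "norm ((1 / \<sigma>) *\<^sub>R (x - 0)) = norm x / \<sigma>" for x :: "real ^ 'n" using \<sigma> by simp
  have "(\<lambda>x. 0 + \<sigma> *\<^sub>R x) ` ball 0 2 \<subseteq> ball (0 :: real ^ 'n) (1/4)"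
    using \<sigma> unfolding affine_ball[OF \<sigma>(1)] by auto
  with C1c_affine(1)[OF bump_C1c s0, of 0] C1c_mono show "\<beta> \<in> C1c (ball 0 (1/4))" unfolding \<beta>_def by blast
  show "0 \<le> \<beta> x" "\<beta> x \<le> 1" by (simp_all add: \<beta>_def bump_values)
  show "\<beta> x = 1" if "norm x \<le> \<sigma>"
    unfolding \<beta>_def using that \<sigma> by (intro bump_values(3)) (simp only: n, simp)
  show "\<beta> x = 0" if "3/16 \<le> norm x"
  proof -
    have "\<sigma> * (3/2) \<le> norm x" using that \<sigma> by simp
    then have "3/2 \<le> norm x / \<sigma>" using \<sigma> by (simp add: le_divide_eq mult.commute)
    then show ?thesis unfolding \<beta>_def by (intro bump_values(4)) (simp only: n)
  qed
  show "energy s \<beta> = ennreal (\<sigma> ^ CARD('n) * \<sigma> powr (- s)) * energy s (bump :: real ^ 'n \<Rightarrow> real)"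
    unfolding \<beta>_def by (rule energy_affine[OF bump_C1c \<sigma>(1)])
  show g: "grad \<beta> x = (1 / \<sigma>) *\<^sub>R grad bump ((1 / \<sigma>) *\<^sub>R (x - 0))"
    unfolding \<beta>_def C1c_affine(2)[OF bump_C1c s0] ..
  show "grad \<beta> x = 0" if "norm x < \<sigma> \<or> 2 * \<sigma> \<le> norm x"
  proof -
    have "norm x / \<sigma> < 1 \<or> 3/2 < norm x / \<sigma>"
      using that \<sigma> by (auto simp: divide_less_eq less_divide_eq)
    then have "grad bump ((1 / \<sigma>) *\<^sub>R (x - 0)) = 0" by (intro grad_bump_eq_0) (simp only: n)
    then show ?thesis unfolding g by simp
  qed
qed

text \<open>In the critical case the energy is invariant under scaling. The transition from 1 to 0 is shared by k
  dyadic scales with disjoint gradients, each divided by k, so that the energy is multiplied by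
  k powr (1 - d).\<close>

lemma dyadic_bump:
  fixes k :: nat
  assumes k: "0 < k"
  obtains \<beta> :: "real ^ 'n::finite \<Rightarrow> real" and r where "0 < r" "r < 1/8"
    "\<beta> \<in> C1c (ball 0 (1/4))" "\<And>x. 0 \<le> \<beta> x" "\<And>x. \<beta> x \<le> 1" "\<And>x. norm x \<le> 2 * r \<Longrightarrow> \<beta> x = 1"
    "energy (real CARD('n)) \<beta> \<le> ennreal (real k powr (- real CARD('n)) * real k) * energy (real CARD('n)) (bump :: real ^ 'n \<Rightarrow> real)"
proof -
  let ?s = "real CARD('n)"
  define \<sigma> where "\<sigma> j = (1/8) * (1/2 :: real) ^ j" for j :: nat
  have \<sigma>: "0 < \<sigma> j" "\<sigma> j \<le> 1/8" for j by (auto simp: \<sigma>_def power_le_one)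
  have \<sigma>mono: "\<sigma> j \<le> \<sigma> i" if "i \<le> j" for i j using that by (auto simp: \<sigma>_def intro: power_decreasing)
  have \<sigma>2: "2 * \<sigma> j \<le> \<sigma> i" if "i < j" for i j
    using \<sigma>mono[of "Suc i" j] that by (simp add: \<sigma>_def)
  define b where "b j = (\<lambda>x :: real ^ 'n. bump ((1 / \<sigma> j) *\<^sub>R (x - 0)))" for j
  have b_eq: "bump ((1 / \<sigma> j) *\<^sub>R (x - 0)) = b j x" for j x by (simp add: b_def)
  note B = scaled_bump[OF \<sigma>, where 'n='n, unfolded b_eq]
  define \<beta> where "\<beta> = (\<lambda>x. (1 / real k) * (\<Sum>j<k. b j x))"
  let ?g = "\<lambda>x. (1 / real k) *\<^sub>R (\<Sum>j<k. grad (b j) x)"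
  have der: "(\<beta> has_derivative (\<lambda>h. ?g x \<bullet> h)) (at x)" for x
  proof -
    have "((\<lambda>x. \<Sum>j<k. b j x) has_derivative (\<lambda>h. \<Sum>j<k. grad (b j) x \<bullet> h)) (at x)"
      by (intro has_derivative_sum C1c_derivative[OF B(1)])
    from has_derivative_mult_right[OF this, of "1 / real k"] show ?thesis
      by (simp add: \<beta>_def inner_sum_left)
  qed
  have cont: "continuous_on UNIV ?g"
    by (intro continuous_intros C1c_continuous_grad[OF B(1)])
  have supp: "\<beta> x = 0" if "x \<notin> cball 0 (3/16)" for x
    using that B(8)[of x] by (simp add: \<beta>_def)
  have sub: "cball (0 :: real ^ 'n) (3/16) \<subseteq> ball 0 (1/4)" by auto
  have C: "\<beta> \<in> C1c (ball 0 (1/4))" "grad \<beta> = ?g"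
    using C1cI[OF der cont compact_cball sub supp] by auto
  define r where "r = \<sigma> (k - 1) / 2"
  have r: "0 < r" "r < 1/8" using \<sigma>[of "k - 1"] by (auto simp: r_def)
  have b0: "0 \<le> \<beta> x" for x using B(2) by (simp add: \<beta>_def sum_nonneg)
  have b1: "\<beta> x \<le> 1" for x
  proof -
    have "(\<Sum>j<k. b j x) \<le> (\<Sum>j<k. 1)" by (intro sum_mono B(3))
    then show ?thesis using k by (simp add: \<beta>_def divide_le_eq)
  qed
  have b2: "\<beta> x = 1" if "norm x \<le> 2 * r" for x
  proof -
    have "b j x = 1" if "j < k" for j
    proof (rule B(4))
      have "j \<le> k - 1" using that by simp
      from \<sigma>mono[OF this] show "norm x \<le> \<sigma> j" using \<open>norm x \<le> 2 * r\<close> by (simp add: r_def)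
    qed
    then show ?thesis using k by (simp add: \<beta>_def)
  qed
  have d1: "1 \<le> ?s" using zero_less_card_finite[where 'a='n] by linarith
  have pw: "norm (?g x) powr ?s \<le> real k powr (- ?s) * (\<Sum>j<k. norm (grad (b j) x) powr ?s)" for x
  proof -
    have "norm (\<Sum>j<k. grad (b j) x) powr ?s \<le> (\<Sum>j<k. norm (grad (b j) x) powr ?s)"
    proof (cases "\<exists>j<k. grad (b j) x \<noteq> 0")
      case True
      then obtain i where i: "i < k" "grad (b i) x \<noteq> 0" by blast
      have ix: "\<sigma> i \<le> norm x" "norm x < 2 * \<sigma> i" using B(7)[of x i] i(2) by (auto simp: not_less[symmetric])
      have "grad (b j) x = 0" if ne: "j \<noteq> i" for j
      proof (rule B(7))
        consider "j < i" | "i < j" using ne by linarith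
        then show "norm x < \<sigma> j \<or> 2 * \<sigma> j \<le> norm x"
        proof cases
          case 1 then show ?thesis using \<sigma>2[of j i] ix by auto
        next
          case 2 then show ?thesis using \<sigma>2[of i j] ix by auto
        qed
      qed
      then have "(\<Sum>j<k. grad (b j) x) = (\<Sum>j<k. if j = i then grad (b i) x else 0)" by (intro sum.cong) auto
      also have "\<dots> = grad (b i) x" using i(1) by simp
      finally have "norm (\<Sum>j<k. grad (b j) x) powr ?s = norm (grad (b i) x) powr ?s" by simp
      also have "\<dots> \<le> (\<Sum>j<k. norm (grad (b j) x) powr ?s)" using i(1) by (intro member_le_sum) auto
      finally show ?thesis .
    next
      case False
      then have "(\<Sum>j<k. grad (b j) x) = 0" by (intro sum.neutral) auto
      then show ?thesis using d1 by (simp add: sum_nonneg)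
    qed
    moreover have "norm (?g x) powr ?s = real k powr (- ?s) * norm (\<Sum>j<k. grad (b j) x) powr ?s"
    proof -
      have "norm (?g x) = norm (\<Sum>j<k. grad (b j) x) / real k" by simp
      then show ?thesis using k by (simp add: powr_divide powr_minus_divide)
    qed
    ultimately show ?thesis by (simp add: mult_left_mono)
  qed
  have "energy ?s \<beta> \<le> (\<integral>\<^sup>+x. ennreal (real k powr (- ?s)) * (\<Sum>j<k. ennreal (norm (grad (b j) x) powr ?s)) \<partial>lborel)"
    unfolding energy_def C(2)
  proof (rule nn_integral_mono)
    fix x :: "real ^ 'n"
    have "ennreal (norm (?g x) powr ?s) \<le> ennreal (real k powr (- ?s) * (\<Sum>j<k. norm (grad (b j) x) powr ?s))"
      by (rule ennreal_leI[OF pw])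
    then show "ennreal (norm (?g x) powr ?s) \<le> ennreal (real k powr (- ?s)) * (\<Sum>j<k. ennreal (norm (grad (b j) x) powr ?s))"
      by (simp add: ennreal_mult sum_ennreal sum_nonneg)
  qed
  also have "\<dots> = ennreal (real k powr (- ?s)) * (\<integral>\<^sup>+x. (\<Sum>j<k. ennreal (norm (grad (b j) x) powr ?s)) \<partial>lborel)"
    using C1c_measurable(2)[OF B(1)] by (intro nn_integral_cmult) measurable
  also have "(\<integral>\<^sup>+x. (\<Sum>j<k. ennreal (norm (grad (b j) x) powr ?s)) \<partial>lborel) = (\<Sum>j<k. energy ?s (b j))"
    unfolding energy_def using C1c_measurable(2)[OF B(1)] by (intro nn_integral_sum) measurable
  also have "\<dots> = (\<Sum>j<k. energy ?s (bump :: real ^ 'n \<Rightarrow> real))"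
  proof (intro sum.cong refl)
    fix j
    have "\<sigma> j ^ CARD('n) * \<sigma> j powr (- ?s) = 1"
      using \<sigma>(1)[of j] by (simp add: powr_minus powr_realpow)
    then show "energy ?s (b j) = energy ?s (bump :: real ^ 'n \<Rightarrow> real)" using B(5)[of ?s j] by simp
  qed
  also have "\<dots> = ennreal (real k) * energy ?s (bump :: real ^ 'n \<Rightarrow> real)"
    by (simp add: ennreal_of_nat_eq_real_of_nat)
  also have "ennreal (real k powr (- ?s)) * (ennreal (real k) * energy ?s (bump :: real ^ 'n \<Rightarrow> real))
      = ennreal (real k powr (- ?s) * real k) * energy ?s (bump :: real ^ 'n \<Rightarrow> real)"
    by (simp add: ennreal_mult mult.assoc)
  finally show ?thesis using that[OF r C(1) b0 b1 b2] by blast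
qed

lemma powr_at_right_0:
  fixes c B \<delta> :: real
  assumes "0 < \<delta>"
  shows "((\<lambda>r. B * r powr \<delta>) \<longlongrightarrow> 0) (at_right 0)"
proof -
  have "((\<lambda>r. B * r powr \<delta>) \<longlongrightarrow> B * 0 powr \<delta>) (at_right 0)"
    using assms by (intro tendsto_intros) (auto simp: eventually_at_right_less less_imp_le eventually_mono[OF eventually_at_right_less])
  then show ?thesis by simp
qed

text \<open>Points have capacity 0: below the dimension by scaling the bump, whose energy is homogeneous of degree
  d - s, and at the dimension d \<ge> 2 by the dyadic bump.\<close>

lemma small_capacity:
  assumes s: "1 \<le> s" "s \<le> real CARD('n::finite)" and d: "2 \<le> CARD('n)" and \<epsilon>: "0 < \<epsilon>"
  obtains \<beta> :: "real ^ 'n \<Rightarrow> real" and r where "0 < r" "r < 1/8"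
    "\<beta> \<in> C1c (ball 0 (1/4))" "\<And>x. 0 \<le> \<beta> x" "\<And>x. \<beta> x \<le> 1" "\<And>x. norm x \<le> 2 * r \<Longrightarrow> \<beta> x = 1"
    "energy s \<beta> \<le> ennreal \<epsilon>"
proof -
  have bC: "(bump :: real ^ 'n \<Rightarrow> real) \<in> C1c (ball 0 2)" by (rule bump_C1c)
  obtain E where E: "energy s (bump :: real ^ 'n \<Rightarrow> real) = ennreal E" "0 \<le> E"
    using mass_finite(2)[OF bC s(1)] by (cases "energy s (bump :: real ^ 'n \<Rightarrow> real)") auto
  show ?thesis
  proof (cases "s = real CARD('n)")
    case True
    obtain k :: nat where k: "E / \<epsilon> < real k" using reals_Archimedean2 by blast
    moreover have "0 \<le> E / \<epsilon>" using E \<epsilon> by simp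
    ultimately have "0 < real k" by linarith
    then have k0: "0 < k" by simp
    then have k1: "1 \<le> real k" by simp
    have "real k powr (- s) * real k \<le> real k powr (- 2) * real k"
      using k1 d True by (intro mult_right_mono powr_mono) auto
    also have "\<dots> = 1 / real k" using k0 by (simp add: powr_minus powr_numeral power2_eq_square divide_inverse)
    finally have "real k powr (- s) * real k * E \<le> 1 / real k * E" using E by (intro mult_right_mono) auto
    also have "\<dots> \<le> \<epsilon>" using k k0 \<epsilon> by (simp add: field_simps)
    finally have le: "real k powr (- s) * real k * E \<le> \<epsilon>" .
    obtain \<beta> :: "real ^ 'n \<Rightarrow> real" and r where \<beta>: "0 < r" "r < 1/8"
      "\<beta> \<in> C1c (ball 0 (1/4))" "\<And>x. 0 \<le> \<beta> x" "\<And>x. \<beta> x \<le> 1" "\<And>x. norm x \<le> 2 * r \<Longrightarrow> \<beta> x = 1"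
      "energy (real CARD('n)) \<beta> \<le> ennreal (real k powr (- real CARD('n)) * real k) * energy (real CARD('n)) (bump :: real ^ 'n \<Rightarrow> real)"
      by (rule dyadic_bump[OF k0]; rule that; assumption)
    have "energy s \<beta> \<le> ennreal (real k powr (- s) * real k * E)"
      using \<beta>(7)[folded True] E by (simp add: ennreal_mult)
    also have "\<dots> \<le> ennreal \<epsilon>" using le by (rule ennreal_leI)
    finally show ?thesis using that[OF \<beta>(1-6)] by blast
  next
    case False
    define \<delta> where "\<delta> = real CARD('n) - s"
    have \<delta>: "0 < \<delta>" using False s by (simp add: \<delta>_def)
    have "\<forall>\<^sub>F \<sigma> in at_right 0. E * \<sigma> powr \<delta> < \<epsilon>"
      by (rule order_tendstoD(2)[OF powr_at_right_0[OF \<delta>] \<epsilon>])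
    moreover have "\<forall>\<^sub>F \<sigma> in at_right 0. \<sigma> < (1/8 :: real)"
      by (rule eventually_mono[OF eventually_at_right_real[of 0 "1/8"]]) auto
    moreover have "\<forall>\<^sub>F \<sigma> in at_right 0. 0 < (\<sigma> :: real)" by (rule eventually_at_right_less)
    ultimately have "\<forall>\<^sub>F \<sigma> in at_right 0. E * \<sigma> powr \<delta> < \<epsilon> \<and> \<sigma> < 1/8 \<and> 0 < \<sigma>"
      by (simp add: eventually_conj_iff)
    then obtain \<sigma> where \<sigma>: "E * \<sigma> powr \<delta> < \<epsilon>" "\<sigma> < 1/8" "0 < \<sigma>"
      using eventually_happens[of _ "at_right (0::real)"] by auto
    define \<beta> where "\<beta> = (\<lambda>x :: real ^ 'n. bump ((1 / \<sigma>) *\<^sub>R (x - 0)))"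
    have s8: "\<sigma> \<le> 1/8" using \<sigma> by simp
    have b_eq: "bump ((1 / \<sigma>) *\<^sub>R (x - 0)) = \<beta> x" for x by (simp add: \<beta>_def)
    note B = scaled_bump[OF \<sigma>(3) s8, where 'n='n, unfolded b_eq]
    have "\<sigma> ^ CARD('n) * \<sigma> powr (- s) = \<sigma> powr \<delta>"
      using \<sigma>(3) by (simp add: \<delta>_def powr_realpow[symmetric] powr_add[symmetric])
    then have "energy s \<beta> = ennreal (\<sigma> powr \<delta> * E)"
      using B(5)[of s] E by (simp add: ennreal_mult)
    also have "\<dots> \<le> ennreal \<epsilon>" using \<sigma>(1) by (intro ennreal_leI) (simp add: mult.commute)
    finally have e: "energy s \<beta> \<le> ennreal \<epsilon>" .
    have b: "\<And>x. norm x \<le> 2 * (\<sigma> / 2) \<Longrightarrow> \<beta> x = 1" using B(4) by simp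
    show ?thesis by (rule that[where r="\<sigma> / 2" and \<beta>=\<beta>, OF _ _ B(1-3) b e]) (use \<sigma> in auto)
  qed
qed

section \<open>Unboundedness up to the dimension\<close>

text \<open>If the supremum were finite, lower bounds on the frequency of order p of the perforated domains would
  pass to that of order q, which is bounded by capacities. For p above the dimension d the lower bounds
  are uniform in r, while the capacities can be made arbitrarily small. For p \<le> d an exponent b between
  d / p and d / q gives a lower bound proportional to r powr (b - 1), against an upper bound
  proportional to the smaller power r powr (d / q - 1) as r tends to 0.\<close>

lemma M_sup_infinite:
  assumes q: "1 \<le> q" "q \<le> of_nat CARD('n::finite)" and qp: "q < p" and d: "2 \<le> CARD('n)"
  shows "M_sup TYPE('n) p q = top"
proof (rule ccontr)
  assume "M_sup TYPE('n) p q \<noteq> top"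
  then obtain m where m: "M_sup TYPE('n) p q = ennreal m" "0 \<le> m" by (cases "M_sup TYPE('n) p q") auto
  have qtop: "q \<noteq> top" using qp by auto
  have p1: "1 \<le> p" using q(1) qp by (simp add: less_imp_le order_trans)
  define s where "s = enn2real q"
  have s: "1 \<le> s" "q = ennreal s" using enn2real_ge_1[OF q(1) qtop] by (simp_all add: s_def)
  have sd: "s \<le> real CARD('n)"
    using q(2) s unfolding s(2) ennreal_of_nat_eq_real_of_nat by (simp add: ennreal_le_iff)
  define v where "v = measure lborel (ball (0 :: real ^ 'n) (1/4))"
  have v: "0 < v" unfolding v_def using content_ball_pos[of "1/4" "0 :: real ^ 'n"] by simp
  define B where "B = 2 powr s * (7 * real CARD('n)) ^ CARD('n)"
  have B: "0 < B" using zero_less_card_finite[where 'a='n] by (simp add: B_def)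
  have key: "(c / (m + 1)) powr s * v \<le> B * \<epsilon>"
    if r: "0 < r" "r < 1/8" and c: "0 < c" "ennreal c \<le> lambda_root p (perforated r :: (real ^ 'n) set)"
      and \<beta>: "\<beta> \<in> C1c (ball (0 :: real ^ 'n) (1/4))" "\<And>x. 0 \<le> \<beta> x" "\<And>x. \<beta> x \<le> 1" "\<And>x. norm x \<le> 2 * r \<Longrightarrow> \<beta> x = 1"
        "energy s \<beta> \<le> ennreal \<epsilon>" "0 \<le> \<epsilon>"
    for r c \<beta> \<epsilon>
  proof -
    let ?\<Omega> = "perforated r :: (real ^ 'n) set"
    have r2: "r < 1/2" using r by simp
    have O: "open ?\<Omega>" "?\<Omega> \<noteq> {}" using perforated_open perforated_nonempty[OF r2] by auto
    have L: "0 < lambda_root q ?\<Omega>" "lambda_root q ?\<Omega> < top"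
      using perforated_admissible[OF q(1) r(1) r2] lambda_root_finite[OF O q(1)] by auto
    then obtain y where y: "lambda_root q ?\<Omega> = ennreal y" "0 < y" by (cases "lambda_root q ?\<Omega>") auto
    have "Fratio p q ?\<Omega> \<le> ennreal m"
      unfolding m(1)[symmetric] M_sup_def using O L lambda_pos_iff[OF O q(1)] by (intro SUP_upper) auto
    then have "lambda_root p ?\<Omega> \<le> ennreal m * lambda_root q ?\<Omega>"
      using ennreal_divide_less_iff(2)[OF L, of "ennreal m" "lambda_root p ?\<Omega>"]
      by (simp add: Fratio_def flip: not_less)
    with c(2) have "ennreal c \<le> ennreal (m * y)" using m(2) y by (simp add: ennreal_mult)
    then have "c \<le> m * y" using m(2) y by (subst (asm) ennreal_le_iff) auto
    also have "\<dots> \<le> (m + 1) * y" using y by simp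
    finally have "c / (m + 1) \<le> y" using m(2) by (simp add: divide_le_eq mult.commute)
    then have "ennreal (c / (m + 1)) \<le> lambda_root q ?\<Omega>" unfolding y(1) by (rule ennreal_leI)
    from perforated_capacity_bound[OF q(1) qtop r \<beta>(1-4) _ \<beta>(6) _ this] \<beta>(5) c(1) m(2)
    show ?thesis by (simp add: s_def v_def B_def)
  qed
  have contra: False
    if c: "0 < c" "\<And>r. 0 < r \<Longrightarrow> r < 1/8 \<Longrightarrow> ennreal c \<le> lambda_root p (perforated r :: (real ^ 'n) set)" for c
  proof -
    define A where "A = (c / (m + 1)) powr s * v"
    have A: "0 < A" using c(1) m(2) v by (simp add: A_def)
    define \<epsilon> where "\<epsilon> = A / (2 * B)"
    have \<epsilon>: "0 < \<epsilon>" using A B by (simp add: \<epsilon>_def)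
    obtain \<beta> :: "real ^ 'n \<Rightarrow> real" and r where \<beta>: "0 < r" "r < 1/8"
      "\<beta> \<in> C1c (ball 0 (1/4))" "\<And>x. 0 \<le> \<beta> x" "\<And>x. \<beta> x \<le> 1" "\<And>x. norm x \<le> 2 * r \<Longrightarrow> \<beta> x = 1"
      "energy s \<beta> \<le> ennreal \<epsilon>"
      by (rule small_capacity[OF s(1) sd d \<epsilon>]; rule that; assumption)
    have "A \<le> B * \<epsilon>"
      unfolding A_def using key[OF \<beta>(1,2) c(1) c(2)[OF \<beta>(1,2)] \<beta>(3-7)] \<epsilon> by simp
    also have "\<dots> = A / 2" using B by (simp add: \<epsilon>_def)
    finally show False using A by simp
  qed
  show False
  proof (cases "p = top")
    case True
    show False
      by (rule contra[of "1 / real CARD('n)"]) (use perforated_lambda_root_top True in auto)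
  next
    case ptop: False
    define t where "t = enn2real p"
    have t: "1 \<le> t" "p = ennreal t" using enn2real_ge_1[OF p1 ptop] by (simp_all add: t_def)
    have st: "s < t" using qp s t by (simp add: ennreal_less_iff)
    show False
    proof (cases "real CARD('n) < t")
      case True
      define b where "b = real CARD('n) / t"
      have b: "real CARD('n) \<le> b * enn2real p" "b < 1" "b \<noteq> 1" using True t(1) by (auto simp: b_def t_def)
      show False
      proof (rule contra)
        show "0 < 1 / (real CARD('n) * (1 / (1 - b)))" using b by simp
        fix r :: real assume r: "0 < r" "r < 1/8"
        show "ennreal (1 / (real CARD('n) * (1 / (1 - b)))) \<le> lambda_root p (perforated r :: (real ^ 'n) set)"
          using r b by (intro perforated_lambda_root_ge[OF p1 ptop _ _ b(1,3)] divide_right_mono) auto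
      qed
    next
      case False
      let ?d = "real CARD('n)"
      \<comment> \<open>Any exponent strictly between d / p and d / q will do.\<close>
      define b where "b = (?d / t + ?d / s) / 2"
      have "?d / t < ?d / s" using st s(1) by (intro divide_strict_left_mono) auto
      moreover have "x < (x + y) / 2 \<and> (x + y) / 2 < y" if "x < y" for x y :: real using that by auto
      ultimately have b: "?d / t < b" and b': "b < ?d / s" unfolding b_def by blast+
      have "1 \<le> ?d / t" using False t(1) by simp
      then have b1: "1 < b" using b by linarith
      have bt: "?d \<le> b * enn2real p" "b \<noteq> 1"
        using b t(1) b1 by (auto simp: t_def[symmetric] divide_less_eq mult.commute)
      define \<delta> where "\<delta> = ?d - b * s"
      have \<delta>: "0 < \<delta>" using b' s(1) by (simp add: \<delta>_def less_divide_eq)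
      have bC: "(bump :: real ^ 'n \<Rightarrow> real) \<in> C1c (ball 0 2)" by (rule bump_C1c)
  obtain E where E: "energy s (bump :: real ^ 'n \<Rightarrow> real) = ennreal E" "0 \<le> E"
        using mass_finite(2)[OF bC s(1)] by (cases "energy s (bump :: real ^ 'n \<Rightarrow> real)") auto
      define A where "A = ((b - 1) / (?d * (m + 1))) powr s * ?d powr (- ((b - 1) * s)) * v"
      have A: "0 < A" using b1 m(2) v by (simp add: A_def)
      define D where "D = B * (2 powr (?d - s) * E)"
      have le: "A \<le> D * r powr \<delta>" if r: "0 < r" "r < 1/16" for r
      proof -
        define c where "c = (b - 1) / ?d * (r / ?d) powr (b - 1)"
        have c0: "0 < c" using b1 r by (simp add: c_def)
        define W where "W = (r / ?d) powr (1 - b) / (b - 1)"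
        have "(1 - (r / ?d) powr (1 - b)) / (1 - b) = ((r / ?d) powr (1 - b) - 1) / (b - 1)"
          using b1 by (simp add: divide_simps) (simp add: algebra_simps)
        also have "\<dots> \<le> W" unfolding W_def using b1 by (intro divide_right_mono) auto
        finally have W: "(1 - (r / ?d) powr (1 - b)) / (1 - b) \<le> W" .
        have "1 / (?d * W) = c"
        proof -
          have "(r / ?d) powr (1 - b) = 1 / (r / ?d) powr (b - 1)"
            using powr_minus_divide[of "r / ?d" "b - 1"] by simp
          then show ?thesis by (simp add: W_def c_def)
        qed
        then have cL: "ennreal c \<le> lambda_root p (perforated r :: (real ^ 'n) set)"
          using perforated_lambda_root_ge[OF p1 ptop r(1) _ bt W] r by simp
        have r8: "0 < 2 * r" "2 * r \<le> 1/8" "r < 1/8" using r by auto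
        define \<beta> where "\<beta> = (\<lambda>x :: real ^ 'n. bump ((1 / (2 * r)) *\<^sub>R (x - 0)))"
        have b_eq: "bump ((1 / (2 * r)) *\<^sub>R (x - 0)) = \<beta> x" for x by (simp add: \<beta>_def)
        note S = scaled_bump[OF r8(1,2), where 'n='n, unfolded b_eq]
        have rd: "(2 * r) ^ CARD('n) * (2 * r) powr (- s) = 2 powr (?d - s) * r powr (?d - s)"
        proof -
          have "(2 * r) ^ CARD('n) * (2 * r) powr (- s) = (2 * r) powr (?d - s)"
            by (simp only: powr_realpow[OF r8(1), symmetric] powr_add[symmetric] diff_conv_add_uminus)
          also have "\<dots> = 2 powr (?d - s) * r powr (?d - s)" by (simp add: powr_mult)
          finally show ?thesis .
        qed
        define \<epsilon> where "\<epsilon> = 2 powr (?d - s) * r powr (?d - s) * E"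
        have \<epsilon>: "energy s \<beta> \<le> ennreal \<epsilon>" "0 \<le> \<epsilon>"
          using S(5)[of s] E unfolding rd by (simp_all add: \<epsilon>_def ennreal_mult)
        have "(c / (m + 1)) powr s * v \<le> B * \<epsilon>"
          by (rule key[OF r(1) r8(3) c0 cL S(1-4) \<epsilon>])
        moreover have "(c / (m + 1)) powr s * v = A * r powr ((b - 1) * s)"
        proof -
          have "c / (m + 1) = (b - 1) / (?d * (m + 1)) * (?d powr (- (b - 1)) * r powr (b - 1))"
          proof -
            have "(r / ?d) powr (b - 1) = ?d powr (- (b - 1)) * r powr (b - 1)"
              using r by (simp only: powr_minus_divide) (simp add: powr_divide)
            then show ?thesis by (simp only: c_def) simp
          qed
          then have "(c / (m + 1)) powr s
              = ((b - 1) / (?d * (m + 1))) powr s * ((?d powr (- (b - 1))) powr s * (r powr (b - 1)) powr s)"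
            by (simp only: powr_mult)
          also have "(?d powr (- (b - 1))) powr s = ?d powr (- ((b - 1) * s))"
            by (simp add: powr_powr algebra_simps)
          also have "(r powr (b - 1)) powr s = r powr ((b - 1) * s)" by (simp add: powr_powr)
          finally show ?thesis by (simp add: A_def mult_ac)
        qed
        moreover have "B * \<epsilon> = D * r powr \<delta> * r powr ((b - 1) * s)"
        proof -
          have "r powr \<delta> * r powr ((b - 1) * s) = r powr (?d - s)"
            by (simp add: powr_add[symmetric] \<delta>_def algebra_simps)
          then show ?thesis by (simp add: D_def \<epsilon>_def mult_ac)
        qed
        ultimately have "A * r powr ((b - 1) * s) \<le> D * r powr \<delta> * r powr ((b - 1) * s)" by simp
        then show ?thesis using r by (subst (asm) mult_le_cancel_right_pos) auto
      qed
      have "\<forall>\<^sub>F r in at_right 0. A \<le> D * r powr \<delta>"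
        using eventually_at_right_real[of 0 "1/16"] by (rule eventually_mono) (use le in auto)
      from tendsto_lowerbound[OF powr_at_right_0[OF \<delta>] this] have "A \<le> 0" by simp
      with A show False by simp
    qed
  qed
qed

theorem theorem1p1:
  fixes p q :: ennreal
  assumes "1 \<le> q" and "q \<le> p"
  shows "(\<exists>(\<Omega>m :: (real ^ 'n::finite) set) (\<Omega>M :: (real ^ 'n) set).
            open \<Omega>m \<and> \<Omega>m \<noteq> {} \<and> smooth_boundary \<Omega>m \<and> Fratio_defined p q \<Omega>m \<and>
            open \<Omega>M \<and> \<Omega>M \<noteq> {} \<and> smooth_boundary \<Omega>M \<and> Fratio_defined p q \<Omega>M \<and>
            Fratio p q \<Omega>m = m_inf TYPE('n) p q \<and>
            Fratio p q \<Omega>M = M_sup TYPE('n) p q) \<and>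
         (q < p \<and> \<not> (CARD('n) = 1 \<and> q = 1) \<longrightarrow>
            (M_sup TYPE('n) p q < top \<longleftrightarrow> of_nat CARD('n) < q))"
proof (intro conjI impI)
  have p: "1 \<le> p" using assms by (rule order_trans)
  show "\<exists>(\<Omega>m :: (real ^ 'n) set) (\<Omega>M :: (real ^ 'n) set).
            open \<Omega>m \<and> \<Omega>m \<noteq> {} \<and> smooth_boundary \<Omega>m \<and> Fratio_defined p q \<Omega>m \<and>
            open \<Omega>M \<and> \<Omega>M \<noteq> {} \<and> smooth_boundary \<Omega>M \<and> Fratio_defined p q \<Omega>M \<and>
            Fratio p q \<Omega>m = m_inf TYPE('n) p q \<and>
            Fratio p q \<Omega>M = M_sup TYPE('n) p q"
    using extremal_m[OF assms(1) p, where 'n='n] extremal_M[OF assms(1) p, where 'n='n] by blast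
  assume H: "q < p \<and> \<not> (CARD('n) = 1 \<and> q = 1)"
  show "M_sup TYPE('n) p q < top \<longleftrightarrow> of_nat CARD('n) < q"
  proof
    assume "of_nat CARD('n) < q"
    then show "M_sup TYPE('n) p q < top" using H by (intro M_sup_finite assms(2)) auto
  next
    assume M: "M_sup TYPE('n) p q < top"
    show "of_nat CARD('n) < q"
    proof (rule ccontr)
      assume "\<not> of_nat CARD('n) < q"
      then have q: "q \<le> of_nat CARD('n)" by simp
      have "CARD('n) \<noteq> 1"
      proof
        assume "CARD('n) = 1"
        with q assms(1) H show False by auto
      qed
      moreover have "0 < CARD('n)" by simp
      ultimately have "2 \<le> CARD('n)" by linarith
      with M_sup_infinite[OF assms(1) q] H M show False by simp
    qed
  qed
qed

end
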